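(* Let $f\in L^2(\Omega,L^2(D))$, let $u^\varepsilon$ be the weak solution of $$-\Delta u^\varepsilon-k^2\alpha^2u^\varepsilon=f\ \text{ in } D,\qquad \partial_\nu u^\varepsilon+\mathbf{i}k\alpha u^\varepsilon=0\ \text{ on }\partial D,$$ let $\{u_n\}_{n\ge0}\subset L^2(\Omega,H^1(D))$ be the mode functions, i.e. the weak solutions of $$-\Delta u_0-k^2u_0=f,\qquad -\Delta u_n-k^2u_n=2k^2\eta u_{n-1}+k^2\eta^2u_{n-2}\ (n\ge1)\quad\text{in } D,$$ $$\partial_\nu u_n+\mathbf{i}ku_n=-\mathbf{i}k\eta u_{n-1}\ (n\ge0)\quad\text{on }\partial D,\qquad u_{-1}:\equiv0,$$ and let $U^\varepsilon_N:=\sum_{n=0}^{N-1}\varepsilon^nu_n$ for $N\ge1$. Let $\sigma:=4\varepsilon C_0^{1/2}(1+k)$. If $\varepsilon(2+\varepsilon)<\gamma_0$ and $\sigma<1$, then for $j=0,1$ $$\mathbb{E}\bigl(\|u^\varepsilon-U^\varepsilon_N\|_{H^j(D)}^2\bigr)\le\frac{9C_0\,\sigma^{2N}}{32(1+k)^2}\Bigl(k^j+\frac1k\Bigr)^4\,\mathbb{E}\bigl(\|f\|_{L^2(D)}^2\bigr).$$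
   Context: $D\subset B_1(0)\subset\mathbb{R}^d$ ($d\in\{1,2,3\}$) is a convex bounded polygonal domain with unit outward normal $\nu$, star-shaped with respect to the origin: there is $c_0>0$ with $x\cdot\nu\ge c_0$ on $\partial D$. It is assumed that $k\ge1$ and $\varepsilon>0$ (normalization: $k\ge 1$, $D\subset B_1(0)$, $R=1$). $(\Omega,\mathcal F,P)$ is a probability space with expectation $\mathbb{E}$. $\alpha=1+\varepsilon\eta$, where $\eta\in L^2(\Omega,L^\infty(D))$ is real-valued with $\|\eta(\omega,\cdot)\|_{L^\infty(D)}\le1$ almost surely, and the boundary values of $\eta$ on $\partial D$ are also bounded by $1$ in absolute value a.s. Function spaces are complex-valued; $H^0(D)=L^2(D)$; $(w,v)_D=\int_Dw\overline v\,dx$, $\langle w,v\rangle_{\partial D}=\int_{\partial D}w\overline v\,dS$. Weak solution of $-\Delta u-k^2\alpha^2u=f$ in $D$, $\partial_\nu u+\mathbf{i}k\alpha u=g$ on $\partial D$: $u\in L^2(\Omega,H^1(D))$ with $\int_\Omega\bigl[(\nabla u,\nabla v)_D-k^2(\alpha^2u,v)_D+\mathbf{i}k\langle\alpha u,v\rangle_{\partial D}\bigr]dP=\int_\Omega[(f,v)_D+\langle g,v\rangle_{\partial D}]\,dP$ for all $v\in L^2(\Omega,H^1(D))$. For the mode functions the same definition is used with $\alpha\equiv1$ and the respective right-hand sides. $\gamma_0:=\min\{1,\frac{13-2d}{2(4d-7)+25k}\}$. $C_0>0$ is a constant independent of $k$ and $u$ such that, whenever $\varepsilon\ge0$ and $\varepsilon(2+\varepsilon)<\gamma_0$,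 every weak solution $u$ with data $f\in L^2(\Omega,L^2(D))$, $g\in L^2(\Omega,L^2(\partial D))$ satisfies, with $M(f,g)=\mathbb{E}(\|f\|_{L^2(D)}^2+\|g\|_{L^2(\partial D)}^2)$, both $\mathbb{E}(\|u\|_{L^2(D)}^2+\|u\|_{L^2(\partial D)}^2+c_0\|\nabla u\|_{L^2(\partial D)}^2)\le C_0(\frac1k+\frac1{k^2})^2M(f,g)$ and $\mathbb{E}(\|u\|_{H^1(D)}^2)\le C_0(1+\frac1{k^2})^2M(f,g)$. *)

theory Defs
  imports "HOL-Probability.Probability"
begin

section \<open>Polygonal domains and surface measure\<close>

text \<open>An open convex set whose closure is a polytope; in dimension one this is a bounded
  open interval, in dimension three a convex polyhedron.\<close>

definition convex_polygonal_domain :: "(real^'d) set \<Rightarrow> bool" where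
  "convex_polygonal_domain D \<longleftrightarrow> open D \<and> convex D \<and> D \<noteq> {} \<and> polytope (closure D)"

text \<open>The vector \<open>n\<close> is the outer unit normal of a facet through \<open>x\<close>.  It is unique for \<open>x\<close> in
  the relative interior of a facet; on the lower-dimensional faces the normals of all
  adjacent facets qualify.\<close>

definition outward_normal :: "(real^'d) set \<Rightarrow> real^'d \<Rightarrow> real^'d \<Rightarrow> bool" where
  "outward_normal D x n \<longleftrightarrow>
     norm n = 1 \<and> x \<in> closure D \<and> closure D \<subseteq> {y. n \<bullet> y \<le> n \<bullet> x} \<and>
     (closure D \<inter> {y. n \<bullet> y = n \<bullet> x}) facet_of closure D"

definition unit_normal :: "(real^'d) set \<Rightarrow> real^'d \<Rightarrow> real^'d" where
  "unit_normal D x = (SOME n. outward_normal D x n)"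

definition star_shaped_const :: "(real^'d) set \<Rightarrow> real \<Rightarrow> bool" where
  "star_shaped_const D c0 \<longleftrightarrow> c0 > 0 \<and> (\<forall>x\<in>frontier D. \<forall>n. outward_normal D x n \<longrightarrow> c0 \<le> x \<bullet> n)"

text \<open>The \<open>(d-1)\<close>-dimensional Lebesgue measure of a Borel subset \<open>E\<close> of a facet with
  normal \<open>n\<close> is the volume of the right prism \<open>{x + t n | x \<in> E, 0 < t < 1}\<close> of height one.
  The prisms erected outwards over the different facets of a convex polytope overlap only in
  a null set, and the closest-point projection maps \<open>x + t n\<close> back to \<open>x\<close>.  Hence the surface
  measure is the image of the volume on the union of the prisms.  In dimension one it
  is the counting measure on the two end points.\<close>

definition outer_collar :: "(real^'d) set \<Rightarrow> (real^'d) set" where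
  "outer_collar D = {x + t *\<^sub>R n | x t n. outward_normal D x n \<and> 0 < t \<and> t < 1}"

definition surface_measure :: "(real^'d) set \<Rightarrow> (real^'d) measure" where
  "surface_measure D =
     distr (restrict_space lborel (outer_collar D)) (restrict_space borel (frontier D))
       (closest_point (closure D))"


section \<open>Lebesgue spaces\<close>

definition L2_space :: "'x measure \<Rightarrow> ('x \<Rightarrow> 'b::real_normed_vector) set" where
  "L2_space M = {w \<in> borel_measurable M. integrable M (\<lambda>x. (norm (w x))\<^sup>2)}"

definition L2_norm :: "'x measure \<Rightarrow> ('x \<Rightarrow> 'b::real_normed_vector) \<Rightarrow> real" where
  "L2_norm M w = sqrt (LINT x|M. (norm (w x))\<^sup>2)"

definition L2_inner :: "'x measure \<Rightarrow> ('x \<Rightarrow> complex) \<Rightarrow> ('x \<Rightarrow> complex) \<Rightarrow> complex" where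
  "L2_inner M w v = (LINT x|M. w x * cnj (v x))"

definition L2_inner_vec ::
  "'x measure \<Rightarrow> ('x \<Rightarrow> complex^'d) \<Rightarrow> ('x \<Rightarrow> complex^'d) \<Rightarrow> complex" where
  "L2_inner_vec M p q = (LINT x|M. (\<Sum>i\<in>UNIV. p x $ i * cnj (q x $ i)))"

definition Linf_space :: "'x measure \<Rightarrow> ('x \<Rightarrow> 'b::real_normed_vector) set" where
  "Linf_space M = {w \<in> borel_measurable M. \<exists>c. AE x in M. norm (w x) \<le> c}"

definition Linf_norm :: "'x measure \<Rightarrow> ('x \<Rightarrow> 'b::real_normed_vector) \<Rightarrow> real" where
  "Linf_norm M w = real_of_ereal (esssup M (\<lambda>x. ereal (norm (w x))))"

text \<open>The Bochner space \<open>L\<^sup>2(\<Omega>, V)\<close> over a function space \<open>V\<close> with (semi)norm \<open>N\<close>: square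
  integrable functions that are strongly measurable, i.e. limits of simple \<open>V\<close>-valued
  functions.  Representatives are taken to be \<open>V\<close>-valued limits at every point of \<open>\<Omega>\<close>, not
  only almost everywhere, because the probability space need not be complete.\<close>

definition bochner_L2 ::
  "'w measure \<Rightarrow> ('x \<Rightarrow> 'b::real_normed_vector) set \<Rightarrow> (('x \<Rightarrow> 'b) \<Rightarrow> real) \<Rightarrow> ('w \<Rightarrow> 'x \<Rightarrow> 'b) set"
where
  "bochner_L2 P V N = {u.
     (\<forall>\<omega>\<in>space P. u \<omega> \<in> V) \<and>
     (\<exists>s. (\<forall>n. simple_function P (s n) \<and> s n ` space P \<subseteq> V) \<and>
          (\<forall>\<omega>\<in>space P. (\<lambda>n::nat. N (\<lambda>x. s n \<omega> x - u \<omega> x)) \<longlonglongrightarrow> 0)) \<and>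
     integrable P (\<lambda>\<omega>. (N (u \<omega>))\<^sup>2)}"

abbreviation L2L2 :: "'w measure \<Rightarrow> 'x measure \<Rightarrow> ('w \<Rightarrow> 'x \<Rightarrow> 'b::real_normed_vector) set" where
  "L2L2 P M \<equiv> bochner_L2 P (L2_space M) (L2_norm M)"

abbreviation L2Linf :: "'w measure \<Rightarrow> 'x measure \<Rightarrow> ('w \<Rightarrow> 'x \<Rightarrow> 'b::real_normed_vector) set" where
  "L2Linf P M \<equiv> bochner_L2 P (Linf_space M) (Linf_norm M)"


section \<open>Weak gradients and traces\<close>

definition partial :: "'d::finite \<Rightarrow> (real^'d \<Rightarrow> complex) \<Rightarrow> real^'d \<Rightarrow> complex" where
  "partial i \<phi> x = frechet_derivative \<phi> (at x) (axis i 1)"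

definition grad :: "(real^'d \<Rightarrow> complex) \<Rightarrow> real^'d \<Rightarrow> complex^'d" where
  "grad \<phi> x = (\<chi> i. partial i \<phi> x)"

primrec C_k :: "nat \<Rightarrow> (real^'d \<Rightarrow> complex) \<Rightarrow> bool" where
  "C_k 0 \<phi> \<longleftrightarrow> continuous_on UNIV \<phi>"
| "C_k (Suc m) \<phi> \<longleftrightarrow> (\<forall>x. \<phi> differentiable (at x)) \<and> (\<forall>i. C_k m (partial i \<phi>))"

definition smooth :: "(real^'d \<Rightarrow> complex) \<Rightarrow> bool" where
  "smooth \<phi> \<longleftrightarrow> (\<forall>m. C_k m \<phi>)"

definition test_function :: "(real^'d) set \<Rightarrow> (real^'d \<Rightarrow> complex) \<Rightarrow> bool" where
  "test_function D \<phi> \<longleftrightarrow>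
     smooth \<phi> \<and> compact (closure {x. \<phi> x \<noteq> 0}) \<and> closure {x. \<phi> x \<noteq> 0} \<subseteq> D"

definition has_weak_gradient ::
  "(real^'d) set \<Rightarrow> (real^'d \<Rightarrow> complex) \<Rightarrow> (real^'d \<Rightarrow> complex^'d) \<Rightarrow> bool" where
  "has_weak_gradient D w p \<longleftrightarrow>
     (\<forall>\<phi> i. test_function D \<phi> \<longrightarrow>
        (LINT x|lebesgue_on D. w x * partial i \<phi> x) = - (LINT x|lebesgue_on D. p x $ i * \<phi> x))"

text \<open>\<open>H\<^sup>1(D)\<close>, each function being given together with its weak gradient (unique almost
  everywhere).\<close>

definition H1 ::
  "(real^'d) set \<Rightarrow> (real^'d \<Rightarrow> complex) \<Rightarrow> (real^'d \<Rightarrow> complex^'d) \<Rightarrow> bool" where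
  "H1 D w p \<longleftrightarrow>
     w \<in> L2_space (lebesgue_on D) \<and> p \<in> L2_space (lebesgue_on D) \<and> has_weak_gradient D w p"

definition Hj_norm ::
  "nat \<Rightarrow> (real^'d) set \<Rightarrow> (real^'d \<Rightarrow> complex) \<Rightarrow> (real^'d \<Rightarrow> complex^'d) \<Rightarrow> real" where
  "Hj_norm j D w p =
     sqrt ((L2_norm (lebesgue_on D) w)\<^sup>2 + (if j = 0 then 0 else (L2_norm (lebesgue_on D) p)\<^sup>2))"

text \<open>The trace on the boundary of an \<open>H\<^sup>1\<close>-function \<open>w\<close> with weak gradient \<open>p\<close>: the extension by
  continuity of the restriction map on functions smooth up to the boundary.\<close>

definition has_trace ::
  "(real^'d) set \<Rightarrow> (real^'d \<Rightarrow> complex) \<Rightarrow> (real^'d \<Rightarrow> complex^'d) \<Rightarrow> (real^'d \<Rightarrow> complex) \<Rightarrow> bool"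
where
  "has_trace D w p \<tau> \<longleftrightarrow>
     H1 D w p \<and> \<tau> \<in> L2_space (surface_measure D) \<and>
     (\<exists>\<phi>. (\<forall>n::nat. smooth (\<phi> n)) \<and>
        (\<lambda>n. Hj_norm 1 D (\<lambda>x. \<phi> n x - w x) (\<lambda>x. grad (\<phi> n) x - p x)) \<longlonglongrightarrow> 0 \<and>
        (\<lambda>n. L2_norm (surface_measure D) (\<lambda>x. \<phi> n x - \<tau> x)) \<longlonglongrightarrow> 0)"

text \<open>The boundary values \<open>G\<close> in \<open>L\<^sup>2(\<partial>D)\<close> of the gradient \<open>p\<close> of an \<open>H\<^sup>1\<close>-function that need not
  be in \<open>H\<^sup>2\<close>, in the usual weak sense.  The first identity is Green's formula, where \<open>l\<close> is the
  weak Laplacian; it fixes the normal component of \<open>G\<close>.  The second one is the divergence theorem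
  for \<open>\<partial>\<^sub>i(\<psi> \<partial>\<^sub>ju) - \<partial>\<^sub>j(\<psi> \<partial>\<^sub>iu)\<close>; it fixes the tangential components of \<open>G\<close>.\<close>

definition has_boundary_gradient ::
  "(real^'d) set \<Rightarrow> (real^'d \<Rightarrow> complex^'d) \<Rightarrow> (real^'d \<Rightarrow> complex^'d) \<Rightarrow> bool" where
  "has_boundary_gradient D p G \<longleftrightarrow>
     G \<in> L2_space (surface_measure D) \<and>
     (\<exists>l \<in> L2_space (lebesgue_on D). \<forall>\<psi>. smooth \<psi> \<longrightarrow>
        (LINT x|surface_measure D. (\<Sum>i\<in>UNIV. of_real (unit_normal D x $ i) * G x $ i) * \<psi> x) =
        (LINT x|lebesgue_on D. l x * \<psi> x + (\<Sum>i\<in>UNIV. p x $ i * partial i \<psi> x))) \<and>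
     (\<forall>\<psi> i j. smooth \<psi> \<longrightarrow>
        (LINT x|surface_measure D.
           (of_real (unit_normal D x $ i) * G x $ j - of_real (unit_normal D x $ j) * G x $ i) * \<psi> x) =
        (LINT x|lebesgue_on D. p x $ j * partial i \<psi> x - p x $ i * partial j \<psi> x))"


section \<open>The random Helmholtz problem\<close>

text \<open>\<open>u \<in> L\<^sup>2(\<Omega>, H\<^sup>1(D))\<close> with weak gradient \<open>Du\<close> and trace \<open>\<tau>u\<close>.\<close>

definition L2H1 ::
  "'w measure \<Rightarrow> (real^'d) set \<Rightarrow> ('w \<Rightarrow> real^'d \<Rightarrow> complex) \<Rightarrow> ('w \<Rightarrow> real^'d \<Rightarrow> complex^'d) \<Rightarrow>
   ('w \<Rightarrow> real^'d \<Rightarrow> complex) \<Rightarrow> bool" where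
  "L2H1 P D u Du \<tau>u \<longleftrightarrow>
     u \<in> L2L2 P (lebesgue_on D) \<and> Du \<in> L2L2 P (lebesgue_on D) \<and>
     \<tau>u \<in> L2L2 P (surface_measure D) \<and>
     (AE \<omega> in P. has_trace D (u \<omega>) (Du \<omega>) (\<tau>u \<omega>))"

definition weak_solution ::
  "'w measure \<Rightarrow> (real^'d) set \<Rightarrow> real \<Rightarrow> ('w \<Rightarrow> real^'d \<Rightarrow> real) \<Rightarrow>
   ('w \<Rightarrow> real^'d \<Rightarrow> complex) \<Rightarrow> ('w \<Rightarrow> real^'d \<Rightarrow> complex) \<Rightarrow>
   ('w \<Rightarrow> real^'d \<Rightarrow> complex) \<Rightarrow> ('w \<Rightarrow> real^'d \<Rightarrow> complex^'d) \<Rightarrow> ('w \<Rightarrow> real^'d \<Rightarrow> complex) \<Rightarrow> bool"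
where
  "weak_solution P D k \<alpha> f g u Du \<tau>u \<longleftrightarrow>
     L2H1 P D u Du \<tau>u \<and>
     (\<forall>v Dv \<tau>v. L2H1 P D v Dv \<tau>v \<longrightarrow>
        (LINT \<omega>|P.
           L2_inner_vec (lebesgue_on D) (Du \<omega>) (Dv \<omega>)
           - of_real (k\<^sup>2) * L2_inner (lebesgue_on D) (\<lambda>x. of_real ((\<alpha> \<omega> x)\<^sup>2) * u \<omega> x) (v \<omega>)
           + \<i> * of_real k * L2_inner (surface_measure D) (\<lambda>x. of_real (\<alpha> \<omega> x) * \<tau>u \<omega> x) (\<tau>v \<omega>)) =
        (LINT \<omega>|P.
           L2_inner (lebesgue_on D) (f \<omega>) (v \<omega>) + L2_inner (surface_measure D) (g \<omega>) (\<tau>v \<omega>)))"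

definition gamma0 :: "nat \<Rightarrow> real \<Rightarrow> real" where
  "gamma0 d k = min 1 ((13 - 2 * real d) / (2 * (4 * real d - 7) + 25 * k))"

text \<open>The two stability estimates, uniformly in \<open>\<epsilon>\<close> (including \<open>\<epsilon> = 0\<close>), the data and the solution.
  The property is stated for a single wave number: a constant that works for every \<open>k\<close>
  satisfies it at the given \<open>k\<close>.  Demanding one constant for all \<open>k \<ge> 1\<close> at once could not be met: for a
  plane wave \<open>exp(\<i>k x \<bullet> e)\<close> the term with \<open>c0\<close> grows like \<open>k\<^sup>2\<close>, the right-hand side stays bounded.\<close>

definition stability_const ::
  "'w measure \<Rightarrow> (real^'d) set \<Rightarrow> real \<Rightarrow> ('w \<Rightarrow> real^'d \<Rightarrow> real) \<Rightarrow> real \<Rightarrow> real \<Rightarrow> bool" where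
  "stability_const P D c0 \<eta> k C0 \<longleftrightarrow>
     (\<forall>\<epsilon> f g u Du \<tau>u.
        0 \<le> \<epsilon> \<longrightarrow> \<epsilon> * (2 + \<epsilon>) < gamma0 CARD('d) k \<longrightarrow>
        f \<in> L2L2 P (lebesgue_on D) \<longrightarrow> g \<in> L2L2 P (surface_measure D) \<longrightarrow>
        weak_solution P D k (\<lambda>\<omega> x. 1 + \<epsilon> * \<eta> \<omega> x) f g u Du \<tau>u \<longrightarrow>
        (let data = (LINT \<omega>|P. (L2_norm (lebesgue_on D) (f \<omega>))\<^sup>2
                             + (L2_norm (surface_measure D) (g \<omega>))\<^sup>2)
         in
         (\<exists>G \<in> L2L2 P (surface_measure D).
            (AE \<omega> in P. has_boundary_gradient D (Du \<omega>) (G \<omega>)) \<and>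
            (LINT \<omega>|P. (L2_norm (lebesgue_on D) (u \<omega>))\<^sup>2
                     + (L2_norm (surface_measure D) (\<tau>u \<omega>))\<^sup>2
                     + c0 * (L2_norm (surface_measure D) (G \<omega>))\<^sup>2)
              \<le> C0 * (1 / k + 1 / k\<^sup>2)\<^sup>2 * data) \<and>
         (LINT \<omega>|P. (Hj_norm 1 D (u \<omega>) (Du \<omega>))\<^sup>2) \<le> C0 * (1 + 1 / k\<^sup>2)\<^sup>2 * data))"

text \<open>\<open>lag u m n\<close> is \<open>u\<^sub>n\<^sub>-\<^sub>m\<close>, with the convention that members of negative index vanish.\<close>

definition lag ::
  "(nat \<Rightarrow> 'w \<Rightarrow> 'x \<Rightarrow> complex) \<Rightarrow> nat \<Rightarrow> nat \<Rightarrow> 'w \<Rightarrow> 'x \<Rightarrow> complex" where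
  "lag u m n = (if n < m then (\<lambda>\<omega> x. 0) else u (n - m))"

end

theory Submission
  imports Defs
begin

text \<open>The residual \<open>u\<^sup>\<epsilon> - U\<^sub>N\<close> solves the perturbed problem with sources
  \<open>\<epsilon>\<^sup>N k\<^sup>2 ((2\<eta> + \<epsilon>\<eta>\<^sup>2) u\<^sub>N\<^sub>-\<^sub>1 + \<eta>\<^sup>2 u\<^sub>N\<^sub>-\<^sub>2)\<close> in \<open>D\<close> and \<open>-\<i>k \<epsilon>\<^sup>N \<eta> u\<^sub>N\<^sub>-\<^sub>1\<close> on the boundary, so the stability
  estimate reduces the claim to bounds for the modes.  With \<open>c = C0 (1 + k)\<^sup>2\<close>, stability at \<open>\<epsilon> = 0\<close>
  gives \<open>a\<^sub>n \<le> c (8 a\<^sub>n\<^sub>-\<^sub>1 + 2 a\<^sub>n\<^sub>-\<^sub>2)\<close> for the mean square norms \<open>a\<^sub>n\<close> of the modes.  Testing it with a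
  constant function gives \<open>c \<ge> 1\<close>, hence \<open>a\<^sub>n\<close> grows at most like \<open>(16 c)\<^sup>n\<close>, which is enough for
  \<open>N \<ge> 2\<close>.

  For \<open>N = 1\<close> the constant \<open>9/32\<close> demands \<open>(2 + \<epsilon>)\<^sup>2 X + T / k\<^sup>2 \<le> 9/2 A\<close>, where \<open>X\<close> and \<open>T\<close> are the mean
  squares of \<open>u\<^sub>0\<close> on \<open>D\<close> and on the boundary and \<open>A\<close> is the bound for \<open>X + T\<close> provided by stability.
  As \<open>(2 + \<epsilon>)\<^sup>2\<close> may exceed \<open>9/2\<close>, this does not follow from \<open>X + T \<le> A\<close> alone; it follows with the
  \<open>H\<^sup>1\<close> estimate and a Friedrichs inequality with explicit constants, since a function with little
  boundary mass has a large gradient.\<close>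


section \<open>The spaces \<open>L\<^sup>2\<close> and \<open>L\<^sup>\<infinity>\<close>\<close>

text \<open>Friedrichs' inequality asks little of the boundary: the integral over D of a directional
  derivative must be at most the boundary integral of the modulus. Since
  \<open>surface_measure\<close> is the image of volume on prisms, this is read off from difference
  quotients: a shift of D by t changes D only inside oblique slabs over the facets, and a rank-one
  affine map compares each slab with the prism that defines surface measure. The explicit constants
  matter for 1 <= k < 2 only. The bound 4 + 22 / (25 k - 6) for (2 + \<epsilon>)^2, which stems from
  \<open>gamma0\<close> in dimension one, reaches 9/2 exactly at k = 2. The factor 16 in the growth
  of the modes is dictated by \<sigma>^2 = 16 c \<epsilon>^2; for N >= 2 it leaves room, because the
  estimate needs 50 and has 72 = 9/32 * 16^2. Since \<open>bochner_L2\<close> works with seminorms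
  on sets of functions, measurability of random norms, products and inner products is obtained by
  evaluating them on simple approximants.\<close>

lemma L2_norm_nonneg [simp]: "0 \<le> L2_norm M w"
  by (simp add: L2_norm_def)

lemma L2_norm_sq: "(L2_norm M w)\<^sup>2 = (LINT x|M. (norm (w x))\<^sup>2)"
  by (simp add: L2_norm_def)

lemma L2_space_measurable: "w \<in> L2_space M \<Longrightarrow> w \<in> borel_measurable M"
  and L2_space_integrable: "w \<in> L2_space M \<Longrightarrow> integrable M (\<lambda>x. (norm (w x))\<^sup>2)"
  by (simp_all add: L2_space_def)

lemma norm_add_sq_le:
  fixes a b :: "'a::real_normed_vector"
  assumes "\<theta> > 0"
  shows "(norm (a + b))\<^sup>2 \<le> (1 + \<theta>) * (norm a)\<^sup>2 + (1 + 1 / \<theta>) * (norm b)\<^sup>2"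
proof -
  have "(norm (a + b))\<^sup>2 \<le> (norm a + norm b)\<^sup>2"
    by (intro power_mono norm_triangle_ineq) auto
  also have "\<dots> \<le> (1 + \<theta>) * (norm a)\<^sup>2 + (1 + 1 / \<theta>) * (norm b)\<^sup>2"
  proof -
    have "0 \<le> (\<theta> * norm a - norm b)\<^sup>2 / \<theta>" using assms by simp
    also have "\<dots> = \<theta> * (norm a)\<^sup>2 + (norm b)\<^sup>2 / \<theta> - 2 * norm a * norm b"
      using assms by (simp add: power2_eq_square field_simps)
    finally have "2 * norm a * norm b \<le> \<theta> * (norm a)\<^sup>2 + (norm b)\<^sup>2 / \<theta>" by simp
    then show ?thesis unfolding power2_sum by (simp add: distrib_right)
  qed
  finally show ?thesis .
qed

lemma L2_space_add:
  fixes u v :: "'x \<Rightarrow> 'b::{real_normed_vector, second_countable_topology}"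
  assumes "u \<in> L2_space M" "v \<in> L2_space M"
  shows "(\<lambda>x. u x + v x) \<in> L2_space M"
proof -
  have [measurable]: "u \<in> borel_measurable M" "v \<in> borel_measurable M"
    using assms by (simp_all add: L2_space_def)
  have "integrable M (\<lambda>x. (norm (u x + v x))\<^sup>2)"
  proof (rule Bochner_Integration.integrable_bound)
    show "integrable M (\<lambda>x. 2 * (norm (u x))\<^sup>2 + 2 * (norm (v x))\<^sup>2)"
      using assms by (simp add: L2_space_def)
    show "AE x in M. norm ((norm (u x + v x))\<^sup>2) \<le> norm (2 * (norm (u x))\<^sup>2 + 2 * (norm (v x))\<^sup>2)"
      using norm_add_sq_le[of 1] by (intro AE_I2) auto
  qed measurable
  then show ?thesis by (simp add: L2_space_def)
qed

lemma L2_space_scaleR: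
  fixes u :: "'x \<Rightarrow> 'b::{real_normed_vector, second_countable_topology}"
  assumes "u \<in> L2_space M"
  shows "(\<lambda>x. r *\<^sub>R u x) \<in> L2_space M"
  using assms unfolding L2_space_def
  by (auto simp: power_mult_distrib intro!: borel_measurable_scaleR)

lemma L2_norm_scaleR: "L2_norm M (\<lambda>x. r *\<^sub>R u x) = \<bar>r\<bar> * L2_norm M u"
  by (simp add: L2_norm_def power_mult_distrib real_sqrt_mult)

text \<open>Minkowski's inequality from a weighted Young inequality: \<open>norm_add_sq_le\<close>
  is integrated for every weight, and the weight is optimized afterwards.\<close>

lemma L2_norm_triangle:
  fixes u v :: "'x \<Rightarrow> 'b::{real_normed_vector, second_countable_topology}"
  assumes u: "u \<in> L2_space M" and v: "v \<in> L2_space M"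
  shows "L2_norm M (\<lambda>x. u x + v x) \<le> L2_norm M u + L2_norm M v"
proof -
  let ?a = "L2_norm M u" and ?b = "L2_norm M v" and ?c = "L2_norm M (\<lambda>x. u x + v x)"
  have *: "?c\<^sup>2 \<le> (1 + \<theta>) * ?a\<^sup>2 + (1 + 1 / \<theta>) * ?b\<^sup>2" if "\<theta> > 0" for \<theta>
  proof -
    have "?c\<^sup>2 \<le> (LINT x|M. (1 + \<theta>) * (norm (u x))\<^sup>2 + (1 + 1 / \<theta>) * (norm (v x))\<^sup>2)"
      unfolding L2_norm_sq
      using u v L2_space_add[OF u v] norm_add_sq_le[OF that]
      by (intro integral_mono) (auto simp: L2_space_def)
    also have "\<dots> = (1 + \<theta>) * ?a\<^sup>2 + (1 + 1 / \<theta>) * ?b\<^sup>2"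
      using u v by (simp add: L2_norm_sq L2_space_def)
    finally show ?thesis .
  qed
  have "?c \<le> ?a + ?b + e" if "e > 0" for e
  proof -
    \<comment> \<open>The optimal weight is the ratio of the two norms. Adding e / 2 keeps both
      positive, so the ratio makes sense even when a norm vanishes.\<close>
    define a' b' where "a' = ?a + e / 2" and "b' = ?b + e / 2"
    have pos: "a' > 0" "b' > 0" "?a \<le> a'" "?b \<le> b'"
      using that by (auto simp: a'_def b'_def add_nonneg_pos)
    have "?c\<^sup>2 \<le> (1 + b' / a') * ?a\<^sup>2 + (1 + 1 / (b' / a')) * ?b\<^sup>2"
      using pos by (intro *) simp
    also have "\<dots> \<le> (1 + b' / a') * a'\<^sup>2 + (1 + 1 / (b' / a')) * b'\<^sup>2"
      using pos by (intro add_mono mult_left_mono power_mono) auto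
    also have "\<dots> = (a' + b')\<^sup>2"
      using pos by (simp add: field_simps power2_eq_square)
    finally have "?c \<le> a' + b'"
      using pos by (simp add: power2_le_iff_abs_le)
    then show ?thesis by (simp add: a'_def b'_def)
  qed
  then show ?thesis by (rule field_le_epsilon)
qed

lemma Linf_norm_AE:
  assumes "w \<in> Linf_space M"
  shows "AE x in M. norm (w x) \<le> Linf_norm M w"
proof -
  from assms obtain c where [measurable]: "w \<in> borel_measurable M" and c: "AE x in M. norm (w x) \<le> c"
    by (auto simp: Linf_space_def)
  let ?e = "esssup M (\<lambda>x. ereal (norm (w x)))"
  have "?e \<le> ereal c" using c by (intro esssup_I) auto
  then have fin: "?e \<noteq> \<infinity>" by auto
  have "AE x in M. ereal (norm (w x)) \<le> ?e" by (rule esssup_AE)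
  then show ?thesis
  proof eventually_elim
    case (elim x)
    \<comment> \<open>The value minus infinity can occur on a null space only, and there the
      pointwise inequality \<open>elim\<close> is contradictory.\<close>
    then show ?case
      using fin unfolding Linf_norm_def by (cases ?e) auto
  qed
qed

lemma L2_mult:
  fixes w :: "'x \<Rightarrow> real" and u :: "'x \<Rightarrow> complex"
  assumes w: "w \<in> borel_measurable M" "AE x in M. norm (w x) \<le> C" and u: "u \<in> L2_space M"
  shows "(\<lambda>x. of_real (w x) * u x) \<in> L2_space M"
    and "L2_norm M (\<lambda>x. of_real (w x) * u x) \<le> \<bar>C\<bar> * L2_norm M u"
proof -
  note [measurable] = w(1) L2_space_measurable[OF u]
  have le: "AE x in M. (norm (of_real (w x) * u x))\<^sup>2 \<le> C\<^sup>2 * (norm (u x))\<^sup>2"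
    using w(2)
  proof eventually_elim
    case (elim x)
    then have "(norm (w x))\<^sup>2 \<le> C\<^sup>2" by (intro power_mono) auto
    then show ?case by (simp add: norm_mult power_mult_distrib mult_right_mono)
  qed
  have i: "integrable M (\<lambda>x. C\<^sup>2 * (norm (u x))\<^sup>2)"
    using u by (simp add: L2_space_def)
  have int: "integrable M (\<lambda>x. (norm (of_real (w x) * u x))\<^sup>2)"
  proof (rule Bochner_Integration.integrable_bound[OF i])
    show "(\<lambda>x. (norm (of_real (w x) * u x))\<^sup>2) \<in> borel_measurable M" by measurable
    show "AE x in M. norm ((norm (of_real (w x) * u x))\<^sup>2) \<le> norm (C\<^sup>2 * (norm (u x))\<^sup>2)"
      using le by eventually_elim simp
  qed
  then show "(\<lambda>x. of_real (w x) * u x) \<in> L2_space M"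
    unfolding L2_space_def mem_Collect_eq by (intro conjI) measurable
  have "(L2_norm M (\<lambda>x. of_real (w x) * u x))\<^sup>2 \<le> (LINT x|M. C\<^sup>2 * (norm (u x))\<^sup>2)"
    unfolding L2_norm_sq by (rule integral_mono_AE[OF int i le])
  also have "\<dots> = (\<bar>C\<bar> * L2_norm M u)\<^sup>2"
    by (simp add: L2_norm_sq power_mult_distrib)
  finally show "L2_norm M (\<lambda>x. of_real (w x) * u x) \<le> \<bar>C\<bar> * L2_norm M u"
    by (rule power2_le_imp_le) auto
qed

lemma L2_inner_integrable:
  assumes u: "u \<in> L2_space M" and v: "v \<in> L2_space M"
  shows "integrable M (\<lambda>x. u x * cnj (v x))"
proof (rule Bochner_Integration.integrable_bound)
  note [measurable] = L2_space_measurable[OF u] L2_space_measurable[OF v]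
  show "integrable M (\<lambda>x. (norm (u x))\<^sup>2 + (norm (v x))\<^sup>2)"
    using u v by (simp add: L2_space_def)
  show "AE x in M. norm (u x * cnj (v x)) \<le> norm ((norm (u x))\<^sup>2 + (norm (v x))\<^sup>2)"
  proof (rule AE_I2)
    fix x
    have "0 \<le> (norm (u x) - norm (v x))\<^sup>2" "0 \<le> norm (u x) * norm (v x)" by auto
    then have "norm (u x) * norm (v x) \<le> (norm (u x))\<^sup>2 + (norm (v x))\<^sup>2"
      unfolding power2_diff by linarith
    then show "norm (u x * cnj (v x)) \<le> norm ((norm (u x))\<^sup>2 + (norm (v x))\<^sup>2)"
      by (simp add: norm_mult)
  qed
  have "(\<lambda>x. cnj (v x)) \<in> borel_measurable M"
    by (rule borel_measurable_continuous_on[OF continuous_on_cnj[OF continuous_on_id]]) simp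
  then show "(\<lambda>x. u x * cnj (v x)) \<in> borel_measurable M"
    by measurable
qed

text \<open>Cauchy-Schwarz by the same optimization of a weight. Both norms are enlarged by e > 0 to
  keep their ratio meaningful, and e tends to 0 at the end.\<close>

lemma L2_inner_le:
  assumes u: "u \<in> L2_space M" and v: "v \<in> L2_space M"
  shows "norm (L2_inner M u v) \<le> L2_norm M u * L2_norm M v"
proof -
  let ?a = "L2_norm M u" and ?b = "L2_norm M v"
  have *: "norm (L2_inner M u v) \<le> (\<theta> * ?a\<^sup>2 + ?b\<^sup>2 / \<theta>) / 2" if "\<theta> > 0" for \<theta>
  proof -
    have "norm (L2_inner M u v) \<le> (LINT x|M. norm (u x * cnj (v x)))"
      unfolding L2_inner_def by (rule integral_norm_bound)
    also have "\<dots> \<le> (LINT x|M. (\<theta> * (norm (u x))\<^sup>2 + (norm (v x))\<^sup>2 / \<theta>) / 2)"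
    proof (rule integral_mono)
      show "integrable M (\<lambda>x. norm (u x * cnj (v x)))"
        using L2_inner_integrable[OF u v] by simp
      show "integrable M (\<lambda>x. (\<theta> * (norm (u x))\<^sup>2 + (norm (v x))\<^sup>2 / \<theta>) / 2)"
        using u v by (simp add: L2_space_def)
      fix x
      have "0 \<le> (\<theta> * norm (u x) - norm (v x))\<^sup>2 / \<theta>" using that by simp
      then show "norm (u x * cnj (v x)) \<le> (\<theta> * (norm (u x))\<^sup>2 + (norm (v x))\<^sup>2 / \<theta>) / 2"
        using that by (simp add: norm_mult power2_eq_square field_simps)
    qed
    also have "\<dots> = (\<theta> * ?a\<^sup>2 + ?b\<^sup>2 / \<theta>) / 2"
      using u v by (simp add: L2_norm_sq L2_space_def)
    finally show ?thesis .
  qed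
  have lim: "((\<lambda>e. (?a + e) * (?b + e)) \<longlongrightarrow> (?a + 0) * (?b + 0)) (at_right 0)"
    by (intro tendsto_intros)
  have "norm (L2_inner M u v) \<le> (?a + 0) * (?b + 0)"
  proof (rule tendsto_lowerbound[OF lim])
    show "\<forall>\<^sub>F e in at_right 0. norm (L2_inner M u v) \<le> (?a + e) * (?b + e)"
      using eventually_at_right_less[of "0::real"]
    proof eventually_elim
      case (elim e)
      define a' b' where "a' = ?a + e" and "b' = ?b + e"
      have pos: "a' > 0" "b' > 0" "?a \<le> a'" "?b \<le> b'"
        using elim by (auto simp: a'_def b'_def add_nonneg_pos)
      have "norm (L2_inner M u v) \<le> ((b' / a') * ?a\<^sup>2 + ?b\<^sup>2 / (b' / a')) / 2"
        using pos by (intro *) simp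
      also have "\<dots> \<le> ((b' / a') * a'\<^sup>2 + b'\<^sup>2 / (b' / a')) / 2"
        using pos by (intro divide_right_mono add_mono mult_left_mono power_mono) auto
      also have "\<dots> = a' * b'"
        using pos by (simp add: field_simps power2_eq_square)
      finally show ?case by (simp add: a'_def b'_def)
    qed
  qed auto
  then show ?thesis by simp
qed

lemma L2_inner_add_left:
  "u \<in> L2_space M \<Longrightarrow> u' \<in> L2_space M \<Longrightarrow> v \<in> L2_space M \<Longrightarrow>
    L2_inner M (\<lambda>x. u x + u' x) v = L2_inner M u v + L2_inner M u' v"
  unfolding L2_inner_def
  by (simp add: distrib_right L2_inner_integrable)

lemma L2_inner_mult_left: "L2_inner M (\<lambda>x. c * u x) v = c * L2_inner M u v"
  unfolding L2_inner_def by (simp add: mult.assoc)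

lemma L2_inner_cnj:
  assumes "u \<in> L2_space M" "v \<in> L2_space M"
  shows "L2_inner M v u = cnj (L2_inner M u v)"
  unfolding L2_inner_def
  using integral_bounded_linear[OF bounded_linear_cnj L2_inner_integrable[OF assms]]
  by (simp add: mult.commute)

text \<open>Joint continuity of the inner product in quantitative form: every summand on the right
  contains a factor that vanishes as u' and v' approach u and v.\<close>

lemma L2_inner_diff_le:
  assumes "u \<in> L2_space M" "u' \<in> L2_space M" "v \<in> L2_space M" "v' \<in> L2_space M"
  shows "norm (L2_inner M u' v' - L2_inner M u v)
    \<le> L2_norm M (\<lambda>x. u' x - u x) * (L2_norm M (\<lambda>x. v' x - v x) + L2_norm M v)
      + L2_norm M u * L2_norm M (\<lambda>x. v' x - v x)"
proof -
  have d: "(\<lambda>x. u' x - u x) \<in> L2_space M" "(\<lambda>x. v' x - v x) \<in> L2_space M"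
    using L2_space_add[OF assms(2) L2_space_scaleR[OF assms(1), of "-1"]]
      L2_space_add[OF assms(4) L2_space_scaleR[OF assms(3), of "-1"]] by simp_all
  have 1: "L2_inner M u' v' = L2_inner M (\<lambda>x. u' x - u x) v' + L2_inner M u v'"
    using L2_inner_add_left[OF d(1) assms(1,4)] by simp
  have 2: "L2_inner M w v' = L2_inner M w (\<lambda>x. v' x - v x) + L2_inner M w v" if "w \<in> L2_space M" for w
    using L2_inner_add_left[OF d(2) assms(3) that]
    by (simp add: L2_inner_cnj[OF _ that] d assms)
  have 3: "L2_inner M u' v' - L2_inner M u v =
     L2_inner M (\<lambda>x. u' x - u x) (\<lambda>x. v' x - v x) + L2_inner M (\<lambda>x. u' x - u x) v
      + L2_inner M u (\<lambda>x. v' x - v x)"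
    unfolding 1 2[OF d(1)] 2[OF assms(1)] by simp
  have "norm (L2_inner M u' v' - L2_inner M u v) \<le> L2_norm M (\<lambda>x. u' x - u x) * L2_norm M (\<lambda>x. v' x - v x)
      + L2_norm M (\<lambda>x. u' x - u x) * L2_norm M v + L2_norm M u * L2_norm M (\<lambda>x. v' x - v x)"
    unfolding 3 by (intro norm_triangle_le add_mono L2_inner_le d assms)
  then show ?thesis by (simp only: distrib_left)
qed

section \<open>Bochner spaces\<close>

text \<open>The measurability part of \<open>bochner_L2\<close>, separated because it passes through
  every sequentially continuous map, whereas square integrability needs a bound of its own each
  time.\<close>

definition strongly_measurable ::
  "'w measure \<Rightarrow> ('x \<Rightarrow> 'b::real_normed_vector) set \<Rightarrow> (('x \<Rightarrow> 'b) \<Rightarrow> real) \<Rightarrow> ('w \<Rightarrow> 'x \<Rightarrow> 'b) \<Rightarrow> bool"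
where
  "strongly_measurable P V N u \<longleftrightarrow>
     (\<forall>\<omega>\<in>space P. u \<omega> \<in> V) \<and>
     (\<exists>s. (\<forall>n. simple_function P (s n) \<and> s n ` space P \<subseteq> V) \<and>
          (\<forall>\<omega>\<in>space P. (\<lambda>n::nat. N (\<lambda>x. s n \<omega> x - u \<omega> x)) \<longlonglongrightarrow> 0))"

lemma bochner_L2_iff:
  "u \<in> bochner_L2 P V N \<longleftrightarrow> strongly_measurable P V N u \<and> integrable P (\<lambda>\<omega>. (N (u \<omega>))\<^sup>2)"
  by (auto simp: bochner_L2_def strongly_measurable_def)

lemma bochner_L2_in: "u \<in> bochner_L2 P V N \<Longrightarrow> \<omega> \<in> space P \<Longrightarrow> u \<omega> \<in> V"
  by (simp add: bochner_L2_def)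

lemma bochner_L2_integrable: "u \<in> bochner_L2 P V N \<Longrightarrow> integrable P (\<lambda>\<omega>. (N (u \<omega>))\<^sup>2)"
  by (simp add: bochner_L2_def)

lemma strongly_measurableE:
  assumes "strongly_measurable P V N u"
  obtains s where "\<And>n. simple_function P (s n)" "\<And>n \<omega>. \<omega> \<in> space P \<Longrightarrow> s n \<omega> \<in> V"
    "\<And>\<omega>. \<omega> \<in> space P \<Longrightarrow> (\<lambda>n. N (\<lambda>x. s n \<omega> x - u \<omega> x)) \<longlonglongrightarrow> 0"
proof -
  obtain s where s: "\<forall>n. simple_function P (s n) \<and> s n ` space P \<subseteq> V"
      "\<forall>\<omega>\<in>space P. (\<lambda>n::nat. N (\<lambda>x. s n \<omega> x - u \<omega> x)) \<longlonglongrightarrow> 0"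
    using assms unfolding strongly_measurable_def by blast
  show ?thesis by (rule that[of s]) (use s in blast)+
qed

text \<open>Applying B to simple approximants of u and v gives simple functions again, so sequential
  continuity of B in the seminorms is enough. No linearity of B is involved, which covers products,
  sums and inner products alike.\<close>

lemma strongly_measurable_map2:
  assumes u: "strongly_measurable P V N u" and v: "strongly_measurable P V' N' v"
    and B: "\<And>a b. a \<in> V \<Longrightarrow> b \<in> V' \<Longrightarrow> B a b \<in> V''"
    and lim: "\<And>a b s t. a \<in> V \<Longrightarrow> b \<in> V' \<Longrightarrow> (\<And>n. s n \<in> V) \<Longrightarrow> (\<And>n. t n \<in> V') \<Longrightarrow>
      (\<lambda>n. N (\<lambda>x. s n x - a x)) \<longlonglongrightarrow> 0 \<Longrightarrow> (\<lambda>n. N' (\<lambda>x. t n x - b x)) \<longlonglongrightarrow> 0 \<Longrightarrow>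
      (\<lambda>n::nat. N'' (\<lambda>x. B (s n) (t n) x - B a b x)) \<longlonglongrightarrow> 0"
  shows "strongly_measurable P V'' N'' (\<lambda>\<omega>. B (u \<omega>) (v \<omega>))"
proof -
  obtain s where s: "\<And>n. simple_function P (s n)" "\<And>n \<omega>. \<omega> \<in> space P \<Longrightarrow> s n \<omega> \<in> V"
      "\<And>\<omega>. \<omega> \<in> space P \<Longrightarrow> (\<lambda>n. N (\<lambda>x. s n \<omega> x - u \<omega> x)) \<longlonglongrightarrow> 0"
    by (rule strongly_measurableE[OF u]) (rule that)
  obtain t where t: "\<And>n. simple_function P (t n)" "\<And>n \<omega>. \<omega> \<in> space P \<Longrightarrow> t n \<omega> \<in> V'"
      "\<And>\<omega>. \<omega> \<in> space P \<Longrightarrow> (\<lambda>n. N' (\<lambda>x. t n \<omega> x - v \<omega> x)) \<longlonglongrightarrow> 0"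
    by (rule strongly_measurableE[OF v]) (rule that)
  have uv: "\<And>\<omega>. \<omega> \<in> space P \<Longrightarrow> u \<omega> \<in> V" "\<And>\<omega>. \<omega> \<in> space P \<Longrightarrow> v \<omega> \<in> V'"
    using u v by (auto simp: strongly_measurable_def)
  show ?thesis unfolding strongly_measurable_def
  proof (intro conjI ballI exI[of _ "\<lambda>n \<omega>. B (s n \<omega>) (t n \<omega>)"] allI)
    show "simple_function P (\<lambda>\<omega>. B (s n \<omega>) (t n \<omega>))" for n
      using s(1)[of n] t(1)[of n] by (rule simple_function_compose2)
    show "(\<lambda>\<omega>. B (s n \<omega>) (t n \<omega>)) ` space P \<subseteq> V''" for n
      using s(2) t(2) B by auto
    show "B (u \<omega>) (v \<omega>) \<in> V''" if "\<omega> \<in> space P" for \<omega> using uv that B by auto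
    show "(\<lambda>n. N'' (\<lambda>x. B (s n \<omega>) (t n \<omega>) x - B (u \<omega>) (v \<omega>) x)) \<longlonglongrightarrow> 0" if "\<omega> \<in> space P" for \<omega>
      using uv s(2,3) t(2,3) that by (intro lim) auto
  qed
qed

lemma strongly_measurable_map:
  assumes "strongly_measurable P V N u"
    and "\<And>a. a \<in> V \<Longrightarrow> B a \<in> V''"
    and "\<And>a s. a \<in> V \<Longrightarrow> (\<And>n. s n \<in> V) \<Longrightarrow> (\<lambda>n. N (\<lambda>x. s n x - a x)) \<longlonglongrightarrow> 0 \<Longrightarrow>
      (\<lambda>n::nat. N'' (\<lambda>x. B (s n) x - B a x)) \<longlonglongrightarrow> 0"
  shows "strongly_measurable P V'' N'' (\<lambda>\<omega>. B (u \<omega>))"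
  using strongly_measurable_map2[OF assms(1) assms(1), of "\<lambda>a b. B a"] assms(2,3) by blast

text \<open>Turns strong measurability of random functions into Borel measurability of the numbers
  computed from them, such as norms and inner products.\<close>

lemma measurable_functional2:
  fixes \<Phi> :: "('x \<Rightarrow> 'b::real_normed_vector) \<Rightarrow> ('y \<Rightarrow> 'c::real_normed_vector) \<Rightarrow> 'd::real_normed_vector"
  assumes u: "strongly_measurable P V N u" and v: "strongly_measurable P V' N' v"
    and lim: "\<And>a b s t. a \<in> V \<Longrightarrow> b \<in> V' \<Longrightarrow> (\<And>n. s n \<in> V) \<Longrightarrow> (\<And>n. t n \<in> V') \<Longrightarrow>
      (\<lambda>n. N (\<lambda>x. s n x - a x)) \<longlonglongrightarrow> 0 \<Longrightarrow> (\<lambda>n. N' (\<lambda>x. t n x - b x)) \<longlonglongrightarrow> 0 \<Longrightarrow>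
      (\<lambda>n::nat. \<Phi> (s n) (t n)) \<longlonglongrightarrow> \<Phi> a b"
  shows "(\<lambda>\<omega>. \<Phi> (u \<omega>) (v \<omega>)) \<in> borel_measurable P"
proof -
  \<comment> \<open>A value of \<open>\<Phi>\<close> is regarded as a function on the one-point
    type, so that the transfer lemma for function-valued maps applies to it.\<close>
  have "strongly_measurable P UNIV (\<lambda>w. norm (w ())) (\<lambda>\<omega> _::unit. \<Phi> (u \<omega>) (v \<omega>))"
    by (rule strongly_measurable_map2[OF u v]) (auto simp: tendsto_norm_zero_iff LIM_zero_iff lim)
  then obtain s where s: "\<And>n. simple_function P (s n)"
      "\<And>\<omega>. \<omega> \<in> space P \<Longrightarrow> (\<lambda>n. norm (s n \<omega> () - \<Phi> (u \<omega>) (v \<omega>))) \<longlonglongrightarrow> 0"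
    unfolding strongly_measurable_def by auto
  show ?thesis
  proof (rule borel_measurable_LIMSEQ_metric)
    show "(\<lambda>\<omega>. s n \<omega> ()) \<in> borel_measurable P" for n
      using simple_function_compose1[OF s(1), of "\<lambda>w. w ()"] by (rule borel_measurable_simple_function)
    show "(\<lambda>n. s n \<omega> ()) \<longlonglongrightarrow> \<Phi> (u \<omega>) (v \<omega>)" if "\<omega> \<in> space P" for \<omega>
      using s(2)[OF that] by (simp add: tendsto_norm_zero_iff LIM_zero_iff)
  qed
qed

section \<open>Random functions with values in a space of square integrable functions\<close>

lemma L2_space_diff:
  fixes u v :: "'x \<Rightarrow> 'b::{real_normed_vector, second_countable_topology}"
  shows "u \<in> L2_space M \<Longrightarrow> v \<in> L2_space M \<Longrightarrow> (\<lambda>x. u x - v x) \<in> L2_space M"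
  using L2_space_add[OF _ L2_space_scaleR[of v M "-1"], of u] by simp

lemma L2_norm_tendsto:
  fixes a :: "'x \<Rightarrow> 'b::{real_normed_vector, second_countable_topology}"
  assumes a: "a \<in> L2_space M" and s: "\<And>n. s n \<in> L2_space M"
    and lim: "(\<lambda>n. L2_norm M (\<lambda>x. s n x - a x)) \<longlonglongrightarrow> 0"
  shows "(\<lambda>n::nat. L2_norm M (s n)) \<longlonglongrightarrow> L2_norm M a"
proof -
  have 1: "\<bar>L2_norm M (s n) - L2_norm M a\<bar> \<le> L2_norm M (\<lambda>x. s n x - a x)" for n
  proof -
    have "L2_norm M (s n) \<le> L2_norm M (\<lambda>x. s n x - a x) + L2_norm M a"
      using L2_norm_triangle[OF L2_space_diff[OF s a] a, of n] by simp
    moreover have "L2_norm M a \<le> L2_norm M (\<lambda>x. (-1) *\<^sub>R (s n x - a x)) + L2_norm M (s n)"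
      using L2_norm_triangle[OF L2_space_scaleR[OF L2_space_diff[OF s a], of "-1"] s, of n n] by simp
    then have "L2_norm M a \<le> L2_norm M (\<lambda>x. s n x - a x) + L2_norm M (s n)"
      unfolding L2_norm_scaleR by simp
    ultimately show ?thesis by linarith
  qed
  have "(\<lambda>n. L2_norm M (s n) - L2_norm M a) \<longlonglongrightarrow> 0"
    by (rule Lim_null_comparison[OF _ lim]) (simp add: 1)
  then show ?thesis by (simp add: LIM_zero_iff)
qed

lemma L2_norm_measurable:
  fixes u :: "'w \<Rightarrow> 'x \<Rightarrow> 'b::{real_normed_vector, second_countable_topology}"
  assumes "strongly_measurable P (L2_space M) (L2_norm M) u"
  shows "(\<lambda>\<omega>. L2_norm M (u \<omega>)) \<in> borel_measurable P"
  by (rule measurable_functional2[OF assms assms, of "\<lambda>a b. L2_norm M a"]) (rule L2_norm_tendsto)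

lemma L2L2_strongly_measurable: "u \<in> L2L2 P M \<Longrightarrow> strongly_measurable P (L2_space M) (L2_norm M) u"
  by (simp add: bochner_L2_iff)

text \<open>Domination criterion: the random norm is measurable automatically, so an integrable
  bound for its square is all that remains to be found.\<close>

lemma L2L2_I:
  fixes u :: "'w \<Rightarrow> 'x \<Rightarrow> 'b::{real_normed_vector, second_countable_topology}"
  assumes u: "strongly_measurable P (L2_space M) (L2_norm M) u"
    and g: "integrable P g" and le: "AE \<omega> in P. (L2_norm M (u \<omega>))\<^sup>2 \<le> g \<omega>"
  shows "u \<in> L2L2 P M"
proof -
  have "integrable P (\<lambda>\<omega>. (L2_norm M (u \<omega>))\<^sup>2)"
  proof (rule Bochner_Integration.integrable_bound[OF g])
    show "(\<lambda>\<omega>. (L2_norm M (u \<omega>))\<^sup>2) \<in> borel_measurable P"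
      using L2_norm_measurable[OF u] by measurable
    show "AE \<omega> in P. norm ((L2_norm M (u \<omega>))\<^sup>2) \<le> norm (g \<omega>)"
      using le by eventually_elim auto
  qed
  then show ?thesis using u by (simp add: bochner_L2_iff)
qed

lemma L2L2_add:
  fixes u v :: "'w \<Rightarrow> 'x \<Rightarrow> 'b::{real_normed_vector, second_countable_topology}"
  assumes u: "u \<in> L2L2 P M" and v: "v \<in> L2L2 P M"
  shows "(\<lambda>\<omega> x. u \<omega> x + v \<omega> x) \<in> L2L2 P M"
proof (rule L2L2_I)
  show "strongly_measurable P (L2_space M) (L2_norm M) (\<lambda>\<omega> x. u \<omega> x + v \<omega> x)"
  proof (rule strongly_measurable_map2[OF L2L2_strongly_measurable[OF u] L2L2_strongly_measurable[OF v]])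
    show "(\<lambda>x. a x + b x) \<in> L2_space M" if "a \<in> L2_space M" "b \<in> L2_space M" for a b :: "'x \<Rightarrow> 'b"
      using that by (rule L2_space_add)
    fix a b :: "'x \<Rightarrow> 'b" and s t :: "nat \<Rightarrow> 'x \<Rightarrow> 'b"
    assume *: "a \<in> L2_space M" "b \<in> L2_space M" "\<And>n. s n \<in> L2_space M" "\<And>n. t n \<in> L2_space M"
      and lim: "(\<lambda>n. L2_norm M (\<lambda>x. s n x - a x)) \<longlonglongrightarrow> 0" "(\<lambda>n. L2_norm M (\<lambda>x. t n x - b x)) \<longlonglongrightarrow> 0"
    show "(\<lambda>n. L2_norm M (\<lambda>x. (s n x + t n x) - (a x + b x))) \<longlonglongrightarrow> 0"
    proof (rule Lim_null_comparison)
      show "(\<lambda>n. L2_norm M (\<lambda>x. s n x - a x) + L2_norm M (\<lambda>x. t n x - b x)) \<longlonglongrightarrow> 0"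
        using tendsto_add[OF lim] by simp
      show "\<forall>\<^sub>F n in sequentially. norm (L2_norm M (\<lambda>x. (s n x + t n x) - (a x + b x)))
        \<le> L2_norm M (\<lambda>x. s n x - a x) + L2_norm M (\<lambda>x. t n x - b x)"
      proof (rule always_eventually, rule allI)
        fix n
        show "norm (L2_norm M (\<lambda>x. (s n x + t n x) - (a x + b x)))
          \<le> L2_norm M (\<lambda>x. s n x - a x) + L2_norm M (\<lambda>x. t n x - b x)"
          using L2_norm_triangle[OF L2_space_diff[OF *(3)[of n] *(1)] L2_space_diff[OF *(4)[of n] *(2)]]
          by (simp add: add_diff_add)
      qed
    qed
  qed
  show "integrable P (\<lambda>\<omega>. 2 * (L2_norm M (u \<omega>))\<^sup>2 + 2 * (L2_norm M (v \<omega>))\<^sup>2)"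
    using bochner_L2_integrable[OF u] bochner_L2_integrable[OF v] by simp
  show "AE \<omega> in P. (L2_norm M (\<lambda>x. u \<omega> x + v \<omega> x))\<^sup>2 \<le> 2 * (L2_norm M (u \<omega>))\<^sup>2 + 2 * (L2_norm M (v \<omega>))\<^sup>2"
  proof (rule AE_I2)
    fix \<omega> assume \<omega>: "\<omega> \<in> space P"
    have "(L2_norm M (\<lambda>x. u \<omega> x + v \<omega> x))\<^sup>2 \<le> (L2_norm M (u \<omega>) + L2_norm M (v \<omega>))\<^sup>2"
      using L2_norm_triangle[OF bochner_L2_in[OF u \<omega>] bochner_L2_in[OF v \<omega>]] by (intro power_mono) auto
    also have "\<dots> \<le> 2 * (L2_norm M (u \<omega>))\<^sup>2 + 2 * (L2_norm M (v \<omega>))\<^sup>2"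
      using norm_add_sq_le[of 1 "L2_norm M (u \<omega>)" "L2_norm M (v \<omega>)"] by simp
    finally show "(L2_norm M (\<lambda>x. u \<omega> x + v \<omega> x))\<^sup>2 \<le> 2 * (L2_norm M (u \<omega>))\<^sup>2 + 2 * (L2_norm M (v \<omega>))\<^sup>2" .
  qed
qed

lemma L2_bounded_linear:
  fixes T :: "'b::{real_normed_vector, second_countable_topology} \<Rightarrow> 'c::{real_normed_vector, second_countable_topology}"
  assumes T: "bounded_linear T" and K: "\<And>y. norm (T y) \<le> norm y * K" and u: "u \<in> L2_space M"
  shows "(\<lambda>x. T (u x)) \<in> L2_space M" and "L2_norm M (\<lambda>x. T (u x)) \<le> \<bar>K\<bar> * L2_norm M u"
proof -
  note [measurable] = L2_space_measurable[OF u]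
  have m: "(\<lambda>x. T (u x)) \<in> borel_measurable M"
    using T by (intro borel_measurable_continuous_on[of T u M] linear_continuous_on) auto
  have le: "(norm (T (u x)))\<^sup>2 \<le> K\<^sup>2 * (norm (u x))\<^sup>2" for x
  proof -
    have "norm (T (u x)) \<le> \<bar>K\<bar> * norm (u x)"
      using K[of "u x"] mult_right_mono[OF abs_ge_self[of K] norm_ge_zero[of "u x"]] by (simp add: mult.commute)
    then have "(norm (T (u x)))\<^sup>2 \<le> (\<bar>K\<bar> * norm (u x))\<^sup>2" by (rule power_mono) simp
    then show ?thesis by (simp add: power_mult_distrib)
  qed
  have i: "integrable M (\<lambda>x. K\<^sup>2 * (norm (u x))\<^sup>2)" using L2_space_integrable[OF u] by simp
  have int: "integrable M (\<lambda>x. (norm (T (u x)))\<^sup>2)"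
    by (rule Bochner_Integration.integrable_bound[OF i]) (use m le in auto)
  then show "(\<lambda>x. T (u x)) \<in> L2_space M" using m by (simp add: L2_space_def)
  have "(L2_norm M (\<lambda>x. T (u x)))\<^sup>2 \<le> (LINT x|M. K\<^sup>2 * (norm (u x))\<^sup>2)"
    unfolding L2_norm_sq by (rule integral_mono[OF int i le])
  also have "\<dots> = (\<bar>K\<bar> * L2_norm M u)\<^sup>2" by (simp add: L2_norm_sq power_mult_distrib)
  finally show "L2_norm M (\<lambda>x. T (u x)) \<le> \<bar>K\<bar> * L2_norm M u"
    by (rule power2_le_imp_le) simp
qed

text \<open>Complex factors, real scalings and the components of a gradient are all
  instances.\<close>

lemma L2L2_bounded_linear:
  fixes T :: "'b::{real_normed_vector, second_countable_topology} \<Rightarrow> 'c::{real_normed_vector, second_countable_topology}"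
  assumes T: "bounded_linear T" and u: "u \<in> L2L2 P M"
  shows "(\<lambda>\<omega> x. T (u \<omega> x)) \<in> L2L2 P M"
proof -
  interpret T: bounded_linear T by fact
  obtain K where K: "\<And>y. norm (T y) \<le> norm y * K" using T.bounded by blast
  show ?thesis
  proof (rule L2L2_I)
    show "strongly_measurable P (L2_space M) (L2_norm M) (\<lambda>\<omega> x. T (u \<omega> x))"
    proof (rule strongly_measurable_map[OF L2L2_strongly_measurable[OF u]])
      show "(\<lambda>x. T (a x)) \<in> L2_space M" if "a \<in> L2_space M" for a
        using that by (rule L2_bounded_linear(1)[OF T K])
      show "(\<lambda>n. L2_norm M (\<lambda>x. T (s n x) - T (a x))) \<longlonglongrightarrow> 0"
        if *: "a \<in> L2_space M" "\<And>n. s n \<in> L2_space M" "(\<lambda>n. L2_norm M (\<lambda>x. s n x - a x)) \<longlonglongrightarrow> 0" for a s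
      proof (rule Lim_null_comparison)
        show "(\<lambda>n. \<bar>K\<bar> * L2_norm M (\<lambda>x. s n x - a x)) \<longlonglongrightarrow> 0"
          by (rule tendsto_mult_right_zero[OF *(3)])
        show "\<forall>\<^sub>F n in sequentially. norm (L2_norm M (\<lambda>x. T (s n x) - T (a x))) \<le> \<bar>K\<bar> * L2_norm M (\<lambda>x. s n x - a x)"
          using L2_bounded_linear(2)[OF T K L2_space_diff[OF *(2) *(1)]] by (simp add: T.diff)
      qed
    qed
    show "integrable P (\<lambda>\<omega>. K\<^sup>2 * (L2_norm M (u \<omega>))\<^sup>2)" using bochner_L2_integrable[OF u] by simp
    show "AE \<omega> in P. (L2_norm M (\<lambda>x. T (u \<omega> x)))\<^sup>2 \<le> K\<^sup>2 * (L2_norm M (u \<omega>))\<^sup>2"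
    proof (rule AE_I2)
      fix \<omega> assume "\<omega> \<in> space P"
      then have "(L2_norm M (\<lambda>x. T (u \<omega> x)))\<^sup>2 \<le> (\<bar>K\<bar> * L2_norm M (u \<omega>))\<^sup>2"
        by (intro power_mono L2_bounded_linear(2)[OF T K] bochner_L2_in[OF u]) auto
      then show "(L2_norm M (\<lambda>x. T (u \<omega> x)))\<^sup>2 \<le> K\<^sup>2 * (L2_norm M (u \<omega>))\<^sup>2"
        by (simp add: power_mult_distrib)
    qed
  qed
qed

lemma L2L2_cmult: "(u :: 'w \<Rightarrow> 'x \<Rightarrow> complex) \<in> L2L2 P M \<Longrightarrow> (\<lambda>\<omega> x. c * u \<omega> x) \<in> L2L2 P M"
  by (rule L2L2_bounded_linear[OF bounded_linear_mult_right])

lemma L2L2_scaleR: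
  fixes u :: "'w \<Rightarrow> 'x \<Rightarrow> 'b::{real_normed_vector, second_countable_topology}"
  shows "u \<in> L2L2 P M \<Longrightarrow> (\<lambda>\<omega> x. r *\<^sub>R u \<omega> x) \<in> L2L2 P M"
  by (rule L2L2_bounded_linear[OF bounded_linear_scaleR_right])

lemma L2L2_nth: "(u :: 'w \<Rightarrow> 'x \<Rightarrow> complex^'d) \<in> L2L2 P M \<Longrightarrow> (\<lambda>\<omega> x. u \<omega> x $ i) \<in> L2L2 P M"
  by (rule L2L2_bounded_linear[OF bounded_linear_vec_nth])

lemma L2L2_const:
  assumes "finite_measure P" "a \<in> L2_space M"
  shows "(\<lambda>\<omega>. a) \<in> L2L2 P M"
proof -
  interpret finite_measure P by fact
  show ?thesis using assms(2) unfolding bochner_L2_def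
    by (auto intro!: exI[of _ "\<lambda>_ _. a"] simp: L2_norm_def)
qed

text \<open>Measurability of the product only uses that each \<eta>(\<omega>) is essentially
  bounded. The uniform bound C enters for integrability in \<omega>: the product of two square
  integrable random norms need not be square integrable.\<close>

lemma L2L2_mult:
  fixes \<eta> :: "'w \<Rightarrow> 'x \<Rightarrow> real" and u :: "'w \<Rightarrow> 'x \<Rightarrow> complex"
  assumes \<eta>: "\<eta> \<in> L2Linf P M" and bound: "AE \<omega> in P. Linf_norm M (\<eta> \<omega>) \<le> C" and u: "u \<in> L2L2 P M"
  shows "(\<lambda>\<omega> x. of_real (\<eta> \<omega> x) * u \<omega> x) \<in> L2L2 P M"
proof (rule L2L2_I)
  have \<eta>_meas: "strongly_measurable P (Linf_space M) (Linf_norm M) \<eta>" using \<eta> by (simp add: bochner_L2_iff)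
  have Linf: "AE x in M. norm (w x) \<le> Linf_norm M w" "w \<in> borel_measurable M"
    if "w \<in> Linf_space M" for w :: "'x \<Rightarrow> real"
    using Linf_norm_AE[OF that] that by (simp_all add: Linf_space_def)
  have diff: "(\<lambda>x. w x - w' x) \<in> Linf_space M" if "w \<in> Linf_space M" "w' \<in> Linf_space M" for w w' :: "'x \<Rightarrow> real"
  proof -
    have "AE x in M. norm (w x - w' x) \<le> Linf_norm M w + Linf_norm M w'"
      using Linf(1)[OF that(1)] Linf(1)[OF that(2)] by eventually_elim simp
    then show ?thesis using Linf(2)[OF that(1)] Linf(2)[OF that(2)] by (auto simp: Linf_space_def)
  qed
  have in_L2: "(\<lambda>x. of_real (w x) * a x) \<in> L2_space M"
    and le: "L2_norm M (\<lambda>x. of_real (w x) * a x) \<le> \<bar>Linf_norm M w\<bar> * L2_norm M a"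
    if "w \<in> Linf_space M" "a \<in> L2_space M" for w and a :: "'x \<Rightarrow> complex"
    using L2_mult[OF Linf(2)[OF that(1)] Linf(1)[OF that(1)] that(2)] by simp_all
  show "strongly_measurable P (L2_space M) (L2_norm M) (\<lambda>\<omega> x. of_real (\<eta> \<omega> x) * u \<omega> x)"
  proof (rule strongly_measurable_map2[OF \<eta>_meas L2L2_strongly_measurable[OF u]])
    show "(\<lambda>x. of_real (w x) * a x) \<in> L2_space M" if "w \<in> Linf_space M" "a \<in> L2_space M" for w and a :: "'x \<Rightarrow> complex"
      using that by (rule in_L2)
    fix w :: "'x \<Rightarrow> real" and a :: "'x \<Rightarrow> complex" and s t
    assume *: "w \<in> Linf_space M" "a \<in> L2_space M" "\<And>n. s n \<in> Linf_space M" "\<And>n. t n \<in> L2_space M"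
      and lim: "(\<lambda>n. Linf_norm M (\<lambda>x. s n x - w x)) \<longlonglongrightarrow> 0" "(\<lambda>n. L2_norm M (\<lambda>x. t n x - a x)) \<longlonglongrightarrow> 0"
    let ?b = "\<lambda>n. \<bar>Linf_norm M w\<bar> * L2_norm M (\<lambda>x. t n x - a x)
        + \<bar>Linf_norm M (\<lambda>x. s n x - w x)\<bar> * L2_norm M (t n)"
    show "(\<lambda>n. L2_norm M (\<lambda>x. of_real (s n x) * t n x - of_real (w x) * a x)) \<longlonglongrightarrow> 0"
    proof (rule Lim_null_comparison)
      have "?b \<longlonglongrightarrow> \<bar>Linf_norm M w\<bar> * 0 + \<bar>0\<bar> * L2_norm M a"
        by (intro tendsto_intros lim L2_norm_tendsto *)
      then show "?b \<longlonglongrightarrow> 0" by simp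
      show "\<forall>\<^sub>F n in sequentially. norm (L2_norm M (\<lambda>x. of_real (s n x) * t n x - of_real (w x) * a x)) \<le> ?b n"
      proof (rule always_eventually, rule allI)
        fix n
        have d: "(\<lambda>x. t n x - a x) \<in> L2_space M" "(\<lambda>x. s n x - w x) \<in> Linf_space M"
          using * by (auto intro: L2_space_diff diff)
        \<comment> \<open>The increment of t is paired with the fixed limit w, the increment of s
          with t itself, whose norms converge and hence do not spoil the limit.\<close>
        have eq: "(\<lambda>x. of_real (s n x) * t n x - of_real (w x) * a x)
          = (\<lambda>x. of_real (w x) * (t n x - a x) + of_real (s n x - w x) * t n x)"
          by (simp add: fun_eq_iff algebra_simps)
        show "norm (L2_norm M (\<lambda>x. of_real (s n x) * t n x - of_real (w x) * a x)) \<le> ?b n"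
          unfolding eq
          using L2_norm_triangle[OF in_L2[OF *(1) d(1)] in_L2[OF d(2) *(4)[of n]]]
            le[OF *(1) d(1)] le[OF d(2) *(4)[of n]] by simp
      qed
    qed
  qed
  show "integrable P (\<lambda>\<omega>. C\<^sup>2 * (L2_norm M (u \<omega>))\<^sup>2)" using bochner_L2_integrable[OF u] by simp
  show "AE \<omega> in P. (L2_norm M (\<lambda>x. of_real (\<eta> \<omega> x) * u \<omega> x))\<^sup>2 \<le> C\<^sup>2 * (L2_norm M (u \<omega>))\<^sup>2"
    using bound AE_space
  proof eventually_elim
    case (elim \<omega>)
    have w: "\<eta> \<omega> \<in> Linf_space M" by (rule bochner_L2_in[OF \<eta> elim(2)])
    have "AE x in M. norm (\<eta> \<omega> x) \<le> C"
      using Linf(1)[OF w] by eventually_elim (use elim(1) in simp)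
    then have "(L2_norm M (\<lambda>x. of_real (\<eta> \<omega> x) * u \<omega> x))\<^sup>2 \<le> (\<bar>C\<bar> * L2_norm M (u \<omega>))\<^sup>2"
      by (intro power_mono L2_mult(2)[OF Linf(2)[OF w] _ bochner_L2_in[OF u elim(2)]]) auto
    then show ?case by (simp add: power_mult_distrib)
  qed
qed

lemma L2_inner_integrable_P:
  assumes u: "u \<in> L2L2 P M" and v: "v \<in> L2L2 P M"
  shows "integrable P (\<lambda>\<omega>. L2_inner M (u \<omega>) (v \<omega>))"
proof (rule Bochner_Integration.integrable_bound)
  show "integrable P (\<lambda>\<omega>. (L2_norm M (u \<omega>))\<^sup>2 + (L2_norm M (v \<omega>))\<^sup>2)"
    using bochner_L2_integrable[OF u] bochner_L2_integrable[OF v] by simp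
  show "AE \<omega> in P. norm (L2_inner M (u \<omega>) (v \<omega>)) \<le> norm ((L2_norm M (u \<omega>))\<^sup>2 + (L2_norm M (v \<omega>))\<^sup>2)"
  proof (rule AE_I2)
    fix \<omega> assume \<omega>: "\<omega> \<in> space P"
    let ?a = "L2_norm M (u \<omega>)" and ?b = "L2_norm M (v \<omega>)"
    have "norm (L2_inner M (u \<omega>) (v \<omega>)) \<le> ?a * ?b"
      by (rule L2_inner_le[OF bochner_L2_in[OF u \<omega>] bochner_L2_in[OF v \<omega>]])
    also have "\<dots> \<le> ?a\<^sup>2 + ?b\<^sup>2"
    proof -
      have "0 \<le> (?a - ?b)\<^sup>2" "0 \<le> ?a * ?b" by auto
      then show ?thesis unfolding power2_diff by linarith
    qed
    finally show "norm (L2_inner M (u \<omega>) (v \<omega>)) \<le> norm (?a\<^sup>2 + ?b\<^sup>2)" by simp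
  qed
  show "(\<lambda>\<omega>. L2_inner M (u \<omega>) (v \<omega>)) \<in> borel_measurable P"
  proof (rule measurable_functional2[OF L2L2_strongly_measurable[OF u] L2L2_strongly_measurable[OF v]])
    fix a b :: "'b \<Rightarrow> complex" and s t
    assume *: "a \<in> L2_space M" "b \<in> L2_space M" "\<And>n. s n \<in> L2_space M" "\<And>n. t n \<in> L2_space M"
      and lim: "(\<lambda>n. L2_norm M (\<lambda>x. s n x - a x)) \<longlonglongrightarrow> 0" "(\<lambda>n. L2_norm M (\<lambda>x. t n x - b x)) \<longlonglongrightarrow> 0"
    have "(\<lambda>n. L2_inner M (s n) (t n) - L2_inner M a b) \<longlonglongrightarrow> 0"
    proof (rule Lim_null_comparison)
      let ?b = "\<lambda>n. L2_norm M (\<lambda>x. s n x - a x) * (L2_norm M (\<lambda>x. t n x - b x) + L2_norm M b)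
        + L2_norm M a * L2_norm M (\<lambda>x. t n x - b x)"
      have "?b \<longlonglongrightarrow> 0 * (0 + L2_norm M b) + L2_norm M a * 0"
        by (intro tendsto_intros lim)
      then show "?b \<longlonglongrightarrow> 0" by simp
      show "\<forall>\<^sub>F n in sequentially. norm (L2_inner M (s n) (t n) - L2_inner M a b) \<le> ?b n"
        using * by (intro always_eventually allI L2_inner_diff_le) auto
    qed
    then show "(\<lambda>n. L2_inner M (s n) (t n)) \<longlonglongrightarrow> L2_inner M a b" by (simp add: LIM_zero_iff)
  qed
qed

section \<open>Change of variables for rank-one perturbations of the identity\<close>

lemma linear_rank_one: "linear (\<lambda>x. x + (n \<bullet> x) *\<^sub>R v)"
  by (intro linearI) (auto simp: algebra_simps inner_add_right)

text \<open>The matrix determinant lemma. An orthogonal map that takes n to a coordinate vector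
  conjugates the matrix into one that differs from the identity in a single column.\<close>

lemma det_rank_one:
  fixes n v :: "real^'k"
  assumes "norm n = 1"
  shows "det (matrix (\<lambda>x. x + (n \<bullet> x) *\<^sub>R v)) = 1 + n \<bullet> v"
proof -
  obtain k :: 'k where True by simp
  obtain f :: "real^'k \<Rightarrow> real^'k" where f: "orthogonal_transformation f" "f n = axis k 1"
    by (rule orthogonal_transformation_exists_1[OF assms norm_axis_1[of k]]) (rule that)
  define g where "g = (\<lambda>x. x + (n \<bullet> x) *\<^sub>R v)"
  define h where "h = (\<lambda>x. x + (axis k 1 \<bullet> x) *\<^sub>R f v)"
  have lf: "linear f" using f by (simp add: orthogonal_transformation_def)
  have lg: "linear g" unfolding g_def by (rule linear_rank_one)
  have lh: "linear h" unfolding h_def by (rule linear_rank_one)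
  have inner: "f x \<bullet> f y = x \<bullet> y" for x y
    using f by (simp add: orthogonal_transformation_def)
  have "f \<circ> g = h \<circ> f"
    by (auto simp: fun_eq_iff g_def h_def linear_add[OF lf] linear_scale[OF lf] inner simp flip: f(2))
  then have "matrix f ** matrix g = matrix h ** matrix f"
    using matrix_compose[OF lg lf] matrix_compose[OF lf lh] by simp
  then have "det (matrix f) * det (matrix g) = det (matrix h) * det (matrix f)"
    by (metis det_mul)
  moreover have "det (matrix f) \<noteq> 0"
    using f(1) orthogonal_transformation_matrix[of f] det_orthogonal_matrix[of "matrix f"] by auto
  ultimately have "det (matrix g) = det (matrix h)" by simp
  \<comment> \<open>Written in the form of Cramer's rule: replacing column k of the identity by a
    vector gives a determinant equal to the k-th entry of that vector.\<close>
  also have "matrix h = (\<chi> i j. if j = k then ((mat 1 :: real^'k^'k) *v (axis k 1 + f v)) $ i else mat 1 $ i $ j)"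
  proof -
    have nth: "axis j (1::real) $ i = (if i = j then 1 else 0)" for i j :: 'k by (simp add: axis_def)
    show ?thesis
      unfolding matrix_vector_mul_lid
      by (auto simp: matrix_def h_def vec_eq_iff inner_axis_axis nth mat_def)
  qed
  also have "det \<dots> = (axis k 1 + f v) $ k"
    by (simp add: cramer_lemma)
  also have "\<dots> = 1 + axis k 1 \<bullet> f v"
    by (simp add: inner_axis')
  also have "\<dots> = 1 + n \<bullet> v"
    by (simp add: inner flip: f(2))
  finally show ?thesis by (simp add: g_def)
qed

text \<open>The index type is well-ordered because \<open>measure_linear_image\<close>, the volume
  formula for linear images, is stated for such types.\<close>

lemma nn_integral_rank_one_wellorder:
  fixes n v :: "real^'k::{finite,wellorder}"
  assumes n: "norm n = 1" and c: "1 + n \<bullet> v \<noteq> 0" and [measurable]: "f \<in> borel_measurable borel"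
  shows "(\<integral>\<^sup>+x. f x \<partial>lborel) = ennreal \<bar>1 + n \<bullet> v\<bar> * (\<integral>\<^sup>+x. f (x + (n \<bullet> x) *\<^sub>R v) \<partial>lborel)"
proof -
  let ?c = "1 + n \<bullet> v"
  define T where "T = (\<lambda>x. x + (n \<bullet> x) *\<^sub>R v)"
  \<comment> \<open>The Sherman-Morrison formula: the inverse of a rank-one perturbation of the
    identity has the same form, with v divided by -(1 + n \<bullet> v).\<close>
  define S where "S = (\<lambda>x. x + (n \<bullet> x) *\<^sub>R ((- 1 / ?c) *\<^sub>R v))"
  have [measurable]: "T \<in> borel_measurable borel" unfolding T_def by measurable
  have lS: "linear S" unfolding S_def by (rule linear_rank_one)
  have ST: "S (T x) = x" for x
  proof -
    have "n \<bullet> T x = ?c * (n \<bullet> x)" by (simp add: T_def inner_add_right algebra_simps)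
    then have "S (T x) = T x + (?c * (n \<bullet> x)) *\<^sub>R ((- 1 / ?c) *\<^sub>R v)" by (simp add: S_def)
    also have "\<dots> = x" using c by (simp add: T_def)
    finally show ?thesis .
  qed
  have TS: "T (S x) = x" for x
  proof -
    have "n \<bullet> S x = n \<bullet> x - (n \<bullet> x) / ?c * (n \<bullet> v)" by (simp add: S_def inner_diff_right)
    also have "\<dots> = (n \<bullet> x) / ?c" using c by (simp add: field_simps)
    finally have "n \<bullet> S x = (n \<bullet> x) / ?c" .
    then have "T (S x) = S x + ((n \<bullet> x) / ?c) *\<^sub>R v" by (simp add: T_def)
    also have "\<dots> = x" using c by (simp add: S_def)
    finally show ?thesis .
  qed
  have vim: "T -` A = S ` A" for A
    using ST TS by (auto simp: image_iff) metis
  have detS: "det (matrix S) = 1 / ?c"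
    using det_rank_one[OF n, of "(- 1 / ?c) *\<^sub>R v"] c by (simp add: S_def field_simps)
  \<comment> \<open>Lebesgue measure is characterized by its values on boxes. The preimage of a box
    under T is its image under the inverse S, so its volume is divided by |1 + n \<bullet> v|, and
    the density restores it.\<close>
  have "lborel = density (distr lborel borel T) (\<lambda>_. ennreal \<bar>?c\<bar>)"
  proof (rule lborel_eqI)
    fix l u :: "(real, 'k) vec" assume lu: "\<And>b. b \<in> Basis \<Longrightarrow> l \<bullet> b \<le> u \<bullet> b"
    have B: "box l u \<in> lmeasurable" by simp
    have S: "S ` box l u \<in> lmeasurable" by (rule measurable_linear_image[OF lS B])
    have Sb: "T -` box l u \<in> sets borel"
      using measurable_sets[of T borel borel "box l u"] by simp
    have "emeasure (density (distr lborel borel T) (\<lambda>_. ennreal \<bar>?c\<bar>)) (box l u)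
        = ennreal \<bar>?c\<bar> * emeasure lborel (T -` box l u)"
      by (simp add: emeasure_density nn_integral_cmult emeasure_distr)
    also have "emeasure lborel (T -` box l u) = emeasure lebesgue (S ` box l u)"
      using Sb by (simp add: vim)
    also have "\<dots> = ennreal (measure lebesgue (S ` box l u))"
      using S by (simp add: emeasure_eq_measure2 fmeasurableD fmeasurableD2)
    also have "\<dots> = ennreal (\<bar>1 / ?c\<bar> * measure lebesgue (box l u))"
      using measure_linear_image[OF lS B] by (simp add: detS)
    also have "ennreal \<bar>?c\<bar> * \<dots> = ennreal (measure lebesgue (box l u))"
      using c by (simp flip: ennreal_mult'')
    also have "measure lebesgue (box l u) = (\<Prod>b\<in>Basis. (u - l) \<bullet> b)"
      using lu by (simp add: measure_lborel_box_eq)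
    finally show "emeasure (density (distr lborel borel T) (\<lambda>_. ennreal \<bar>?c\<bar>)) (box l u) = (\<Prod>b\<in>Basis. (u - l) \<bullet> b)" .
  qed simp
  then have "(\<integral>\<^sup>+x. f x \<partial>lborel) = (\<integral>\<^sup>+x. f x \<partial>density (distr lborel borel T) (\<lambda>_. ennreal \<bar>?c\<bar>))"
    by simp
  also have "\<dots> = ennreal \<bar>?c\<bar> * (\<integral>\<^sup>+x. f (T x) \<partial>lborel)"
    by (simp add: nn_integral_density nn_integral_cmult nn_integral_distr)
  finally show ?thesis by (simp add: T_def)
qed

lemma prod_inner_Basis_vec:
  fixes w :: "real^'m"
  shows "(\<Prod>b\<in>Basis. w \<bullet> b) = (\<Prod>i\<in>UNIV. w $ i)"
proof -
  have B: "Basis = range (\<lambda>i. axis i 1 :: real^'m)" by (auto simp: Basis_vec_def)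
  have "(\<Prod>b\<in>range (\<lambda>i. axis i 1). w \<bullet> b) = (\<Prod>i\<in>UNIV. w $ i)"
    by (subst prod.reindex) (auto simp: inj_on_def axis_eq_axis inner_axis)
  then show ?thesis unfolding B .
qed

text \<open>Relabelling coordinates along a bijection of index types maps boxes to boxes of the same
  volume and preserves inner products. Hence both Lebesgue measure and the rank-one map are carried
  over from a well-ordered index type to \<open>'d\<close>.\<close>

lemma nn_integral_rank_one_transport:
  fixes n v :: "real^'d" and \<pi> :: "'k::{finite,wellorder} \<Rightarrow> 'd"
  assumes \<pi>: "bij \<pi>"
    and n: "norm n = 1" and c: "1 + n \<bullet> v \<noteq> 0" and [measurable]: "f \<in> borel_measurable borel"
  shows "(\<integral>\<^sup>+x. f x \<partial>lborel) = ennreal \<bar>1 + n \<bullet> v\<bar> * (\<integral>\<^sup>+x. f (x + (n \<bullet> x) *\<^sub>R v) \<partial>lborel)"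
proof -
  define J :: "(real, 'k) vec \<Rightarrow> real^'d" where "J x = (\<chi> i. x $ inv \<pi> i)" for x
  define K :: "real^'d \<Rightarrow> (real, 'k) vec" where "K x = (\<chi> i. x $ \<pi> i)" for x
  have JK: "J (K x) = x" for x
    using \<pi> by (simp add: J_def K_def bij_is_surj surj_f_inv_f)
  have inner: "J x \<bullet> J y = x \<bullet> y" for x y
    unfolding inner_vec_def J_def
    using sum.reindex_bij_betw[OF bij_imp_bij_inv[OF \<pi>], of "\<lambda>i. x $ i * y $ i"] by simp
  have [measurable]: "J \<in> borel_measurable borel"
    unfolding J_def by (intro borel_measurable_continuous_onI continuous_intros)
  have lborel: "lborel = distr lborel borel J"
  proof (rule lborel_eqI)
    fix l u :: "real^'d" assume lu: "\<And>b. b \<in> Basis \<Longrightarrow> l \<bullet> b \<le> u \<bullet> b"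
    have lu': "l $ i \<le> u $ i" for i using lu[of "axis i 1"] by (simp add: inner_axis)
    have vim: "J -` box l u = box (K l) (K u)"
      unfolding box_def Basis_vec_def J_def K_def
      using \<pi> by (auto simp: inner_axis) (metis bij_inv_eq_iff)+
    have "emeasure (distr lborel borel J) (box l u) = emeasure lborel (box (K l) (K u))"
      by (simp add: emeasure_distr vim)
    also have "\<dots> = ennreal (\<Prod>b\<in>Basis. (K u - K l) \<bullet> b)"
      using lu' by (subst emeasure_lborel_box) (auto simp: Basis_vec_def inner_axis K_def)
    also have "(\<Prod>b\<in>Basis. (K u - K l) \<bullet> b) = (\<Prod>b\<in>Basis. (u - l) \<bullet> b)"
      unfolding prod_inner_Basis_vec using prod.reindex_bij_betw[OF \<pi>, of "\<lambda>i. (u - l) $ i"] by (simp add: K_def)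
    finally show "emeasure (distr lborel borel J) (box l u) = (\<Prod>b\<in>Basis. (u - l) \<bullet> b)" .
  qed simp
  have eq: "(\<integral>\<^sup>+x. g x \<partial>lborel) = (\<integral>\<^sup>+x. g (J x) \<partial>lborel)" if [measurable]: "g \<in> borel_measurable borel" for g :: "real^'d \<Rightarrow> ennreal"
    by (subst lborel) (simp add: nn_integral_distr)
  have n': "norm (K n) = 1" and nv: "K n \<bullet> K v = n \<bullet> v"
    using n inner[of "K n" "K n"] inner[of "K n" "K v"] by (simp_all add: JK norm_eq_sqrt_inner)
  have "(\<integral>\<^sup>+x. f x \<partial>lborel) = (\<integral>\<^sup>+x. f (J x) \<partial>lborel)" by (rule eq) simp
  also have "\<dots> = ennreal \<bar>1 + K n \<bullet> K v\<bar> * (\<integral>\<^sup>+x. f (J (x + (K n \<bullet> x) *\<^sub>R K v)) \<partial>lborel)"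
    using nv c by (intro nn_integral_rank_one_wellorder n') simp_all
  also have "(\<lambda>x. f (J (x + (K n \<bullet> x) *\<^sub>R K v))) = (\<lambda>x. f (J x + (n \<bullet> J x) *\<^sub>R v))"
  proof
    fix x
    have "J (x + (K n \<bullet> x) *\<^sub>R K v) = J x + (K n \<bullet> x) *\<^sub>R J (K v)"
      by (simp add: J_def vec_eq_iff)
    moreover have "K n \<bullet> x = n \<bullet> J x" using inner[of "K n" x] by (simp add: JK)
    ultimately show "f (J (x + (K n \<bullet> x) *\<^sub>R K v)) = f (J x + (n \<bullet> J x) *\<^sub>R v)" by (simp add: JK)
  qed
  also have "(\<integral>\<^sup>+x. f (J x + (n \<bullet> J x) *\<^sub>R v) \<partial>lborel) = (\<integral>\<^sup>+x. f (x + (n \<bullet> x) *\<^sub>R v) \<partial>lborel)"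
    by (rule eq[symmetric]) measurable
  finally show ?thesis by (simp add: nv)
qed

text \<open>The dimension restriction supplies a well-ordered index type of the right cardinality:
  one of the numeral types \<open>1\<close>, \<open>2\<close>, \<open>3\<close>.\<close>

lemma nn_integral_rank_one:
  fixes n v :: "real^'d"
  assumes dim: "CARD('d) \<in> {1, 2, 3}"
    and n: "norm n = 1" and c: "1 + n \<bullet> v \<noteq> 0" and f: "f \<in> borel_measurable borel"
  shows "(\<integral>\<^sup>+x. f x \<partial>lborel) = ennreal \<bar>1 + n \<bullet> v\<bar> * (\<integral>\<^sup>+x. f (x + (n \<bullet> x) *\<^sub>R v) \<partial>lborel)"
proof -
  have ex: "\<exists>\<pi>::'k \<Rightarrow> 'd. bij \<pi>" if "CARD('k::finite) = CARD('d)"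
    using finite_same_card_bij[of "UNIV :: 'k set" "UNIV :: 'd set"] that by auto
  consider "CARD(1) = CARD('d)" | "CARD(2) = CARD('d)" | "CARD(3) = CARD('d)"
    using dim by auto
  then show ?thesis
  proof cases
    case 1
    then obtain \<pi> :: "1 \<Rightarrow> 'd" where "bij \<pi>" using ex by blast
    then show ?thesis using n c f by (rule nn_integral_rank_one_transport)
  next
    case 2
    then obtain \<pi> :: "2 \<Rightarrow> 'd" where "bij \<pi>" using ex by blast
    then show ?thesis using n c f by (rule nn_integral_rank_one_transport)
  next
    case 3
    then obtain \<pi> :: "3 \<Rightarrow> 'd" where "bij \<pi>" using ex by blast
    then show ?thesis using n c f by (rule nn_integral_rank_one_transport)
  qed
qed

section \<open>Facets and the outer collar\<close>

locale polygonal_domain =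
  fixes D :: "(real^'d) set"
  assumes domain: "convex_polygonal_domain D"
begin

lemma open_D: "open D" and convex_D: "convex D" and D_nonempty: "D \<noteq> {}"
  and polytope_closure: "polytope (closure D)"
  using domain by (auto simp: convex_polygonal_domain_def)

lemma convex_closure_D: "convex (closure D)" and compact_closure_D: "compact (closure D)"
  using convex_closure[OF convex_D] polytope_imp_compact[OF polytope_closure] by blast+

lemma interior_closure_D: "interior (closure D) = D"
  using convex_interior_closure[OF convex_D] interior_open[OF open_D] by simp

lemma frontier_D: "frontier D = closure D - D"
  by (simp add: frontier_def interior_open open_D)

text \<open>A point of the open set D can be moved a little along n without leaving D, so the
  supporting inequality is strict there.\<close>

lemma outward_normal_less:
  assumes n: "outward_normal D p n" and y: "y \<in> D"
  shows "n \<bullet> y < n \<bullet> p"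
proof -
  obtain e where e: "e > 0" "cball y e \<subseteq> D"
    using open_D y open_contains_cball by blast
  have norm: "norm n = 1" using n by (simp add: outward_normal_def)
  have "y + e *\<^sub>R n \<in> closure D"
    using e norm by (intro subsetD[OF closure_subset] subsetD[OF e(2)]) (auto simp: dist_norm)
  then have "n \<bullet> (y + e *\<^sub>R n) \<le> n \<bullet> p" using n by (auto simp: outward_normal_def)
  moreover have "n \<bullet> n = 1" using norm by (simp add: norm_eq_1)
  ultimately show ?thesis using e(1) by (simp add: inner_add_right)
qed

lemma outward_normal_frontier: "outward_normal D p n \<Longrightarrow> p \<in> frontier D"
  using outward_normal_less by (force simp: frontier_D outward_normal_def)

text \<open>The support value n \<bullet> p is the same at every point that has n as a normal, so
  these points are exactly one facet.\<close>

lemma outward_normal_iff: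
  assumes "outward_normal D p n"
  shows "outward_normal D x n \<longleftrightarrow> x \<in> closure D \<and> n \<bullet> x = n \<bullet> p"
proof
  assume x: "outward_normal D x n"
  have "n \<bullet> x \<le> n \<bullet> p" "n \<bullet> p \<le> n \<bullet> x" using assms x by (auto simp: outward_normal_def)
  then show "x \<in> closure D \<and> n \<bullet> x = n \<bullet> p" using x by (simp add: outward_normal_def)
next
  assume "x \<in> closure D \<and> n \<bullet> x = n \<bullet> p"
  then show "outward_normal D x n" using assms by (simp add: outward_normal_def)
qed

text \<open>The relative boundary of a polyhedron is the union of its facets, and every facet comes
  with a supporting half-space; its normal only has to be scaled to length one.\<close>

lemma outward_normal_exists:
  assumes "p \<in> frontier D"
  obtains n where "outward_normal D p n"
proof -
  have poly: "polyhedron (closure D)" using polytope_closure by (rule polytope_imp_polyhedron)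
  have "rel_interior (closure D) = D"
    using rel_interior_nonempty_interior[of "closure D"] interior_closure_D D_nonempty by simp
  then have "p \<in> \<Union> {F. F facet_of closure D}"
    using assms rel_boundary_of_polyhedron[OF poly] unfolding frontier_D by metis
  then obtain F where F: "F facet_of closure D" "p \<in> F" by blast
  obtain a b where ab: "a \<noteq> 0" "closure D \<subseteq> {x. a \<bullet> x \<le> b}" "F = closure D \<inter> {x. a \<bullet> x = b}"
    by (rule facet_of_polyhedron[OF poly F(1)])
  have p: "p \<in> closure D" "a \<bullet> p = b" using F(2) ab(3) by auto
  define n where "n = a /\<^sub>R norm a"
  have "{y. n \<bullet> y \<le> n \<bullet> p} = {x. a \<bullet> x \<le> b}" "{y. n \<bullet> y = n \<bullet> p} = {x. a \<bullet> x = b}"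
    using ab(1) p by (auto simp: n_def field_simps)
  moreover have "norm n = 1" using ab(1) by (simp add: n_def)
  ultimately have "outward_normal D p n"
    using ab F(1) p by (simp add: outward_normal_def)
  then show ?thesis by (rule that)
qed

text \<open>A facet has codimension one, so it spans the whole supporting hyperplane; that fixes the
  normal up to sign, and a point of D decides the sign.\<close>

lemma outward_normal_unique:
  assumes n: "outward_normal D p n" and n': "outward_normal D p n'"
    and eq: "{x. outward_normal D x n} = {x. outward_normal D x n'}"
  shows "n = n'"
proof -
  let ?F = "{x. outward_normal D x n}"
  have hyp: "affine hull ?F = {y. m \<bullet> y = m \<bullet> p}" if m: "outward_normal D p m" and F: "?F = {x. outward_normal D x m}" for m
  proof -
    have norm: "norm m = 1" using m by (simp add: outward_normal_def)
    then have m0: "m \<noteq> 0" by auto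
    have F_eq: "?F = closure D \<inter> {y. m \<bullet> y = m \<bullet> p}"
      unfolding F using outward_normal_iff[OF m] by auto
    have "?F facet_of closure D" unfolding F_eq using m by (simp add: outward_normal_def)
    then have "aff_dim ?F = aff_dim (closure D) - 1" by (simp add: facet_of_def)
    also have "aff_dim (closure D) = DIM(real^'d)"
      using aff_dim_open[OF open_D D_nonempty] by simp
    finally have dim: "aff_dim ?F = DIM(real^'d) - 1" by simp
    show ?thesis
    proof (rule affine_dim_equal)
      show "affine {y. m \<bullet> y = m \<bullet> p}" by (rule affine_hyperplane)
      show "affine hull ?F \<noteq> {}" using n by auto
      show "affine hull ?F \<subseteq> {y. m \<bullet> y = m \<bullet> p}"
        by (rule hull_minimal) (auto simp: F_eq affine_hyperplane)
      show "aff_dim (affine hull ?F) = aff_dim {y. m \<bullet> y = m \<bullet> p}"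
        using m0 dim by simp
    qed simp
  qed
  have hh: "{y. n \<bullet> y = n \<bullet> p} = {y. n' \<bullet> y = n' \<bullet> p}"
    using hyp[OF n refl] hyp[OF n' eq] by simp
  have nn: "n \<bullet> n = 1" "n' \<bullet> n' = 1" using n n' by (simp_all add: outward_normal_def norm_eq_1)
  \<comment> \<open>The component of n' orthogonal to n. Moving p by w stays in the common
    hyperplane, so w is orthogonal to n' as well, which forces w = 0.\<close>
  define w where "w = n' - (n \<bullet> n') *\<^sub>R n"
  have "n \<bullet> w = 0" using nn by (simp add: w_def inner_diff_right)
  then have "p + w \<in> {y. n' \<bullet> y = n' \<bullet> p}" unfolding hh[symmetric] by (simp add: inner_add_right)
  then have "n' \<bullet> w = 0" by (simp add: inner_add_right)
  then have sq: "(n \<bullet> n')\<^sup>2 = 1" using nn by (simp add: w_def inner_diff_right power2_eq_square inner_commute)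
  obtain q where q: "q \<in> D" using D_nonempty by blast
  have w0: "w = 0"
  proof -
    have "w \<bullet> w = 0" using \<open>n' \<bullet> w = 0\<close> \<open>n \<bullet> w = 0\<close> by (simp add: w_def inner_diff_left)
    then show ?thesis by simp
  qed
  have "n \<bullet> n' \<noteq> -1"
  proof
    assume "n \<bullet> n' = -1"
    then have "n' = - n" using w0 by (simp add: w_def add_eq_0_iff)
    then show False using outward_normal_less[OF n q] outward_normal_less[OF n' q] by simp
  qed
  then have "n \<bullet> n' = 1" using sq by (simp add: power2_eq_1_iff)
  then show ?thesis using w0 by (simp add: w_def)
qed

definition normals :: "(real^'d) set" where
  "normals = {n. \<exists>x. outward_normal D x n}"

text \<open>A normal is determined by its facet, and a polytope has finitely many facets.\<close>

lemma finite_normals: "finite normals"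
proof (rule inj_on_finite)
  let ?F = "\<lambda>n. {x. outward_normal D x n}"
  show "inj_on ?F normals"
  proof (rule inj_onI)
    fix n n' assume nn: "n \<in> normals" "n' \<in> normals" and eq: "?F n = ?F n'"
    then obtain p where "outward_normal D p n" by (auto simp: normals_def)
    then show "n = n'" using eq outward_normal_unique[of p n n'] by blast
  qed
  show "?F ` normals \<subseteq> {T. T facet_of closure D}"
  proof clarify
    fix n assume "n \<in> normals"
    then obtain p where p: "outward_normal D p n" by (auto simp: normals_def)
    then have "?F n = closure D \<inter> {y. n \<bullet> y = n \<bullet> p}" using outward_normal_iff by blast
    then show "?F n facet_of closure D" using p by (simp add: outward_normal_def)
  qed
  show "finite {T. T facet_of closure D}"
    using polytope_closure by (rule finite_polytope_facets)
qed

text \<open>The supporting hyperplane at p separates p + t n from the closure of D by the distance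
  t, and p attains it.\<close>

lemma closest_point_collar:
  assumes n: "outward_normal D p n" and t: "0 \<le> t"
  shows "closest_point (closure D) (p + t *\<^sub>R n) = p"
proof (rule closest_point_unique[symmetric])
  have norm: "norm n = 1" using n by (simp add: outward_normal_def)
  then have nn: "n \<bullet> n = 1" by (simp add: norm_eq_1)
  show "\<forall>z\<in>closure D. dist (p + t *\<^sub>R n) p \<le> dist (p + t *\<^sub>R n) z"
  proof
    fix z assume "z \<in> closure D"
    then have "n \<bullet> z \<le> n \<bullet> p" using n by (auto simp: outward_normal_def)
    then have "t \<le> n \<bullet> (p + t *\<^sub>R n - z)" using nn by (simp add: inner_add_right inner_diff_right)
    also have "\<dots> \<le> norm n * norm (p + t *\<^sub>R n - z)" by (rule norm_cauchy_schwarz)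
    finally show "dist (p + t *\<^sub>R n) p \<le> dist (p + t *\<^sub>R n) z"
      using norm t by (simp add: dist_norm)
  qed
qed (use n convex_closure_D in \<open>auto simp: outward_normal_def\<close>)

definition slab :: "real^'d \<Rightarrow> real^'d \<Rightarrow> real \<Rightarrow> (real^'d) set" where
  "slab n v t = {x + s *\<^sub>R v | x s. outward_normal D x n \<and> 0 < s \<and> s < t}"

abbreviation prism :: "real^'d \<Rightarrow> (real^'d) set" where
  "prism n \<equiv> slab n n 1"

lemma outer_collar_eq: "outer_collar D = (\<Union>n\<in>normals. prism n)"
  by (auto simp: outer_collar_def slab_def normals_def)

text \<open>Solving for the length s turns an image set into a condition on z itself, from which
  Borel measurability is immediate.\<close>

lemma slab_iff:
  assumes p: "outward_normal D p n" and nv: "n \<bullet> v \<noteq> 0"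
  defines "h z \<equiv> (n \<bullet> z - n \<bullet> p) / (n \<bullet> v)"
  shows "z \<in> slab n v t \<longleftrightarrow> 0 < h z \<and> h z < t \<and> z - h z *\<^sub>R v \<in> closure D"
proof
  assume "z \<in> slab n v t"
  then obtain x s where x: "z = x + s *\<^sub>R v" "outward_normal D x n" "0 < s" "s < t"
    by (auto simp: slab_def)
  have "h z = s" using x nv outward_normal_iff[OF p, of x] by (simp add: inner_add_right h_def)
  then show "0 < h z \<and> h z < t \<and> z - h z *\<^sub>R v \<in> closure D"
    using x outward_normal_iff[OF p, of x] by simp
next
  assume z: "0 < h z \<and> h z < t \<and> z - h z *\<^sub>R v \<in> closure D"
  define x where "x = z - h z *\<^sub>R v"
  have "n \<bullet> x = n \<bullet> p" using nv by (simp add: x_def inner_diff_right h_def)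
  then have "outward_normal D x n" using z outward_normal_iff[OF p, of x] by (simp add: x_def)
  then show "z \<in> slab n v t" unfolding slab_def using z
    by (intro CollectI exI[of _ x] exI[of _ "h z"]) (simp add: x_def)
qed

lemma sets_slab [measurable]:
  assumes "n \<in> normals" and nv: "n \<bullet> v \<noteq> 0"
  shows "slab n v t \<in> sets borel"
proof -
  obtain p where p: "outward_normal D p n" using assms by (auto simp: normals_def)
  define h where "h z = (n \<bullet> z - n \<bullet> p) / (n \<bullet> v)" for z
  have h: "continuous_on UNIV h" using nv unfolding h_def by (intro continuous_intros) auto
  have 1: "open {z. 0 < h z \<and> h z < t}"
    by (intro open_Collect_conj open_Collect_less continuous_intros h)
  have "closed ((\<lambda>z. z - h z *\<^sub>R v) -` closure D)"
    using continuous_on_closed_vimage[of UNIV "\<lambda>z. z - h z *\<^sub>R v"] h by (auto intro!: continuous_intros)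
  then have 2: "closed {z. z - h z *\<^sub>R v \<in> closure D}"
    by (simp add: vimage_def)
  have "slab n v t = {z. 0 < h z \<and> h z < t} \<inter> {z. z - h z *\<^sub>R v \<in> closure D}"
    using slab_iff[OF p nv, folded h_def] by blast
  then show ?thesis using 1 2 by simp
qed

lemma inner_self_normals: "n \<in> normals \<Longrightarrow> n \<bullet> n = 1"
  by (auto simp: normals_def outward_normal_def norm_eq_1)

lemma sets_prism [measurable]: "n \<in> normals \<Longrightarrow> prism n \<in> sets borel"
  by (rule sets_slab) (simp_all add: inner_self_normals)

text \<open>The closest-point projection recovers the base point, so the two displacements agree;
  comparing their lengths then identifies the normals.\<close>

lemma prism_disjoint:
  assumes "z \<in> prism n" "z \<in> prism n'"
  shows "n = n'"
proof -
  obtain x t where x: "z = x + t *\<^sub>R n" "outward_normal D x n" "0 < t"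
    using assms(1) by (auto simp: slab_def)
  obtain x' t' where x': "z = x' + t' *\<^sub>R n'" "outward_normal D x' n'" "0 < t'"
    using assms(2) by (auto simp: slab_def)
  have "x = x'"
    using closest_point_collar[OF x(2), of t] closest_point_collar[OF x'(2), of t'] x x' by simp
  then have eq: "t *\<^sub>R n = t' *\<^sub>R n'" using x(1) x'(1) by simp
  then have "norm (t *\<^sub>R n) = norm (t' *\<^sub>R n')" by simp
  then have "t = t'" using x x' by (simp add: outward_normal_def)
  then show ?thesis using eq x by simp
qed

lemma sum_indicator_prism_le: "(\<Sum>n\<in>normals. indicator (prism n) z) \<le> (indicator (outer_collar D) z :: ennreal)"
proof (cases "\<exists>n\<in>normals. z \<in> prism n")
  case True
  then obtain n where n: "n \<in> normals" "z \<in> prism n" by blast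
  have "(\<Sum>m\<in>normals. indicator (prism m) z) = (\<Sum>m\<in>normals. if m = n then 1 else (0::ennreal))"
    using n prism_disjoint by (intro sum.cong) (auto simp: indicator_def)
  also have "\<dots> = 1" using n finite_normals by simp
  finally have "(\<Sum>m\<in>normals. indicator (prism m) z) = (1::ennreal)" .
  moreover have "z \<in> outer_collar D" using n by (auto simp: outer_collar_eq)
  ultimately show ?thesis by simp
next
  case False
  then have "(\<Sum>m\<in>normals. indicator (prism m) z) = (0::ennreal)"
    by (intro sum.neutral) auto
  then show ?thesis by simp
qed

lemma sets_outer_collar [measurable]: "outer_collar D \<in> sets borel"
  unfolding outer_collar_eq using finite_normals by (intro sets.finite_UN sets_prism)

lemma norm_outer_collar_le:
  assumes "D \<subseteq> ball 0 1" "z \<in> outer_collar D"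
  shows "norm z \<le> 2"
proof -
  obtain x t n where x: "z = x + t *\<^sub>R n" "outward_normal D x n" "0 < t" "t < 1"
    using assms(2) by (auto simp: outer_collar_def)
  have "closure D \<subseteq> cball 0 1"
    using closure_mono[OF assms(1)] by simp
  then have "norm x \<le> 1" using x(2) by (auto simp: outward_normal_def)
  moreover have "norm (t *\<^sub>R n) \<le> 1" using x by (simp add: outward_normal_def)
  ultimately show ?thesis using norm_triangle_le[of x "t *\<^sub>R n" 2] x(1) by simp
qed

text \<open>The point p belongs to the last parameter at which the segment is still in the closure
  of D. It cannot lie in the open set D, so it is on the frontier, and the strict supporting
  inequality at y gives the sign of n \<bullet> e.\<close>

lemma crossing:
  assumes y: "y \<in> D" and x: "y + t *\<^sub>R e \<notin> closure D" and t: "0 < t"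
  obtains p n s where "outward_normal D p n" "0 < s" "s < t" "p = y + s *\<^sub>R e" "0 < n \<bullet> e"
proof -
  define S where "S = {s. 0 \<le> s \<and> s \<le> t \<and> y + s *\<^sub>R e \<in> closure D}"
  have "compact S"
  proof -
    have "closed {s. y + s *\<^sub>R e \<in> closure D}"
      using continuous_closed_vimage[OF closed_closure, of "\<lambda>s. y + s *\<^sub>R e" D]
      by (simp add: vimage_def)
    moreover have "S = {0..t} \<inter> {s. y + s *\<^sub>R e \<in> closure D}" by (auto simp: S_def)
    ultimately show ?thesis by (simp add: compact_Int_closed)
  qed
  moreover have "S \<noteq> {}" using y t closure_subset[of D] by (auto simp: S_def intro!: exI[of _ 0])
  ultimately obtain s where s: "s \<in> S" "\<And>r. r \<in> S \<Longrightarrow> r \<le> s"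
    using compact_attains_sup[of S] by blast
  define p where "p = y + s *\<^sub>R e"
  have pK: "p \<in> closure D" and s0: "0 \<le> s" "s \<le> t" using s(1) by (auto simp: S_def p_def)
  have st: "s < t" using x pK s0 by (cases "s = t") (auto simp: p_def)
  have pD: "p \<notin> D"
  proof
    assume "p \<in> D"
    then have "open ((\<lambda>r. y + r *\<^sub>R e) -` D)" "s \<in> (\<lambda>r. y + r *\<^sub>R e) -` D"
      using continuous_open_vimage[OF open_D, of "\<lambda>r. y + r *\<^sub>R e"] by (auto simp: p_def)
    then obtain d where d: "d > 0" "\<And>r. dist r s < d \<Longrightarrow> y + r *\<^sub>R e \<in> D"
      unfolding open_dist by blast
    \<comment> \<open>A slightly later parameter, cut off at t, that would contradict the maximality
      of s.\<close>
    define r where "r = min t (s + d / 2)"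
    have "r > s" "r \<le> t" "dist r s < d" using d st by (auto simp: r_def dist_real_def)
    then have "r \<in> S" using d(2)[of r] closure_subset[of D] s0 by (auto simp: S_def)
    then show False using s(2) \<open>r > s\<close> by fastforce
  qed
  then have "p \<in> frontier D" using pK by (simp add: frontier_D)
  then obtain n where n: "outward_normal D p n" by (rule outward_normal_exists)
  have "s \<noteq> 0" using pD y by (auto simp: p_def)
  then have s_pos: "s > 0" using s0 by simp
  have "0 < n \<bullet> p - n \<bullet> y" using outward_normal_less[OF n y] by simp
  also have "\<dots> = s * (n \<bullet> e)" by (simp add: p_def inner_add_right)
  finally have "0 < n \<bullet> e" using s_pos by (simp add: zero_less_mult_iff)
  then show ?thesis using that n s_pos st p_def by blast
qed

end

section \<open>The surface measure\<close>

lemma lborel_translate: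
  fixes a :: "'a::euclidean_space"
  shows "f \<in> borel_measurable borel \<Longrightarrow> (\<integral>\<^sup>+x. f x \<partial>lborel) = (\<integral>\<^sup>+x. f (a + x) \<partial>lborel)"
    and "g \<in> borel_measurable borel \<Longrightarrow> (LINT x|lborel. (g x :: 'b::{banach, second_countable_topology})) = (LINT x|lborel. g (a + x))"
  by (subst lborel_distr_plus[symmetric, of a], simp add: nn_integral_distr integral_distr)+

lemma AE_lborel_translate:
  fixes a :: "'a::euclidean_space"
  assumes "closed S" "negligible S"
  shows "AE x in lborel. x - a \<notin> S"
proof -
  have "(+) a ` S \<in> null_sets lborel"
    using assms negligible_translation[of S a] closed_translation[of S a]
    by (auto simp: negligible_iff_null_sets null_sets_completion_iff)
  then have "AE x in lborel. x \<notin> (+) a ` S" by (rule AE_not_in)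
  then show ?thesis by eventually_elim (auto simp: image_iff)
qed

context polygonal_domain
begin

lemma closest_point_measurable [measurable]: "closest_point (closure D) \<in> borel_measurable borel"
  using continuous_on_closest_point[OF convex_closure_D closed_closure] D_nonempty
  by (intro borel_measurable_continuous_onI) auto

lemma closest_point_frontier:
  assumes "z \<in> outer_collar D"
  shows "closest_point (closure D) z \<in> frontier D"
  using assms closest_point_collar outward_normal_frontier by (force simp: outer_collar_def)

lemma closest_point_measurable_surface:
  "closest_point (closure D) \<in> restrict_space lborel (outer_collar D) \<rightarrow>\<^sub>M restrict_space borel (frontier D)"
proof (rule measurable_restrict_space2)
  show "closest_point (closure D) \<in> space (restrict_space lborel (outer_collar D)) \<rightarrow> frontier D"
    using closest_point_frontier by (auto simp: space_restrict_space)
  show "closest_point (closure D) \<in> restrict_space lborel (outer_collar D) \<rightarrow>\<^sub>M borel"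
    by (intro measurable_restrict_space1) simp
qed

lemma space_surface: "space (surface_measure D) = frontier D"
  by (simp add: surface_measure_def space_restrict_space)

lemma measurable_surface: "f \<in> borel_measurable borel \<Longrightarrow> f \<in> borel_measurable (surface_measure D)"
  unfolding surface_measure_def by (simp add: measurable_distr_eq1 measurable_restrict_space1)

lemma nn_integral_surface:
  assumes [measurable]: "f \<in> borel_measurable borel"
  shows "(\<integral>\<^sup>+x. f x \<partial>surface_measure D) =
    (\<integral>\<^sup>+z. f (closest_point (closure D) z) * indicator (outer_collar D) z \<partial>lborel)"
proof -
  have "(\<integral>\<^sup>+x. f x \<partial>surface_measure D) =
      (\<integral>\<^sup>+z. f (closest_point (closure D) z) \<partial>restrict_space lborel (outer_collar D))"
    unfolding surface_measure_def
    by (rule nn_integral_distr[OF closest_point_measurable_surface]) (simp add: measurable_restrict_space1)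
  then show ?thesis by (simp add: nn_integral_restrict_space)
qed

lemma emeasure_collar_finite:
  assumes "D \<subseteq> ball 0 1"
  shows "emeasure lborel (outer_collar D) < \<infinity>"
proof -
  have "outer_collar D \<subseteq> cball 0 2" using norm_outer_collar_le[OF assms] by auto
  then have "emeasure lborel (outer_collar D) \<le> emeasure lborel (cball 0 2 :: (real^'d) set)"
    by (intro emeasure_mono) auto
  also have "\<dots> < \<infinity>" using emeasure_bounded_finite[OF bounded_cball] by auto
  finally show ?thesis .
qed

lemma finite_surface:
  assumes "D \<subseteq> ball 0 1"
  shows "finite_measure (surface_measure D)"
proof (rule finite_measureI)
  have "emeasure (surface_measure D) (space (surface_measure D)) = emeasure lborel (outer_collar D)"
    using nn_integral_surface[of "\<lambda>_. 1"] by simp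
  then show "emeasure (surface_measure D) (space (surface_measure D)) \<noteq> \<infinity>"
    using emeasure_collar_finite[OF assms] by simp
qed

lemma integrable_surface:
  fixes f :: "real^'d \<Rightarrow> 'b::{banach, second_countable_topology}"
  assumes "D \<subseteq> ball 0 1" and "f \<in> borel_measurable borel" "\<And>x. x \<in> frontier D \<Longrightarrow> norm (f x) \<le> B"
  shows "integrable (surface_measure D) f"
  using assms by (intro finite_measure.integrable_const_bound[OF finite_surface, of f B])
    (auto intro!: AE_I2 measurable_surface simp: space_surface)

text \<open>The affine map of the proof carries the prism of height one over a facet onto the oblique
  slab of length \<open>t\<close> in direction \<open>e\<close>; its Jacobian is \<open>t (n \<bullet> e)\<close>.\<close>

lemma nn_integral_slab_le:
  fixes f :: "real^'d \<Rightarrow> ennreal"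
  assumes dim: "CARD('d) \<in> {1, 2, 3}" and p: "outward_normal D p n" and ne: "n \<bullet> e \<noteq> 0"
    and e: "norm e = 1" and t: "0 < t" and [measurable]: "f \<in> borel_measurable borel"
  shows "(\<integral>\<^sup>+x. f x * indicator (slab n e t) x \<partial>lborel)
    \<le> ennreal t * (\<integral>\<^sup>+z. f (z + (n \<bullet> z - n \<bullet> p) *\<^sub>R (t *\<^sub>R e - n)) * indicator (prism n) z \<partial>lborel)"
proof -
  have n: "n \<in> normals" "n \<bullet> n = 1" "norm n = 1"
    using p by (auto simp: normals_def outward_normal_def norm_eq_1)
  \<comment> \<open>The affine map T must fix the hyperplane of the facet and send a unit step along
    n to a step t e; its rank-one direction is therefore t e - n.\<close>
  define v where "v = t *\<^sub>R e - n"
  define T where "T z = z + (n \<bullet> z - n \<bullet> p) *\<^sub>R v" for z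
  have nv: "1 + n \<bullet> v = t * (n \<bullet> e)" using n by (simp add: v_def inner_diff_right)
  then have nv0: "1 + n \<bullet> v \<noteq> 0" using t ne by simp
  have T_slab: "T (x + r *\<^sub>R n) = x + (t * r) *\<^sub>R e" if "outward_normal D x n" for x r
    using outward_normal_iff[OF p, of x] that n
    by (simp add: T_def v_def inner_add_right algebra_simps)
  have inj: "a = b" if "T a = T b" for a b
  proof -
    have eq: "(a - b) + (n \<bullet> (a - b)) *\<^sub>R v = 0" using that by (simp add: T_def algebra_simps inner_diff_right)
    then have "n \<bullet> ((a - b) + (n \<bullet> (a - b)) *\<^sub>R v) = 0" by simp
    then have "(n \<bullet> (a - b)) * (1 + n \<bullet> v) = 0" by (simp only: inner_add_right inner_scaleR_right) (simp add: algebra_simps)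
    then show ?thesis using eq nv0 by simp
  qed
  have ind: "indicator (slab n e t) (T z) = (indicator (prism n) z :: ennreal)" for z
  proof -
    have "T z \<in> slab n e t \<longleftrightarrow> z \<in> prism n"
    proof
      assume "z \<in> prism n"
      then obtain x r where x: "z = x + r *\<^sub>R n" "outward_normal D x n" "0 < r" "r < 1"
        by (auto simp: slab_def)
      then have "T z = x + (t * r) *\<^sub>R e" "0 < t * r" "t * r < t" using T_slab t by auto
      then show "T z \<in> slab n e t" using x(2) unfolding slab_def by blast
    next
      assume "T z \<in> slab n e t"
      then obtain x s where x: "T z = x + s *\<^sub>R e" "outward_normal D x n" "0 < s" "s < t"
        by (auto simp: slab_def)
      have "T z = T (x + (s / t) *\<^sub>R n)" unfolding T_slab[OF x(2)] x(1) using t by simp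
      then have "z = x + (s / t) *\<^sub>R n" by (rule inj)
      moreover have "0 < s / t" "s / t < 1" using x t by auto
      ultimately show "z \<in> prism n" using x(2) unfolding slab_def by blast
    qed
    then show ?thesis by (simp add: indicator_def)
  qed
  note [measurable] = sets_slab[OF n(1) ne] sets_prism[OF n(1)]
  define g where "g x = f x * indicator (slab n e t) x" for x
  have [measurable]: "g \<in> borel_measurable borel" unfolding g_def by measurable
  \<comment> \<open>A translation by the constant part of T leaves the linear rank-one map to which
    the change of variables applies.\<close>
  have "(\<integral>\<^sup>+x. g x \<partial>lborel) = (\<integral>\<^sup>+x. g (- (n \<bullet> p) *\<^sub>R v + x) \<partial>lborel)"
    by (rule lborel_translate) simp
  also have "\<dots> = ennreal \<bar>1 + n \<bullet> v\<bar> * (\<integral>\<^sup>+x. g (- (n \<bullet> p) *\<^sub>R v + (x + (n \<bullet> x) *\<^sub>R v)) \<partial>lborel)"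
    by (rule nn_integral_rank_one[OF dim n(3) nv0]) simp
  also have "(\<lambda>x. g (- (n \<bullet> p) *\<^sub>R v + (x + (n \<bullet> x) *\<^sub>R v))) = (\<lambda>x. f (T x) * indicator (prism n) x)"
  proof
    fix x
    have "- (n \<bullet> p) *\<^sub>R v + (x + (n \<bullet> x) *\<^sub>R v) = T x" by (simp add: T_def algebra_simps)
    then show "g (- (n \<bullet> p) *\<^sub>R v + (x + (n \<bullet> x) *\<^sub>R v)) = f (T x) * indicator (prism n) x"
      by (simp add: g_def ind)
  qed
  also have "ennreal \<bar>1 + n \<bullet> v\<bar> * (\<integral>\<^sup>+x. f (T x) * indicator (prism n) x \<partial>lborel)
      \<le> ennreal t * (\<integral>\<^sup>+x. f (T x) * indicator (prism n) x \<partial>lborel)"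
  proof (intro mult_right_mono ennreal_leI)
    \<comment> \<open>The obliqueness factor |n \<bullet> e| of the Jacobian is estimated by 1, so
      that all facets are weighted equally from here on.\<close>
    have "\<bar>n \<bullet> e\<bar> \<le> 1" using Cauchy_Schwarz_ineq2[of n e] n e by simp
    then show "\<bar>1 + n \<bullet> v\<bar> \<le> t" unfolding nv abs_mult using t by (simp add: mult_left_le)
  qed simp
  finally show ?thesis by (simp add: g_def T_def v_def)
qed

text \<open>If exactly one of x and x - t e lies in D, the segment between them meets the frontier.
  \<open>crossing\<close> is run from the end that lies in D, forwards or backwards, which is why
  both signs of n \<bullet> e occur.\<close>

lemma slab_cover:
  assumes "x \<notin> frontier D" "x - t *\<^sub>R e \<notin> frontier D" "x - t *\<^sub>R e \<in> D \<longleftrightarrow> x \<notin> D" and t: "0 < t"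
  shows "\<exists>n\<in>normals. n \<bullet> e \<noteq> 0 \<and> x \<in> slab n e t"
proof (cases "x \<in> D")
  case False
  then have y: "x - t *\<^sub>R e \<in> D" and "x \<notin> closure D" using assms by (auto simp: frontier_D)
  then have "(x - t *\<^sub>R e) + t *\<^sub>R e \<notin> closure D" by simp
  then obtain p n s where *: "outward_normal D p n" "0 < s" "s < t" "p = x - t *\<^sub>R e + s *\<^sub>R e" "0 < n \<bullet> e"
    by (rule crossing[OF y _ t])
  then have "x = p + (t - s) *\<^sub>R e" by (simp add: algebra_simps)
  moreover have "0 < t - s" "t - s < t" using * by auto
  ultimately have "x \<in> slab n e t" unfolding slab_def using *(1) by blast
  then show ?thesis using * by (auto simp: normals_def)
next
  case True
  then have "x - t *\<^sub>R e \<notin> closure D" using assms by (auto simp: frontier_D)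
  then have "x + t *\<^sub>R (- e) \<notin> closure D" by simp
  then obtain p n s where *: "outward_normal D p n" "0 < s" "s < t" "p = x + s *\<^sub>R (- e)" "0 < n \<bullet> (- e)"
    by (rule crossing[OF True _ t])
  then have "x = p + s *\<^sub>R e" by simp
  then have "x \<in> slab n e t" unfolding slab_def using * by blast
  then show ?thesis using * by (auto simp: normals_def)
qed

end

section \<open>Difference quotients and the boundary integral\<close>

context polygonal_domain
begin

lemma emeasure_D_finite: "emeasure lborel D < \<infinity>"
  using bounded_subset[OF compact_imp_bounded[OF compact_closure_D] closure_subset]
  by (rule emeasure_bounded_finite)

text \<open>Translating the integral moves the difference from \<psi> to the indicator of D, which
  is supported in slabs of length t over the facets. There \<psi> differs from its value at the base
  point on the facet by at most \<epsilon>, and the slabs are compared with the prisms behind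
  \<open>surface_measure\<close>.\<close>

lemma difference_quotient_bound:
  fixes \<psi> :: "real^'d \<Rightarrow> 'b::euclidean_space"
  assumes dim: "CARD('d) \<in> {1, 2, 3}" and unit: "D \<subseteq> ball 0 1"
    and meas[measurable]: "\<psi> \<in> borel_measurable borel" and cont: "continuous_on (cball 0 r) \<psi>"
    and r: "r > 1" and e: "norm e = 1" and \<epsilon>: "\<epsilon> > 0"
  obtains \<delta> where "\<delta> > 0" "\<And>t. 0 < t \<Longrightarrow> t < \<delta> \<Longrightarrow>
    norm (LINT x|lborel. indicator D x *\<^sub>R (\<psi> (x + t *\<^sub>R e) - \<psi> x))
      \<le> t * ((LINT x|surface_measure D. norm (\<psi> x)) + \<epsilon> * measure lborel (outer_collar D))"
proof -
  have K: "closure D \<subseteq> cball 0 1" using closure_mono[OF unit] by simp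
  have "uniformly_continuous_on (cball 0 r) \<psi>"
    by (rule compact_uniformly_continuous[OF cont compact_cball])
  then obtain d where d: "d > 0" "\<And>x y. x \<in> cball 0 r \<Longrightarrow> y \<in> cball 0 r \<Longrightarrow> dist y x < d \<Longrightarrow> dist (\<psi> y) (\<psi> x) < \<epsilon>"
    using \<epsilon> unfolding uniformly_continuous_on_def by metis
  obtain B where B: "\<And>x. x \<in> cball 0 r \<Longrightarrow> norm (\<psi> x) \<le> B"
    using compact_imp_bounded[OF compact_continuous_image[OF cont compact_cball]]
    unfolding bounded_iff by blast
  \<comment> \<open>d is a modulus of uniform continuity for \<epsilon>; steps shorter than r - 1
    keep translates of the unit ball inside the ball of radius r.\<close>
  define \<delta> where "\<delta> = min d (r - 1)"
  let ?J = "LINT x|surface_measure D. norm (\<psi> x)"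
  let ?cp = "closest_point (closure D)"
  have fr1: "norm x \<le> 1" if "x \<in> frontier D" for x using that K by (auto simp: frontier_D)
  have intJ: "integrable (surface_measure D) (\<lambda>x. norm (\<psi> x))"
  proof (rule integrable_surface[OF unit, where B = B])
    fix x assume "x \<in> frontier D"
    then have "x \<in> cball 0 r" using fr1[of x] r by simp
    then show "norm (norm (\<psi> x)) \<le> B" using B by simp
  qed simp
  have J: "(\<integral>\<^sup>+z. ennreal (norm (\<psi> (?cp z))) * indicator (outer_collar D) z \<partial>lborel) = ennreal ?J"
    using nn_integral_surface[of "\<lambda>x. ennreal (norm (\<psi> x))"] nn_integral_eq_integral[OF intJ] by simp
  have collar: "emeasure lborel (outer_collar D) = ennreal (measure lborel (outer_collar D))"
    using emeasure_collar_finite[OF unit] by (intro emeasure_eq_ennreal_measure) simp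
  have [measurable]: "D \<in> sets borel" using open_D by simp
  show ?thesis
  proof (rule that)
    show "\<delta> > 0" using d r by (simp add: \<delta>_def)
  next
    fix t assume t: "0 < t" "t < \<delta>"
    \<comment> \<open>What remains of the difference after the translation: u vanishes unless
      exactly one of x and x - t e is in D.\<close>
    define u where "u x = (indicator D (x - t *\<^sub>R e) - indicator D x) *\<^sub>R \<psi> x" for x
    have Dte: "x + t *\<^sub>R e \<in> cball 0 r" if "norm x \<le> 1" for x
      using norm_triangle_ineq[of x "t *\<^sub>R e"] that t e by (simp add: \<delta>_def)
    have int1: "integrable lborel (\<lambda>x. indicator D x *\<^sub>R \<psi> x)"
      by (rule integrableI_bounded_set_indicator[where B = B])
        (use unit r B emeasure_D_finite in \<open>auto intro!: AE_I2\<close>)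
    have int2: "integrable lborel (\<lambda>x. indicator D x *\<^sub>R \<psi> (x + t *\<^sub>R e))"
    proof (rule integrableI_bounded_set_indicator[where B = B])
      show "AE x in lborel. x \<in> D \<longrightarrow> norm (\<psi> (x + t *\<^sub>R e)) \<le> B"
        using unit Dte by (intro AE_I2 impI B) auto
    qed (use emeasure_D_finite in auto)
    have tr: "(LINT x|lborel. indicator D x *\<^sub>R \<psi> (x + t *\<^sub>R e)) = (LINT x|lborel. indicator D (x - t *\<^sub>R e) *\<^sub>R \<psi> x)"
      using lborel_translate(2)[of "\<lambda>x. indicator D (x - t *\<^sub>R e) *\<^sub>R \<psi> x" "t *\<^sub>R e"]
      by (simp add: add.commute)
    have int3: "integrable lborel (\<lambda>x. indicator D (x - t *\<^sub>R e) *\<^sub>R \<psi> x)"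
    proof -
      have "integrable (distr lborel borel ((+) (t *\<^sub>R e))) (\<lambda>x. indicator D (x - t *\<^sub>R e) *\<^sub>R \<psi> x)"
        using int2 by (subst integrable_distr_eq) (auto simp: add.commute)
      then show ?thesis by (simp only: lborel_distr_plus)
    qed
    have u_eq: "u = (\<lambda>x. indicator D (x - t *\<^sub>R e) *\<^sub>R \<psi> x - indicator D x *\<^sub>R \<psi> x)"
      by (simp add: u_def scaleR_diff_left fun_eq_iff)
    have intu: "integrable lborel u" unfolding u_eq using int1 int3 by simp
    have *: "(LINT x|lborel. indicator D x *\<^sub>R (\<psi> (x + t *\<^sub>R e) - \<psi> x)) = (LINT x|lborel. u x)"
      using int1 int2 int3 by (simp add: scaleR_diff_right u_eq tr)
    have "ennreal (norm (LINT x|lborel. indicator D x *\<^sub>R (\<psi> (x + t *\<^sub>R e) - \<psi> x)))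
        \<le> (\<integral>\<^sup>+x. norm (u x) \<partial>lborel)"
      unfolding * by (rule integral_norm_bound_ennreal[OF intu])
    also have "\<dots> \<le> (\<integral>\<^sup>+x. (\<Sum>n\<in>{n\<in>normals. n \<bullet> e \<noteq> 0}. ennreal (norm (\<psi> x)) * indicator (slab n e t) x) \<partial>lborel)"
    proof (rule nn_integral_mono_AE)
      \<comment> \<open>The covering by slabs concerns points off the frontier and off its
        translate; both sets are negligible because D is convex.\<close>
      have neg: "closed (frontier D)" "negligible (frontier D)"
        by (simp_all add: negligible_convex_frontier convex_D)
      show "AE x in lborel. ennreal (norm (u x))
          \<le> (\<Sum>n\<in>{n\<in>normals. n \<bullet> e \<noteq> 0}. ennreal (norm (\<psi> x)) * indicator (slab n e t) x)"
        using AE_lborel_translate[OF neg, of 0] AE_lborel_translate[OF neg, of "t *\<^sub>R e"]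
      proof eventually_elim
        case (elim x)
        show ?case
        proof (cases "x - t *\<^sub>R e \<in> D \<longleftrightarrow> x \<notin> D")
          case True
          then obtain n where n: "n \<in> normals" "n \<bullet> e \<noteq> 0" "x \<in> slab n e t"
            using slab_cover[of x t e] elim t by auto
          have "norm (u x) \<le> norm (\<psi> x)" by (simp add: u_def indicator_def)
          then have "ennreal (norm (u x)) \<le> ennreal (norm (\<psi> x)) * indicator (slab n e t) x"
            using n by (simp add: ennreal_leI)
          also have "\<dots> \<le> (\<Sum>n\<in>{n\<in>normals. n \<bullet> e \<noteq> 0}. ennreal (norm (\<psi> x)) * indicator (slab n e t) x)"
            using n finite_normals by (intro member_le_sum) auto
          finally show ?thesis .
        next
          case False
          then have "u x = 0" by (auto simp: u_def indicator_def)
          then show ?thesis by simp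
        qed
      qed
    qed
    also have "\<dots> = (\<Sum>n\<in>{n\<in>normals. n \<bullet> e \<noteq> 0}. \<integral>\<^sup>+x. ennreal (norm (\<psi> x)) * indicator (slab n e t) x \<partial>lborel)"
      by (rule nn_integral_sum) (use sets_slab in auto)
    also have "\<dots> \<le> (\<Sum>n\<in>{n\<in>normals. n \<bullet> e \<noteq> 0}. ennreal t *
        (\<integral>\<^sup>+z. ennreal (norm (\<psi> (?cp z)) + \<epsilon>) * indicator (prism n) z \<partial>lborel))"
    proof (rule sum_mono)
      fix n assume "n \<in> {n\<in>normals. n \<bullet> e \<noteq> 0}"
      then obtain p where n: "n \<bullet> e \<noteq> 0" and p: "outward_normal D p n" by (auto simp: normals_def)
      have "(\<integral>\<^sup>+x. ennreal (norm (\<psi> x)) * indicator (slab n e t) x \<partial>lborel) \<le> ennreal t *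
        (\<integral>\<^sup>+z. ennreal (norm (\<psi> (z + (n \<bullet> z - n \<bullet> p) *\<^sub>R (t *\<^sub>R e - n)))) * indicator (prism n) z \<partial>lborel)"
        by (rule nn_integral_slab_le[OF dim p n e t(1)]) simp
      also have "\<dots> \<le> ennreal t * (\<integral>\<^sup>+z. ennreal (norm (\<psi> (?cp z)) + \<epsilon>) * indicator (prism n) z \<partial>lborel)"
      proof (intro mult_left_mono nn_integral_mono)
        fix z
        show "ennreal (norm (\<psi> (z + (n \<bullet> z - n \<bullet> p) *\<^sub>R (t *\<^sub>R e - n)))) * indicator (prism n) z
          \<le> ennreal (norm (\<psi> (?cp z)) + \<epsilon>) * indicator (prism n) z"
        proof (cases "z \<in> prism n")
          case True
          then obtain x s where x: "z = x + s *\<^sub>R n" "outward_normal D x n" "0 < s" "s < 1"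
            by (auto simp: slab_def)
          have cp: "?cp z = x" using closest_point_collar[OF x(2), of s] x by simp
          have nn: "n \<bullet> n = 1" using x(2) by (simp add: outward_normal_def norm_eq_1)
          have "n \<bullet> z - n \<bullet> p = s" using x nn outward_normal_iff[OF p, of x] by (simp add: inner_add_right)
          \<comment> \<open>Height s in the prism becomes a displacement s t e of the base point x,
            which is shorter than d, while the closest-point projection of z is x.\<close>
          then have T: "z + (n \<bullet> z - n \<bullet> p) *\<^sub>R (t *\<^sub>R e - n) = x + (s * t) *\<^sub>R e"
            by (simp add: x(1) algebra_simps)
          have x1: "norm x \<le> 1" using x(2) K by (auto simp: outward_normal_def)
          have st: "0 < s * t" "s * t < t" using x t by auto
          have nst: "norm ((s * t) *\<^sub>R e) = s * t" using st(1) e by simp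
          have td: "t < d" "t < r - 1" using t by (simp_all add: \<delta>_def)
          have "norm (x + (s * t) *\<^sub>R e) \<le> r"
            using norm_triangle_ineq[of x "(s * t) *\<^sub>R e"] x1 st(2) td(2) unfolding nst by linarith
          moreover have "dist (x + (s * t) *\<^sub>R e) x < d"
            unfolding dist_norm add_diff_cancel_left' nst using st(2) td(1) by linarith
          ultimately have "dist (\<psi> (x + (s * t) *\<^sub>R e)) (\<psi> x) < \<epsilon>"
            using x1 r by (intro d) auto
          then have "norm (\<psi> (x + (s * t) *\<^sub>R e)) \<le> norm (\<psi> x) + \<epsilon>"
            using norm_triangle_sub[of "\<psi> (x + (s * t) *\<^sub>R e)" "\<psi> x"] by (simp add: dist_norm)
          then show ?thesis unfolding T cp using True by (simp add: ennreal_leI)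
        qed simp
      qed simp
      finally show "(\<integral>\<^sup>+x. ennreal (norm (\<psi> x)) * indicator (slab n e t) x \<partial>lborel)
        \<le> ennreal t * (\<integral>\<^sup>+z. ennreal (norm (\<psi> (?cp z)) + \<epsilon>) * indicator (prism n) z \<partial>lborel)" .
    qed
    \<comment> \<open>Facets parallel to e are added back, because the prisms over all facets
      together make up the collar.\<close>
    also have "\<dots> \<le> (\<Sum>n\<in>normals. ennreal t *
        (\<integral>\<^sup>+z. ennreal (norm (\<psi> (?cp z)) + \<epsilon>) * indicator (prism n) z \<partial>lborel))"
      using finite_normals by (intro sum_mono2) auto
    also have "\<dots> = ennreal t * (\<integral>\<^sup>+z. (\<Sum>n\<in>normals. ennreal (norm (\<psi> (?cp z)) + \<epsilon>) * indicator (prism n) z) \<partial>lborel)"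
      by (subst nn_integral_sum) (auto simp: sum_distrib_left)
    also have "\<dots> \<le> ennreal t * (\<integral>\<^sup>+z. ennreal (norm (\<psi> (?cp z)) + \<epsilon>) * indicator (outer_collar D) z \<partial>lborel)"
      using sum_indicator_prism_le
      by (intro mult_left_mono nn_integral_mono) (auto simp flip: sum_distrib_left intro: mult_left_mono)
    also have "(\<integral>\<^sup>+z. ennreal (norm (\<psi> (?cp z)) + \<epsilon>) * indicator (outer_collar D) z \<partial>lborel)
        = (\<integral>\<^sup>+z. ennreal (norm (\<psi> (?cp z))) * indicator (outer_collar D) z + ennreal \<epsilon> * indicator (outer_collar D) z \<partial>lborel)"
      using \<epsilon> by (intro nn_integral_cong) (simp add: ennreal_plus distrib_right)
    also have "\<dots> = ennreal ?J + ennreal \<epsilon> * emeasure lborel (outer_collar D)"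
      by (subst nn_integral_add) (simp_all add: J nn_integral_cmult)
    also have "\<dots> = ennreal (?J + \<epsilon> * measure lborel (outer_collar D))"
      using \<epsilon> by (simp add: collar ennreal_mult ennreal_plus)
    also have "ennreal t * \<dots> = ennreal (t * (?J + \<epsilon> * measure lborel (outer_collar D)))"
      using t by (intro ennreal_mult[symmetric]) (auto intro!: add_nonneg_nonneg mult_nonneg_nonneg simp: \<epsilon> less_imp_le)
    finally show "norm (LINT x|lborel. indicator D x *\<^sub>R (\<psi> (x + t *\<^sub>R e) - \<psi> x))
      \<le> t * (?J + \<epsilon> * measure lborel (outer_collar D))"
      using t \<epsilon> by (subst (asm) ennreal_le_iff) (auto intro!: mult_nonneg_nonneg add_nonneg_nonneg)
  qed
qed

end

text \<open>The mean value inequality along one segment. Only the derivative in direction e is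
  bounded, matching the hypothesis that \<psi>' is continuous in that single direction.\<close>

lemma directional_bound:
  fixes \<psi> :: "'a::real_normed_vector \<Rightarrow> 'b::real_normed_vector"
  assumes t: "0 \<le> t" and B: "\<And>s. 0 \<le> s \<Longrightarrow> s \<le> t \<Longrightarrow> norm (\<psi>' (x + s *\<^sub>R e) e) \<le> B"
    and der: "\<And>s. 0 \<le> s \<Longrightarrow> s \<le> t \<Longrightarrow> (\<psi> has_derivative \<psi>' (x + s *\<^sub>R e)) (at (x + s *\<^sub>R e))"
  shows "norm (\<psi> (x + t *\<^sub>R e) - \<psi> x) \<le> t * B"
proof -
  let ?g = "\<lambda>s. \<psi> (x + s *\<^sub>R e)" and ?g' = "\<lambda>s h. \<psi>' (x + s *\<^sub>R e) (h *\<^sub>R e)"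
  have "norm (?g t - ?g 0) \<le> B * norm (t - 0)"
  proof (rule differentiable_bound[where S = "{0..t}" and f' = ?g'])
    fix s assume s: "s \<in> {0..t}"
    show "(?g has_derivative ?g' s) (at s within {0..t})"
    proof (rule has_derivative_compose[of "\<lambda>s. x + s *\<^sub>R e" "\<lambda>h. h *\<^sub>R e"])
      show "((\<lambda>s. x + s *\<^sub>R e) has_derivative (\<lambda>h. h *\<^sub>R e)) (at s within {0..t})"
        by (auto intro!: derivative_eq_intros)
      show "(\<psi> has_derivative \<psi>' (x + s *\<^sub>R e)) (at (x + s *\<^sub>R e))" using der s by simp
    qed
    have lin: "linear (\<psi>' (x + s *\<^sub>R e))" using der s has_derivative_linear by force
    show "onorm (?g' s) \<le> B"
      using B[of s] s by (intro onorm_le) (simp add: linear_scale[OF lin] mult.commute[of B] mult_left_mono)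
  qed (use t in auto)
  then show ?thesis using t by (simp add: mult.commute)
qed

lemma difference_quotient_tendsto:
  fixes \<psi> :: "'a::real_normed_vector \<Rightarrow> 'b::real_normed_vector"
  assumes der: "(\<psi> has_derivative \<psi>') (at x)" and e: "e \<noteq> 0"
    and t: "t \<longlonglongrightarrow> 0" "\<And>m. t m \<noteq> (0::real)"
  shows "(\<lambda>m. (\<psi> (x + t m *\<^sub>R e) - \<psi> x) /\<^sub>R t m) \<longlonglongrightarrow> \<psi>' e"
proof -
  have lin: "linear \<psi>'" using der by (rule has_derivative_linear)
  have "(\<lambda>h. norm (\<psi> (x + h) - \<psi> x - \<psi>' h) / norm h) \<midarrow>0\<rightarrow> 0"
    using der by (simp add: has_derivative_at)
  moreover have "filterlim (\<lambda>m. t m *\<^sub>R e) (at 0) sequentially"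
    unfolding filterlim_at using t e
    by (auto intro!: tendsto_eq_intros)
  ultimately have "(\<lambda>m. norm (\<psi> (x + t m *\<^sub>R e) - \<psi> x - \<psi>' (t m *\<^sub>R e)) / norm (t m *\<^sub>R e)) \<longlonglongrightarrow> 0"
    by (rule filterlim_compose)
  from tendsto_mult_right[OF this, of "norm e"]
  have "(\<lambda>m. norm (\<psi> (x + t m *\<^sub>R e) - \<psi> x - \<psi>' (t m *\<^sub>R e)) / \<bar>t m\<bar>) \<longlonglongrightarrow> 0"
    using e by (simp add: field_simps)
  moreover have "norm (\<psi> (x + t m *\<^sub>R e) - \<psi> x - \<psi>' (t m *\<^sub>R e)) / \<bar>t m\<bar>
      = norm ((\<psi> (x + t m *\<^sub>R e) - \<psi> x) /\<^sub>R t m - \<psi>' e)" for m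
  proof -
    have "(\<psi> (x + t m *\<^sub>R e) - \<psi> x) /\<^sub>R t m - \<psi>' e
        = (\<psi> (x + t m *\<^sub>R e) - \<psi> x - \<psi>' (t m *\<^sub>R e)) /\<^sub>R t m"
      using t(2)[of m] by (simp add: linear_scale[OF lin] scaleR_diff_right)
    then show ?thesis by (simp add: divide_inverse mult.commute)
  qed
  ultimately have "(\<lambda>m. norm ((\<psi> (x + t m *\<^sub>R e) - \<psi> x) /\<^sub>R t m - \<psi>' e)) \<longlonglongrightarrow> 0"
    by simp
  then show ?thesis
    by (simp add: tendsto_norm_zero_iff LIM_zero_iff)
qed

context polygonal_domain
begin

text \<open>The difference quotients of \<open>\<psi>\<close> integrate to the mean of \<open>\<psi>\<close> over the thin oblique slabs
  between \<open>D\<close> and its translate.\<close>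

lemma norm_integral_derivative_le:
  fixes \<psi> :: "real^'d \<Rightarrow> 'b::euclidean_space"
  assumes dim: "CARD('d) \<in> {1, 2, 3}" and unit: "D \<subseteq> ball 0 1" and r: "r > 1"
    and der: "\<And>x. x \<in> ball 0 r \<Longrightarrow> (\<psi> has_derivative \<psi>' x) (at x)"
    and cont: "continuous_on (ball 0 r) (\<lambda>x. \<psi>' x e)" and e: "norm e = 1"
  shows "norm (LINT x|lebesgue_on D. \<psi>' x e) \<le> (LINT x|surface_measure D. norm (\<psi> x))"
proof -
  \<comment> \<open>An intermediate radius: the closed ball of radius r1 is compact, so the
    directional derivative is bounded there, and it still contains small translates of D.\<close>
  define r1 where "r1 = (1 + r) / 2"
  have r1: "1 < r1" "r1 < r" using r by (auto simp: r1_def)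
  then have sub: "cball (0::real^'d) r1 \<subseteq> ball 0 r" by auto
  \<comment> \<open>Extension by zero makes \<psi> and its derivative Borel measurable on the whole
    space without changing them near D.\<close>
  define \<psi>0 where "\<psi>0 x = (if x \<in> ball 0 r then \<psi> x else 0)" for x
  define d0 where "d0 x = (if x \<in> ball 0 r then \<psi>' x e else 0)" for x
  have cont\<psi>: "continuous_on (ball 0 r) \<psi>"
    by (intro continuous_at_imp_continuous_on ballI has_derivative_continuous[OF der])
  have [measurable]: "\<psi>0 \<in> borel_measurable borel" "d0 \<in> borel_measurable borel"
    unfolding \<psi>0_def d0_def
    by (rule borel_measurable_continuous_on_if, simp, fact cont\<psi> cont, simp)+
  have [measurable]: "D \<in> sets borel" using open_D by simp
  have cont0: "continuous_on (cball 0 r1) \<psi>0"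
    using continuous_on_subset[OF cont\<psi> sub]
    by (rule continuous_on_eq) (use sub in \<open>auto simp: \<psi>0_def\<close>)
  obtain B where B: "\<And>x. x \<in> cball 0 r1 \<Longrightarrow> norm (\<psi>' x e) \<le> B"
    using compact_imp_bounded[OF compact_continuous_image[OF continuous_on_subset[OF cont sub] compact_cball]]
    unfolding bounded_iff by blast
  \<comment> \<open>Step sizes tending to 0 that never exceed r1 - 1, so every segment starting in D
    stays in the compact ball and one bound dominates all difference quotients.\<close>
  define t where "t m = (r1 - 1) / real (Suc m)" for m
  have "t \<longlonglongrightarrow> 0"
    unfolding t_def divide_inverse by (rule tendsto_mult_right_zero[OF LIMSEQ_inverse_real_of_nat])
  moreover have "0 < t m" for m using r1 by (simp add: t_def)
  moreover have "t m \<le> r1 - 1" for m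
    using divide_left_mono[of 1 "real (Suc m)" "r1 - 1"] r1 by (simp add: t_def)
  ultimately have t: "t \<longlonglongrightarrow> 0" "\<And>m. 0 < t m" "\<And>m. t m \<le> r1 - 1" by blast+
  have D1: "norm x < 1" if "x \<in> D" for x using that unit by auto
  have seg: "x + s *\<^sub>R e \<in> cball 0 r1" if "x \<in> D" "0 \<le> s" "s \<le> r1 - 1" for x s
    using norm_triangle_ineq[of x "s *\<^sub>R e"] D1[OF that(1)] that e by simp
  let ?q = "\<lambda>m x. indicator D x *\<^sub>R ((\<psi>0 (x + t m *\<^sub>R e) - \<psi>0 x) /\<^sub>R t m)"
  have lim: "(\<lambda>m. LINT x|lborel. ?q m x) \<longlonglongrightarrow> (LINT x|lborel. indicator D x *\<^sub>R d0 x)"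
  proof (rule integral_dominated_convergence)
    show "integrable lborel (\<lambda>x. indicator D x * B)"
      using emeasure_D_finite by (intro integrable_mult_left integrable_real_indicator) auto
    show "AE x in lborel. (\<lambda>m. ?q m x) \<longlonglongrightarrow> indicator D x *\<^sub>R d0 x"
    proof (rule AE_I2)
      fix x :: "real^'d"
      show "(\<lambda>m. ?q m x) \<longlonglongrightarrow> indicator D x *\<^sub>R d0 x"
      proof (cases "x \<in> D")
        case True
        then have x: "x \<in> ball 0 r" using seg[OF True, of 0] r1 sub by auto
        have "(\<lambda>m. (\<psi> (x + t m *\<^sub>R e) - \<psi> x) /\<^sub>R t m) \<longlonglongrightarrow> \<psi>' x e"
          using e t by (intro difference_quotient_tendsto der x) (auto simp: less_imp_neq[symmetric])
        moreover have "\<psi>0 (x + t m *\<^sub>R e) = \<psi> (x + t m *\<^sub>R e)" "\<psi>0 x = \<psi> x" for m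
          using seg[OF True, of "t m"] t(2,3)[of m] sub x by (auto simp: \<psi>0_def)
        ultimately show ?thesis using True x by (simp add: d0_def)
      qed simp
    qed
    fix m
    show "AE x in lborel. norm (?q m x) \<le> indicator D x * B"
    proof (rule AE_I2)
      fix x :: "real^'d"
      show "norm (?q m x) \<le> indicator D x * B"
      proof (cases "x \<in> D")
        case True
        have "norm (\<psi> (x + t m *\<^sub>R e) - \<psi> x) \<le> t m * B"
        proof (rule directional_bound)
          fix s assume "0 \<le> s" "s \<le> t m"
          then have "x + s *\<^sub>R e \<in> cball 0 r1" using seg[OF True, of s] t(3)[of m] by simp
          then show "norm (\<psi>' (x + s *\<^sub>R e) e) \<le> B" "(\<psi> has_derivative \<psi>' (x + s *\<^sub>R e)) (at (x + s *\<^sub>R e))"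
            using B der sub by blast+
        qed (use t(2) in \<open>simp add: less_imp_le\<close>)
        moreover have "\<psi>0 (x + t m *\<^sub>R e) = \<psi> (x + t m *\<^sub>R e)" "\<psi>0 x = \<psi> x"
          using seg[OF True, of "t m"] seg[OF True, of 0] t(2,3)[of m] sub r1 by (auto simp: \<psi>0_def)
        ultimately show ?thesis using True t(2)[of m] by (simp add: divide_simps mult.commute)
      qed simp
    qed
  qed measurable
  have int_eq: "(LINT x|lebesgue_on D. \<psi>' x e) = (LINT x|lborel. indicator D x *\<^sub>R d0 x)"
  proof -
    have "(LINT x|lebesgue_on D. \<psi>' x e) = (LINT x|lebesgue. indicator D x *\<^sub>R \<psi>' x e)"
      by (rule integral_restrict_space) simp
    also have "(\<lambda>x. indicator D x *\<^sub>R \<psi>' x e) = (\<lambda>x. indicator D x *\<^sub>R d0 x)"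
      using D1 r by (fastforce simp: d0_def indicator_def fun_eq_iff)
    also have "(LINT x|lebesgue. indicator D x *\<^sub>R d0 x) = (LINT x|lborel. indicator D x *\<^sub>R d0 x)"
      by (rule integral_completion) simp
    finally show ?thesis .
  qed
  let ?J = "LINT x|surface_measure D. norm (\<psi> x)" and ?V = "measure lborel (outer_collar D)"
  have J: "(LINT x|surface_measure D. norm (\<psi>0 x)) = ?J"
  proof (rule Bochner_Integration.integral_cong)
    fix x assume "x \<in> space (surface_measure D)"
    then have "x \<in> closure D" by (simp add: space_surface frontier_D)
    then have "norm x \<le> 1" using closure_mono[OF unit] by auto
    then show "norm (\<psi>0 x) = norm (\<psi> x)" using r by (simp add: \<psi>0_def)
  qed simp
  have le: "norm (LINT x|lebesgue_on D. \<psi>' x e) \<le> ?J + \<epsilon> * ?V" if \<epsilon>: "\<epsilon> > 0" for \<epsilon>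
  proof -
    obtain \<delta> where \<delta>: "\<delta> > 0" "\<And>t. 0 < t \<Longrightarrow> t < \<delta> \<Longrightarrow>
      norm (LINT x|lborel. indicator D x *\<^sub>R (\<psi>0 (x + t *\<^sub>R e) - \<psi>0 x)) \<le> t * (?J + \<epsilon> * ?V)"
      by (rule difference_quotient_bound[OF dim unit \<open>\<psi>0 \<in> borel_measurable borel\<close> cont0 r1(1) e \<epsilon>, unfolded J])
        (rule that, assumption, blast)
    have ev: "\<forall>\<^sub>F m in sequentially. t m < \<delta>"
      using order_tendstoD(2)[OF t(1) \<delta>(1)] .
    have "\<forall>\<^sub>F m in sequentially. norm (LINT x|lborel. ?q m x) \<le> ?J + \<epsilon> * ?V"
      using ev
    proof eventually_elim
      case (elim m)
      have "(LINT x|lborel. ?q m x) = (LINT x|lborel. inverse (t m) *\<^sub>R (indicator D x *\<^sub>R (\<psi>0 (x + t m *\<^sub>R e) - \<psi>0 x)))"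
        by (simp add: mult.commute)
      also have "\<dots> = inverse (t m) *\<^sub>R (LINT x|lborel. indicator D x *\<^sub>R (\<psi>0 (x + t m *\<^sub>R e) - \<psi>0 x))"
        by (rule integral_scaleR_right)
      also have "norm \<dots> = norm (LINT x|lborel. indicator D x *\<^sub>R (\<psi>0 (x + t m *\<^sub>R e) - \<psi>0 x)) / t m"
        using t(2)[of m] by (simp add: divide_inverse mult.commute)
      also have "\<dots> \<le> ?J + \<epsilon> * ?V"
        using \<delta>(2)[OF t(2) elim] t(2)[of m] by (simp add: pos_divide_le_eq mult.commute)
      finally show ?case .
    qed
    then show ?thesis unfolding int_eq
      by (rule tendsto_upperbound[OF tendsto_norm[OF lim]]) simp
  qed
  show ?thesis
  proof (rule field_le_epsilon)
    fix \<eta> :: real assume \<eta>: "\<eta> > 0"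
    have V: "0 \<le> ?V" by (rule measure_nonneg)
    \<comment> \<open>The collar volume is increased by 1 to obtain a positive denominator when the
      error is scaled.\<close>
    then have V1: "0 < ?V + 1" by linarith
    have "norm (LINT x|lebesgue_on D. \<psi>' x e) \<le> ?J + \<eta> / (?V + 1) * ?V"
      by (rule le[OF divide_pos_pos[OF \<eta> V1]])
    also have "\<eta> / (?V + 1) * ?V \<le> \<eta>"
    proof -
      have "\<eta> * ?V \<le> \<eta> * (?V + 1)" using \<eta> by (intro mult_left_mono) auto
      then show ?thesis using V1 by (simp add: pos_divide_le_eq)
    qed
    finally show "norm (LINT x|lebesgue_on D. \<psi>' x e) \<le> ?J + \<eta>" by simp
  qed
qed

end

section \<open>Smooth functions and Friedrichs' inequality\<close>

lemma smooth_differentiable: "smooth \<phi> \<Longrightarrow> \<phi> differentiable (at x)"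
  unfolding smooth_def using C_k.simps(2)[of 0 \<phi>] by blast

lemma smooth_partial: "smooth \<phi> \<Longrightarrow> smooth (partial i \<phi>)"
  unfolding smooth_def using C_k.simps(2) by blast

lemma smooth_continuous: "smooth \<phi> \<Longrightarrow> continuous_on UNIV \<phi>"
  unfolding smooth_def using C_k.simps(1) by blast

lemma smooth_has_derivative: "smooth \<phi> \<Longrightarrow> (\<phi> has_derivative frechet_derivative \<phi> (at x)) (at x)"
  using smooth_differentiable frechet_derivative_works by blast

lemma continuous_grad: "smooth \<phi> \<Longrightarrow> continuous_on UNIV (grad \<phi>)"
  unfolding grad_def by (intro continuous_intros smooth_continuous smooth_partial)

lemma norm_partial_le: "norm (partial i \<phi> x) \<le> norm (grad \<phi> x)"
  using Finite_Cartesian_Product.norm_nth_le[of "grad \<phi> x" i] by (simp add: grad_def)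

context polygonal_domain
begin

lemma finite_lebesgue_on_D: "finite_measure (lebesgue_on D)"
proof (rule finite_measureI)
  have "D \<in> sets borel" using open_D by simp
  then show "emeasure (lebesgue_on D) (space (lebesgue_on D)) \<noteq> \<infinity>"
    using emeasure_D_finite by (simp add: emeasure_restrict_space)
qed

lemma integrable_lebesgue_on_D:
  fixes f :: "real^'d \<Rightarrow> 'b::euclidean_space"
  assumes "continuous_on (closure D) f"
  shows "integrable (lebesgue_on D) f"
proof -
  obtain B where B: "\<And>x. x \<in> closure D \<Longrightarrow> norm (f x) \<le> B"
    using compact_imp_bounded[OF compact_continuous_image[OF assms compact_closure_D]]
    unfolding bounded_iff by blast
  have "D \<in> sets lebesgue" using open_D by simp
  then have "f \<in> borel_measurable (lebesgue_on D)"
    using continuous_on_subset[OF assms closure_subset]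
    by (intro continuous_imp_measurable_on_sets_lebesgue)
  then show ?thesis
    using B closure_subset[of D]
    by (intro finite_measure.integrable_const_bound[OF finite_lebesgue_on_D, of f B])
      (auto intro!: AE_I2)
qed

text \<open>The inequality follows by integrating the derivative of \<open>h(x\<^sub>i) |\<phi>|\<^sup>2\<close>, where \<open>h\<close> solves the
  Riccati inequality \<open>h' - h\<^sup>2 \<ge> c\<close> on \<open>[-1, 1]\<close>; the solution \<open>\<surd>c tan(\<surd>c s)\<close> is replaced by a
  rational function.\<close>

lemma friedrichs_smooth:
  fixes \<phi> :: "real^'d \<Rightarrow> complex" and b :: real
  assumes dim: "CARD('d) \<in> {1, 2, 3}" and unit: "D \<subseteq> ball 0 1" and \<phi>: "smooth \<phi>"
    and b: "0 < b" "b < 1"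
  defines "c \<equiv> 3 * b - b\<^sup>2"
  shows "c * (LINT x|lebesgue_on D. (norm (\<phi> x))\<^sup>2)
    \<le> c / (1 - b) * (LINT x|surface_measure D. (norm (\<phi> x))\<^sup>2) + (LINT x|lebesgue_on D. (norm (grad \<phi> x))\<^sup>2)"
proof -
  obtain i :: 'd where True by simp
  define e :: "real^'d" where "e = axis i 1"
  have e: "norm e = 1" by (simp add: e_def norm_axis_1)
  have c: "c > 0" using b by (simp add: c_def power2_eq_square field_simps)
  \<comment> \<open>The shape of the Pade approximant x / (1 - x^2 / 3) of tan x, with the parameter
    b in place of the coefficient.\<close>
  define h where "h s = c * s / (1 - b * s\<^sup>2)" for s
  define h' where "h' s = c * (1 + b * s\<^sup>2) / (1 - b * s\<^sup>2)\<^sup>2" for s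
  \<comment> \<open>The pole of h. It exceeds 1 because b < 1, so the closure of D stays away from
    it.\<close>
  define r where "r = 1 / sqrt b"
  have r: "r > 1" using b by (simp add: r_def)
  have pos: "1 - b * (x $ i)\<^sup>2 > 0" if "x \<in> ball 0 r" for x :: "real^'d"
  proof -
    have "\<bar>x $ i\<bar> < r" using that component_le_norm_cart[of x i] by simp
    then have "(x $ i)\<^sup>2 < r\<^sup>2" by (metis abs_ge_zero power2_abs power_strict_mono zero_less_numeral)
    then show ?thesis using b by (simp add: r_def power_divide field_simps)
  qed
  have dh: "(h has_real_derivative h' s) (at s)" if "1 - b * s\<^sup>2 > 0" for s
  proof -
    have "(h has_real_derivative (c * (1 - b * s\<^sup>2) - c * s * (- (b * (2 * s)))) / ((1 - b * s\<^sup>2) * (1 - b * s\<^sup>2))) (at s)"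
      unfolding h_def using that by (auto intro!: derivative_eq_intros)
    also have "(c * (1 - b * s\<^sup>2) - c * s * (- (b * (2 * s)))) = c * (1 + b * s\<^sup>2)"
      by (simp add: algebra_simps power2_eq_square)
    finally show ?thesis by (simp add: h'_def power2_eq_square)
  qed
  define F where "F x = frechet_derivative \<phi> (at x)" for x
  have dF: "(\<phi> has_derivative F x) (at x)" for x
    unfolding F_def by (rule smooth_has_derivative[OF \<phi>])
  have Fe: "F x e = partial i \<phi> x" for x by (simp add: F_def partial_def e_def)
  define \<psi> where "\<psi> x = h (x $ i) * (\<phi> x \<bullet> \<phi> x)" for x
  define \<psi>' where "\<psi>' x v = h' (x $ i) * (v $ i) * (\<phi> x \<bullet> \<phi> x) + h (x $ i) * (2 * (\<phi> x \<bullet> F x v))" for x v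
  have d\<psi>: "(\<psi> has_derivative \<psi>' x) (at x)" if "x \<in> ball 0 r" for x
  proof -
    have "((\<lambda>x. h (x $ i)) has_derivative (\<lambda>v. h' (x $ i) * (v $ i))) (at x)"
    proof (rule has_derivative_compose[of "\<lambda>x. x $ i" "\<lambda>v. v $ i" x UNIV h "(*) (h' (x $ i))"])
      show "((\<lambda>x. x $ i) has_derivative (\<lambda>v. v $ i)) (at x)"
        by (rule bounded_linear_imp_has_derivative[OF bounded_linear_vec_nth])
      show "(h has_derivative (*) (h' (x $ i))) (at (x $ i))"
        using dh[OF pos[OF that]] by (simp add: has_field_derivative_def)
    qed
    from has_derivative_mult[OF this has_derivative_inner[OF dF dF]]
    show ?thesis unfolding \<psi>_def[abs_def] \<psi>'_def
      by (rule has_derivative_eq_rhs) (auto simp: inner_commute)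
  qed
  have cont_h: "continuous_on (ball 0 r) (\<lambda>x::real^'d. h (x $ i))" "continuous_on (ball 0 r) (\<lambda>x::real^'d. h' (x $ i))"
    unfolding h_def h'_def using pos by (auto intro!: continuous_intros simp del: mem_ball) fastforce+
  have cont_\<phi>: "continuous_on S \<phi>" "continuous_on S (partial i \<phi>)" "continuous_on S (grad \<phi>)" for S
    using smooth_continuous[OF \<phi>] smooth_continuous[OF smooth_partial[OF \<phi>]] continuous_grad[OF \<phi>]
    by (auto intro: continuous_on_subset)
  have cont\<psi>: "continuous_on (ball 0 r) (\<lambda>x. \<psi>' x e)"
    unfolding \<psi>'_def Fe by (intro continuous_intros cont_h cont_\<phi>)
  have K: "closure D \<subseteq> cball 0 1" using closure_mono[OF unit] by simp
  have Kr: "closure D \<subseteq> ball 0 r" using K r by auto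
  have xi: "(x $ i)\<^sup>2 \<le> 1" if "x \<in> closure D" for x
    using that K component_le_norm_cart[of x i] by (force simp: abs_square_le_1)
  have le: "c * (norm (\<phi> x))\<^sup>2 - (norm (grad \<phi> x))\<^sup>2 \<le> \<psi>' x e" if x: "x \<in> D" for x
  proof -
    let ?s = "x $ i"
    have x': "x \<in> closure D" using x closure_subset by blast
    then have p: "1 - b * ?s\<^sup>2 > 0" using Kr by (intro pos) blast
    have ric: "c \<le> h' ?s - (h ?s)\<^sup>2"
    proof -
      \<comment> \<open>This identity is the origin of the constant c = 3 b - b^2: for the given b
        it is the largest one for which the Riccati inequality for h holds on [-1, 1], with equality
        at the end points.\<close>
      have "0 \<le> ?s\<^sup>2 * (b\<^sup>2 * (1 - ?s\<^sup>2))" using xi[OF x'] by (intro mult_nonneg_nonneg) auto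
      also have "\<dots> = (1 + b * ?s\<^sup>2 - c * ?s\<^sup>2) - (1 - b * ?s\<^sup>2)\<^sup>2"
        by (simp add: c_def power2_eq_square algebra_simps)
      finally have "c * (1 - b * ?s\<^sup>2)\<^sup>2 \<le> c * (1 + b * ?s\<^sup>2 - c * ?s\<^sup>2)"
        using c by (intro mult_left_mono) auto
      then have "c \<le> c * (1 + b * ?s\<^sup>2 - c * ?s\<^sup>2) / (1 - b * ?s\<^sup>2)\<^sup>2"
        using p by (simp add: pos_le_divide_eq)
      also have "\<dots> = h' ?s - (h ?s)\<^sup>2"
        by (simp add: h_def h'_def power_divide power_mult_distrib diff_divide_distrib[symmetric])
          (simp add: power2_eq_square algebra_simps)
      finally show ?thesis .
    qed
    \<comment> \<open>Completing the square absorbs the mixed term of the derivative at the price of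
      -h^2 |\<phi>|^2, which the Riccati inequality pays for.\<close>
    have "0 \<le> (norm (h ?s *\<^sub>R \<phi> x + partial i \<phi> x))\<^sup>2" by simp
    also have "\<dots> = (h ?s)\<^sup>2 * (norm (\<phi> x))\<^sup>2 + 2 * h ?s * (\<phi> x \<bullet> partial i \<phi> x) + (norm (partial i \<phi> x))\<^sup>2"
      by (simp only: power2_norm_eq_inner inner_add_left inner_add_right inner_scaleR_left inner_scaleR_right)
        (simp add: inner_commute power2_eq_square algebra_simps)
    finally have 1: "- (h ?s)\<^sup>2 * (norm (\<phi> x))\<^sup>2 - (norm (partial i \<phi> x))\<^sup>2 \<le> 2 * h ?s * (\<phi> x \<bullet> partial i \<phi> x)"
      by simp
    have 2: "(norm (partial i \<phi> x))\<^sup>2 \<le> (norm (grad \<phi> x))\<^sup>2"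
      by (intro power_mono norm_partial_le) simp
    have 3: "c * (norm (\<phi> x))\<^sup>2 \<le> (h' ?s - (h ?s)\<^sup>2) * (norm (\<phi> x))\<^sup>2"
      by (rule mult_right_mono[OF ric]) simp
    have "\<psi>' x e = h' ?s * (norm (\<phi> x))\<^sup>2 + 2 * h ?s * (\<phi> x \<bullet> partial i \<phi> x)"
    proof -
      have "e $ i = 1" by (simp add: e_def)
      then show ?thesis by (simp add: \<psi>'_def Fe power2_norm_eq_inner)
    qed
    then show ?thesis using 1 2 3 unfolding left_diff_distrib by linarith
  qed
  have int: "integrable (lebesgue_on D) (\<lambda>x. (norm (\<phi> x))\<^sup>2)" "integrable (lebesgue_on D) (\<lambda>x. (norm (grad \<phi> x))\<^sup>2)"
    by (intro integrable_lebesgue_on_D continuous_intros cont_\<phi>)+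
  have "c * (LINT x|lebesgue_on D. (norm (\<phi> x))\<^sup>2) - (LINT x|lebesgue_on D. (norm (grad \<phi> x))\<^sup>2)
      = (LINT x|lebesgue_on D. c * (norm (\<phi> x))\<^sup>2 - (norm (grad \<phi> x))\<^sup>2)"
    using int by simp
  also have "\<dots> \<le> (LINT x|lebesgue_on D. \<psi>' x e)"
    using int le integrable_lebesgue_on_D[OF continuous_on_subset[OF cont\<psi> Kr]]
    by (intro integral_mono) auto
  also have "\<dots> \<le> (LINT x|surface_measure D. norm (\<psi> x))"
    using norm_integral_derivative_le[OF dim unit r d\<psi> cont\<psi> e] by simp
  also have "\<dots> \<le> (LINT x|surface_measure D. c / (1 - b) * (norm (\<phi> x))\<^sup>2)"
  proof (rule integral_mono')
    obtain B where B: "\<And>x. x \<in> closure D \<Longrightarrow> norm (\<phi> x) \<le> B"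
      using compact_imp_bounded[OF compact_continuous_image[OF cont_\<phi>(1) compact_closure_D]]
      unfolding bounded_iff by blast
    have "integrable (surface_measure D) (\<lambda>x. (norm (\<phi> x))\<^sup>2)"
    proof (rule integrable_surface[OF unit, where B = "B\<^sup>2"])
      show "(\<lambda>x. (norm (\<phi> x))\<^sup>2) \<in> borel_measurable borel"
        by (intro borel_measurable_continuous_onI continuous_intros cont_\<phi>)
      show "norm ((norm (\<phi> x))\<^sup>2) \<le> B\<^sup>2" if "x \<in> frontier D" for x
        using B[of x] that by (simp add: frontier_D power_mono)
    qed
    then show "integrable (surface_measure D) (\<lambda>x. c / (1 - b) * (norm (\<phi> x))\<^sup>2)" by simp
    fix x assume "x \<in> space (surface_measure D)"
    then have x: "x \<in> closure D" by (simp add: space_surface frontier_D)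
    \<comment> \<open>On [-1, 1] the function |h| is largest at the end points, with value c / (1 -
      b); this is the boundary coefficient of the inequality.\<close>
    have "\<bar>h (x $ i)\<bar> \<le> c / (1 - b)"
    proof -
      have "b * (x $ i)\<^sup>2 \<le> b" using xi[OF x] b by (simp add: mult_left_le)
      then have "1 - b \<le> \<bar>1 - b * (x $ i)\<^sup>2\<bar>" by linarith
      moreover have "\<bar>x $ i\<bar> \<le> 1" using xi[OF x] by (simp add: abs_square_le_1)
      ultimately show ?thesis
        using b c unfolding h_def abs_mult abs_divide
        by (intro frac_le) (auto simp: mult_left_le)
    qed
    from mult_right_mono[OF this inner_ge_zero[of "\<phi> x"]]
    show "norm (\<psi> x) \<le> c / (1 - b) * (norm (\<phi> x))\<^sup>2"
      by (simp add: \<psi>_def abs_mult power2_norm_eq_inner)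
  qed (use b c in simp)
  finally show ?thesis by simp
qed

end

section \<open>Linearity of gradients and traces\<close>

lemma partial_lincomb:
  assumes "\<And>x. \<phi> differentiable (at x)" "\<And>x. \<psi> differentiable (at x)"
  shows "partial i (\<lambda>x. \<phi> x + r *\<^sub>R \<psi> x) = (\<lambda>x. partial i \<phi> x + r *\<^sub>R partial i \<psi> x)"
proof
  fix x
  have "((\<lambda>x. \<phi> x + r *\<^sub>R \<psi> x) has_derivative
      (\<lambda>v. frechet_derivative \<phi> (at x) v + r *\<^sub>R frechet_derivative \<psi> (at x) v)) (at x)"
    using assms by (intro derivative_intros) (simp_all add: frechet_derivative_works[symmetric])
  then show "partial i (\<lambda>x. \<phi> x + r *\<^sub>R \<psi> x) x = partial i \<phi> x + r *\<^sub>R partial i \<psi> x"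
    by (simp add: partial_def frechet_derivative_at[symmetric])
qed

lemma C_k_lincomb: "C_k m \<phi> \<Longrightarrow> C_k m \<psi> \<Longrightarrow> C_k m (\<lambda>x. \<phi> x + r *\<^sub>R \<psi> x)"
proof (induction m arbitrary: \<phi> \<psi>)
  case 0
  then show ?case by (auto intro!: continuous_intros)
next
  case (Suc m)
  then have "\<And>x. \<phi> differentiable (at x)" "\<And>x. \<psi> differentiable (at x)" by simp_all
  then show ?case using Suc partial_lincomb[of \<phi> \<psi>] by auto
qed

lemma smooth_lincomb: "smooth \<phi> \<Longrightarrow> smooth \<psi> \<Longrightarrow> smooth (\<lambda>x. \<phi> x + r *\<^sub>R \<psi> x)"
  by (simp add: smooth_def C_k_lincomb)

lemma grad_lincomb:
  "smooth \<phi> \<Longrightarrow> smooth \<psi> \<Longrightarrow> grad (\<lambda>x. \<phi> x + r *\<^sub>R \<psi> x) x = grad \<phi> x + r *\<^sub>R grad \<psi> x"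
  by (simp add: grad_def vec_eq_iff partial_lincomb smooth_differentiable)

lemma partial_const: "partial i (\<lambda>x. c) = (\<lambda>x. 0)"
  by (simp add: partial_def frechet_derivative_const fun_eq_iff)

lemma smooth_const: "smooth (\<lambda>x::real^'d. c)"
proof -
  have "C_k m (\<lambda>x::real^'d. c)" for m c by (induction m arbitrary: c) (simp_all add: partial_const)
  then show ?thesis by (simp add: smooth_def)
qed

lemma L2_space_lincomb:
  fixes u v :: "'x \<Rightarrow> 'b::{real_normed_vector, second_countable_topology}"
  shows "u \<in> L2_space M \<Longrightarrow> v \<in> L2_space M \<Longrightarrow> (\<lambda>x. u x + r *\<^sub>R v x) \<in> L2_space M"
  by (intro L2_space_add L2_space_scaleR)

lemma L2L2_lincomb:
  fixes u v :: "'w \<Rightarrow> 'x \<Rightarrow> 'b::{real_normed_vector, second_countable_topology}"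
  shows "u \<in> L2L2 P M \<Longrightarrow> v \<in> L2L2 P M \<Longrightarrow> (\<lambda>\<omega> x. u \<omega> x + r *\<^sub>R v \<omega> x) \<in> L2L2 P M"
  by (intro L2L2_add L2L2_scaleR)

lemma L2_tendsto_lincomb:
  fixes a b :: "'x \<Rightarrow> 'b::{real_normed_vector, second_countable_topology}"
  assumes "a \<in> L2_space M" "b \<in> L2_space M" "\<And>n. s n \<in> L2_space M" "\<And>n. t n \<in> L2_space M"
    and lim: "(\<lambda>n. L2_norm M (\<lambda>x. s n x - a x)) \<longlonglongrightarrow> 0" "(\<lambda>n. L2_norm M (\<lambda>x. t n x - b x)) \<longlonglongrightarrow> 0"
  shows "(\<lambda>n::nat. L2_norm M (\<lambda>x. (s n x + r *\<^sub>R t n x) - (a x + r *\<^sub>R b x))) \<longlonglongrightarrow> 0"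
proof (rule Lim_null_comparison)
  have "(\<lambda>n. L2_norm M (\<lambda>x. s n x - a x) + \<bar>r\<bar> * L2_norm M (\<lambda>x. t n x - b x)) \<longlonglongrightarrow> 0 + \<bar>r\<bar> * 0"
    by (intro tendsto_intros lim)
  then show "(\<lambda>n. L2_norm M (\<lambda>x. s n x - a x) + \<bar>r\<bar> * L2_norm M (\<lambda>x. t n x - b x)) \<longlonglongrightarrow> 0" by simp
  show "\<forall>\<^sub>F n in sequentially. norm (L2_norm M (\<lambda>x. (s n x + r *\<^sub>R t n x) - (a x + r *\<^sub>R b x)))
      \<le> L2_norm M (\<lambda>x. s n x - a x) + \<bar>r\<bar> * L2_norm M (\<lambda>x. t n x - b x)"
  proof (rule always_eventually, rule allI)
    fix n
    have eq: "(\<lambda>x. (s n x + r *\<^sub>R t n x) - (a x + r *\<^sub>R b x)) = (\<lambda>x. (s n x - a x) + r *\<^sub>R (t n x - b x))"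
      by (simp add: fun_eq_iff algebra_simps)
    have "L2_norm M (\<lambda>x. (s n x - a x) + r *\<^sub>R (t n x - b x))
        \<le> L2_norm M (\<lambda>x. s n x - a x) + L2_norm M (\<lambda>x. r *\<^sub>R (t n x - b x))"
      using assms(1-4) by (intro L2_norm_triangle L2_space_scaleR L2_space_diff)
    then show "norm (L2_norm M (\<lambda>x. (s n x + r *\<^sub>R t n x) - (a x + r *\<^sub>R b x)))
      \<le> L2_norm M (\<lambda>x. s n x - a x) + \<bar>r\<bar> * L2_norm M (\<lambda>x. t n x - b x)"
      unfolding eq by (simp add: L2_norm_scaleR)
  qed
qed

lemma Hj_norm_0: "Hj_norm 0 D w p = L2_norm (lebesgue_on D) w"
  by (simp add: Hj_norm_def)

lemma Hj_norm_1_sq: "(Hj_norm 1 D w p)\<^sup>2 = (L2_norm (lebesgue_on D) w)\<^sup>2 + (L2_norm (lebesgue_on D) p)\<^sup>2"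
  by (simp add: Hj_norm_def)

lemma Hj_norm_1_tendsto:
  "(\<lambda>n. Hj_norm 1 D (w n) (p n)) \<longlonglongrightarrow> 0 \<longleftrightarrow>
   (\<lambda>n. L2_norm (lebesgue_on D) (w n)) \<longlonglongrightarrow> 0 \<and> (\<lambda>n. L2_norm (lebesgue_on D) (p n)) \<longlonglongrightarrow> 0" (is "?l \<longleftrightarrow> ?r")
proof
  assume ?l
  moreover have "norm (L2_norm (lebesgue_on D) (w n)) \<le> Hj_norm 1 D (w n) (p n)"
      "norm (L2_norm (lebesgue_on D) (p n)) \<le> Hj_norm 1 D (w n) (p n)" for n
    unfolding Hj_norm_def by (auto intro!: real_le_rsqrt)
  ultimately show ?r
    by (auto intro: Lim_null_comparison[of _ "\<lambda>n. Hj_norm 1 D (w n) (p n)"])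
next
  assume ?r
  then have "(\<lambda>n. sqrt ((L2_norm (lebesgue_on D) (w n))\<^sup>2 + (L2_norm (lebesgue_on D) (p n))\<^sup>2)) \<longlonglongrightarrow> sqrt (0\<^sup>2 + 0\<^sup>2)"
    by (intro tendsto_intros) auto
  then show ?l by (simp add: Hj_norm_def)
qed

lemma L2_space_times_integrable:
  assumes "u \<in> L2_space M" "v \<in> L2_space M"
  shows "integrable M (\<lambda>x. u x * v x :: complex)"
proof -
  have "(\<lambda>x. cnj (v x)) \<in> L2_space M"
    using L2_bounded_linear(1)[OF bounded_linear_cnj, of 1 v M] assms(2) by simp
  from L2_inner_integrable[OF assms(1) this] show ?thesis by simp
qed

text \<open>Gradients are handled component by component, so that the scalar facts on
  \<open>L2_inner\<close> apply to them.\<close>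

lemma L2_inner_vec_eq:
  assumes "p \<in> L2_space M" "q \<in> L2_space M"
  shows "L2_inner_vec M p q = (\<Sum>i\<in>UNIV. L2_inner M (\<lambda>x. p x $ i) (\<lambda>x. q x $ i))"
  unfolding L2_inner_vec_def L2_inner_def
  by (rule Bochner_Integration.integral_sum)
    (intro L2_inner_integrable L2_bounded_linear(1)[OF bounded_linear_vec_nth, where K = 1] assms,
     simp_all add: Finite_Cartesian_Product.norm_nth_le)

lemma L2_inner_vec_lincomb:
  assumes "p \<in> L2_space M" "p' \<in> L2_space M" "q \<in> L2_space M"
  shows "L2_inner_vec M (\<lambda>x. p x + r *\<^sub>R p' x) q = L2_inner_vec M p q + of_real r * L2_inner_vec M p' q"
proof -
  have nth: "(\<lambda>x. w x $ i) \<in> L2_space M" if "w \<in> L2_space M" for w :: "'a \<Rightarrow> complex^'b" and i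
    using that by (intro L2_bounded_linear(1)[OF bounded_linear_vec_nth, where K = 1])
      (simp_all add: Finite_Cartesian_Product.norm_nth_le)
  have "L2_inner M (\<lambda>x. (p x + r *\<^sub>R p' x) $ i) (\<lambda>x. q x $ i)
      = L2_inner M (\<lambda>x. p x $ i) (\<lambda>x. q x $ i) + of_real r * L2_inner M (\<lambda>x. p' x $ i) (\<lambda>x. q x $ i)" for i
    using L2_inner_add_left[OF nth[OF assms(1)] L2_space_scaleR[OF nth[OF assms(2)]] nth[OF assms(3)], of i r i i]
      L2_inner_mult_left[of M "of_real r"]
    by (simp add: scaleR_conv_of_real[where 'a = complex])
  then show ?thesis
    by (simp add: L2_inner_vec_eq assms L2_space_lincomb sum.distrib sum_distrib_left)
qed

lemma L2_inner_lincomb: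
  assumes "u \<in> L2_space M" "u' \<in> L2_space M" "v \<in> L2_space M"
  shows "L2_inner M (\<lambda>x. u x + r *\<^sub>R u' x) v = L2_inner M u v + of_real r * L2_inner M u' v"
  using L2_inner_add_left[OF assms(1) L2_space_scaleR[OF assms(2)] assms(3), of r]
    L2_inner_mult_left[of M "of_real r"]
  by (simp add: scaleR_conv_of_real)

lemma L2_inner_vec_integrable_P:
  fixes p q :: "'w \<Rightarrow> 'x \<Rightarrow> complex^'d"
  assumes p: "p \<in> L2L2 P M" and q: "q \<in> L2L2 P M"
  shows "integrable P (\<lambda>\<omega>. L2_inner_vec M (p \<omega>) (q \<omega>))"
proof -
  have "integrable P (\<lambda>\<omega>. \<Sum>i\<in>UNIV. L2_inner M (\<lambda>x. p \<omega> x $ i) (\<lambda>x. q \<omega> x $ i))"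
    by (intro Bochner_Integration.integrable_sum L2_inner_integrable_P L2L2_nth p q)
  moreover have "L2_inner_vec M (p \<omega>) (q \<omega>) = (\<Sum>i\<in>UNIV. L2_inner M (\<lambda>x. p \<omega> x $ i) (\<lambda>x. q \<omega> x $ i))"
    if "\<omega> \<in> space P" for \<omega>
    by (rule L2_inner_vec_eq[OF bochner_L2_in[OF p that] bochner_L2_in[OF q that]])
  ultimately show ?thesis by (simp cong: Bochner_Integration.integrable_cong)
qed

locale helmholtz_domain = polygonal_domain D for D :: "(real^'d) set" +
  assumes dim: "CARD('d) \<in> {1, 2, 3}" and unit: "D \<subseteq> ball 0 1"
begin

abbreviation "\<mu> \<equiv> lebesgue_on D"
abbreviation "S \<equiv> surface_measure D"

lemma continuous_L2_D:
  fixes f :: "real^'d \<Rightarrow> 'b::euclidean_space"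
  assumes "continuous_on UNIV f"
  shows "f \<in> L2_space \<mu>"
proof -
  have c: "continuous_on (closure D) f" using assms continuous_on_subset by blast
  have "integrable \<mu> (\<lambda>x. (norm (f x))\<^sup>2)"
    by (intro integrable_lebesgue_on_D continuous_intros c)
  then show ?thesis using integrable_lebesgue_on_D[OF c] by (simp add: L2_space_def)
qed

lemma continuous_L2_S:
  fixes f :: "real^'d \<Rightarrow> 'b::euclidean_space"
  assumes c: "continuous_on UNIV f"
  shows "f \<in> L2_space S"
proof -
  have m: "f \<in> borel_measurable borel" using c by (rule borel_measurable_continuous_onI)
  obtain B where B: "\<And>x. x \<in> closure D \<Longrightarrow> norm (f x) \<le> B"
    using compact_imp_bounded[OF compact_continuous_image[OF continuous_on_subset[OF c subset_UNIV] compact_closure_D]]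
    unfolding bounded_iff by blast
  have "integrable S (\<lambda>x. (norm (f x))\<^sup>2)"
  proof (rule integrable_surface[OF unit, where B = "B\<^sup>2"])
    show "norm ((norm (f x))\<^sup>2) \<le> B\<^sup>2" if "x \<in> frontier D" for x
      using B[of x] that by (simp add: frontier_D power_mono)
  qed (use m in measurable)
  then show ?thesis using measurable_surface[OF m] by (simp add: L2_space_def)
qed

lemma H1_lincomb:
  assumes "H1 D w p" "H1 D w' p'"
  shows "H1 D (\<lambda>x. w x + r *\<^sub>R w' x) (\<lambda>x. p x + r *\<^sub>R p' x)"
proof -
  have L2: "w \<in> L2_space \<mu>" "w' \<in> L2_space \<mu>" "p \<in> L2_space \<mu>" "p' \<in> L2_space \<mu>"
    using assms by (auto simp: H1_def)
  have nth: "(\<lambda>x. q x $ i) \<in> L2_space \<mu>" if "q \<in> L2_space \<mu>" for q :: "real^'d \<Rightarrow> complex^'d" and i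
    using that by (intro L2_bounded_linear(1)[OF bounded_linear_vec_nth, where K = 1])
      (simp_all add: Finite_Cartesian_Product.norm_nth_le)
  have "has_weak_gradient D (\<lambda>x. w x + r *\<^sub>R w' x) (\<lambda>x. p x + r *\<^sub>R p' x)"
    unfolding has_weak_gradient_def
  proof (intro allI impI)
    fix \<phi> i assume test: "test_function D \<phi>"
    then have "smooth \<phi>" by (simp add: test_function_def)
    then have \<phi>: "\<phi> \<in> L2_space \<mu>" "partial i \<phi> \<in> L2_space \<mu>"
      by (auto intro!: continuous_L2_D smooth_continuous smooth_partial)
    note int = L2_space_times_integrable[OF L2(1) \<phi>(2)] L2_space_times_integrable[OF L2(2) \<phi>(2)]
      L2_space_times_integrable[OF nth[OF L2(3)] \<phi>(1)] L2_space_times_integrable[OF nth[OF L2(4)] \<phi>(1)]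
    show "(LINT x|\<mu>. (w x + r *\<^sub>R w' x) * partial i \<phi> x) = - (LINT x|\<mu>. (p x + r *\<^sub>R p' x) $ i * \<phi> x)"
      using assms test int by (simp add: H1_def has_weak_gradient_def distrib_right)
  qed
  then show ?thesis using L2 by (simp add: H1_def L2_space_lincomb)
qed

lemma has_trace_lincomb:
  assumes "has_trace D w p \<tau>" "has_trace D w' p' \<tau>'"
  shows "has_trace D (\<lambda>x. w x + r *\<^sub>R w' x) (\<lambda>x. p x + r *\<^sub>R p' x) (\<lambda>x. \<tau> x + r *\<^sub>R \<tau>' x)"
proof -
  obtain \<phi> where \<phi>: "\<And>n. smooth (\<phi> n)"
      "(\<lambda>n. Hj_norm 1 D (\<lambda>x. \<phi> n x - w x) (\<lambda>x. grad (\<phi> n) x - p x)) \<longlonglongrightarrow> 0"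
      "(\<lambda>n. L2_norm S (\<lambda>x. \<phi> n x - \<tau> x)) \<longlonglongrightarrow> 0"
    using assms(1) unfolding has_trace_def by blast
  obtain \<psi> where \<psi>: "\<And>n. smooth (\<psi> n)"
      "(\<lambda>n. Hj_norm 1 D (\<lambda>x. \<psi> n x - w' x) (\<lambda>x. grad (\<psi> n) x - p' x)) \<longlonglongrightarrow> 0"
      "(\<lambda>n. L2_norm S (\<lambda>x. \<psi> n x - \<tau>' x)) \<longlonglongrightarrow> 0"
    using assms(2) unfolding has_trace_def by blast
  have L2: "w \<in> L2_space \<mu>" "w' \<in> L2_space \<mu>" "p \<in> L2_space \<mu>" "p' \<in> L2_space \<mu>"
     "\<tau> \<in> L2_space S" "\<tau>' \<in> L2_space S"
    using assms by (auto simp: has_trace_def H1_def)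
  have sm: "\<xi> \<in> L2_space \<mu>" "\<xi> \<in> L2_space S" "grad \<xi> \<in> L2_space \<mu>" if "smooth \<xi>" for \<xi>
    using that by (auto intro!: continuous_L2_D continuous_L2_S smooth_continuous continuous_grad)
  show ?thesis unfolding has_trace_def
  proof (intro conjI exI[of _ "\<lambda>n x. \<phi> n x + r *\<^sub>R \<psi> n x"] allI)
    show "H1 D (\<lambda>x. w x + r *\<^sub>R w' x) (\<lambda>x. p x + r *\<^sub>R p' x)"
      using assms by (intro H1_lincomb) (auto simp: has_trace_def)
    show "(\<lambda>x. \<tau> x + r *\<^sub>R \<tau>' x) \<in> L2_space S" by (intro L2_space_lincomb L2)
    show "smooth (\<lambda>x. \<phi> n x + r *\<^sub>R \<psi> n x)" for n by (intro smooth_lincomb \<phi> \<psi>)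
    show "(\<lambda>n. L2_norm S (\<lambda>x. \<phi> n x + r *\<^sub>R \<psi> n x - (\<tau> x + r *\<^sub>R \<tau>' x))) \<longlonglongrightarrow> 0"
      by (intro L2_tendsto_lincomb L2 \<phi> \<psi> sm)
    show "(\<lambda>n. Hj_norm 1 D (\<lambda>x. \<phi> n x + r *\<^sub>R \<psi> n x - (w x + r *\<^sub>R w' x))
        (\<lambda>x. grad (\<lambda>x. \<phi> n x + r *\<^sub>R \<psi> n x) x - (p x + r *\<^sub>R p' x))) \<longlonglongrightarrow> 0"
      unfolding Hj_norm_1_tendsto grad_lincomb[OF \<phi>(1) \<psi>(1)]
      using \<phi>(2) \<psi>(2) unfolding Hj_norm_1_tendsto
      by (intro conjI L2_tendsto_lincomb L2 \<phi> \<psi> sm) auto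
  qed
qed

text \<open>The convergence that defines \<open>has_trace\<close> controls all three norms involved,
  so the inequality for smooth functions passes to the limit.\<close>

lemma friedrichs:
  assumes tr: "has_trace D w p \<tau>" and b: "0 < b" "b < 1"
  shows "(3 * b - b\<^sup>2) * (L2_norm \<mu> w)\<^sup>2
    \<le> (3 * b - b\<^sup>2) / (1 - b) * (L2_norm S \<tau>)\<^sup>2 + (L2_norm \<mu> p)\<^sup>2"
proof -
  obtain \<phi> where \<phi>: "\<And>n. smooth (\<phi> n)"
      "(\<lambda>n. L2_norm \<mu> (\<lambda>x. \<phi> n x - w x)) \<longlonglongrightarrow> 0" "(\<lambda>n. L2_norm \<mu> (\<lambda>x. grad (\<phi> n) x - p x)) \<longlonglongrightarrow> 0"
      "(\<lambda>n. L2_norm S (\<lambda>x. \<phi> n x - \<tau> x)) \<longlonglongrightarrow> 0"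
    using tr unfolding has_trace_def Hj_norm_1_tendsto by blast
  have L2: "w \<in> L2_space \<mu>" "p \<in> L2_space \<mu>" "\<tau> \<in> L2_space S"
    using tr by (auto simp: has_trace_def H1_def)
  have sm: "\<phi> n \<in> L2_space \<mu>" "\<phi> n \<in> L2_space S" "grad (\<phi> n) \<in> L2_space \<mu>" for n
    using \<phi>(1) by (auto intro!: continuous_L2_D continuous_L2_S smooth_continuous continuous_grad)
  note lim = L2_norm_tendsto[OF L2(1) sm(1) \<phi>(2)] L2_norm_tendsto[OF L2(2) sm(3) \<phi>(3)]
    L2_norm_tendsto[OF L2(3) sm(2) \<phi>(4)]
  show ?thesis
  proof (rule LIMSEQ_le)
    show "(\<lambda>n. (3 * b - b\<^sup>2) * (L2_norm \<mu> (\<phi> n))\<^sup>2) \<longlonglongrightarrow> (3 * b - b\<^sup>2) * (L2_norm \<mu> w)\<^sup>2"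
      by (intro tendsto_intros lim)
    show "(\<lambda>n. (3 * b - b\<^sup>2) / (1 - b) * (L2_norm S (\<phi> n))\<^sup>2 + (L2_norm \<mu> (grad (\<phi> n)))\<^sup>2)
      \<longlonglongrightarrow> (3 * b - b\<^sup>2) / (1 - b) * (L2_norm S \<tau>)\<^sup>2 + (L2_norm \<mu> p)\<^sup>2"
      by (intro tendsto_intros lim)
    show "\<exists>N. \<forall>n\<ge>N. (3 * b - b\<^sup>2) * (L2_norm \<mu> (\<phi> n))\<^sup>2
      \<le> (3 * b - b\<^sup>2) / (1 - b) * (L2_norm S (\<phi> n))\<^sup>2 + (L2_norm \<mu> (grad (\<phi> n)))\<^sup>2"
      using friedrichs_smooth[OF dim unit \<phi>(1) b] unfolding L2_norm_sq by blast
  qed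
qed

text \<open>That a constant has weak gradient 0 means that test functions have derivatives of mean
  zero. This follows from the bound by the boundary integral, since a test function vanishes on the
  frontier.\<close>

lemma has_trace_const: "has_trace D (\<lambda>x. c) (\<lambda>x. 0) (\<lambda>x. c)"
  unfolding has_trace_def
proof (intro conjI exI[of _ "\<lambda>n x. c"] allI)
  have "has_weak_gradient D (\<lambda>x. c) (\<lambda>x. 0)"
    unfolding has_weak_gradient_def
  proof (intro allI impI)
    fix \<phi> and i :: 'd assume "test_function D \<phi>"
    then have sm: "smooth \<phi>" and supp: "closure {x. \<phi> x \<noteq> 0} \<subseteq> D" by (auto simp: test_function_def)
    have "norm (LINT x|\<mu>. frechet_derivative \<phi> (at x) (axis i 1)) \<le> (LINT x|S. norm (\<phi> x))"
    proof (rule norm_integral_derivative_le[OF dim unit, where r = 2])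
      show "continuous_on (ball 0 2) (\<lambda>x. frechet_derivative \<phi> (at x) (axis i 1))"
        using smooth_continuous[OF smooth_partial[OF sm, of i]]
        by (auto simp: partial_def[abs_def] intro: continuous_on_subset)
    qed (use sm in \<open>auto simp: smooth_has_derivative norm_axis_1\<close>)
    also have "(LINT x|S. norm (\<phi> x)) = (LINT x|S. 0)"
    proof (rule Bochner_Integration.integral_cong)
      fix x assume "x \<in> space S"
      then have "x \<notin> D" by (simp add: space_surface frontier_D)
      then show "norm (\<phi> x) = 0" using supp closure_subset[of "{x. \<phi> x \<noteq> 0}"] by auto
    qed simp
    finally have "(LINT x|\<mu>. partial i \<phi> x) = 0" by (simp add: partial_def)
    then show "(LINT x|\<mu>. c * partial i \<phi> x) = - (LINT x|\<mu>. (0::complex^'d) $ i * \<phi> x)" by simp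
  qed
  then show "H1 D (\<lambda>x. c) (\<lambda>x. 0)"
    unfolding H1_def by (auto intro!: continuous_L2_D)
  show "(\<lambda>x. c) \<in> L2_space S" by (rule continuous_L2_S) simp
qed (simp_all add: smooth_const Hj_norm_def grad_def partial_const L2_norm_def zero_vec_def[symmetric])

end

section \<open>Weak solutions\<close>

context helmholtz_domain
begin

text \<open>The form for \<alpha> = 1 only. The perturbed problem is brought to it by moving the
  terms with \<eta> into the data, see \<open>weak_solution_shift\<close>.\<close>

definition form :: "'w measure \<Rightarrow> real \<Rightarrow> ('w \<Rightarrow> real^'d \<Rightarrow> complex) \<Rightarrow> ('w \<Rightarrow> real^'d \<Rightarrow> complex^'d) \<Rightarrow>
    ('w \<Rightarrow> real^'d \<Rightarrow> complex) \<Rightarrow> ('w \<Rightarrow> real^'d \<Rightarrow> complex) \<Rightarrow> ('w \<Rightarrow> real^'d \<Rightarrow> complex^'d) \<Rightarrow>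
    ('w \<Rightarrow> real^'d \<Rightarrow> complex) \<Rightarrow> complex" where
  "form P k u Du \<tau> v Dv \<tau>v = (LINT \<omega>|P. L2_inner_vec \<mu> (Du \<omega>) (Dv \<omega>)
     - of_real (k\<^sup>2) * L2_inner \<mu> (u \<omega>) (v \<omega>) + \<i> * of_real k * L2_inner S (\<tau> \<omega>) (\<tau>v \<omega>))"

definition load :: "'w measure \<Rightarrow> ('w \<Rightarrow> real^'d \<Rightarrow> complex) \<Rightarrow> ('w \<Rightarrow> real^'d \<Rightarrow> complex) \<Rightarrow>
    ('w \<Rightarrow> real^'d \<Rightarrow> complex) \<Rightarrow> ('w \<Rightarrow> real^'d \<Rightarrow> complex) \<Rightarrow> complex" where
  "load P f g v \<tau>v = (LINT \<omega>|P. L2_inner \<mu> (f \<omega>) (v \<omega>) + L2_inner S (g \<omega>) (\<tau>v \<omega>))"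

lemma L2H1_D:
  assumes "L2H1 P D u Du \<tau>"
  shows "u \<in> L2L2 P \<mu>" "Du \<in> L2L2 P \<mu>" "\<tau> \<in> L2L2 P S" "AE \<omega> in P. has_trace D (u \<omega>) (Du \<omega>) (\<tau> \<omega>)"
  using assms by (simp_all add: L2H1_def)

lemma L2H1_lincomb:
  assumes "L2H1 P D u Du \<tau>" "L2H1 P D u' Du' \<tau>'"
  shows "L2H1 P D (\<lambda>\<omega> x. u \<omega> x + r *\<^sub>R u' \<omega> x) (\<lambda>\<omega> x. Du \<omega> x + r *\<^sub>R Du' \<omega> x) (\<lambda>\<omega> x. \<tau> \<omega> x + r *\<^sub>R \<tau>' \<omega> x)"
  unfolding L2H1_def
proof (intro conjI L2L2_lincomb)
  show "AE \<omega> in P. has_trace D (\<lambda>x. u \<omega> x + r *\<^sub>R u' \<omega> x) (\<lambda>x. Du \<omega> x + r *\<^sub>R Du' \<omega> x) (\<lambda>x. \<tau> \<omega> x + r *\<^sub>R \<tau>' \<omega> x)"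
    using L2H1_D(4)[OF assms(1)] L2H1_D(4)[OF assms(2)] by eventually_elim (rule has_trace_lincomb)
qed (use assms in \<open>simp_all add: L2H1_def\<close>)

lemma weak_solution_unit_index:
  "weak_solution P D k (\<lambda>\<omega> x. 1) f g u Du \<tau> \<longleftrightarrow>
    L2H1 P D u Du \<tau> \<and> (\<forall>v Dv \<tau>v. L2H1 P D v Dv \<tau>v \<longrightarrow> form P k u Du \<tau> v Dv \<tau>v = load P f g v \<tau>v)"
  by (simp add: weak_solution_def form_def load_def)

lemma form_integrable:
  assumes "L2H1 P D u Du \<tau>" "L2H1 P D v Dv \<tau>v"
  shows "integrable P (\<lambda>\<omega>. L2_inner_vec \<mu> (Du \<omega>) (Dv \<omega>)
     - of_real (k\<^sup>2) * L2_inner \<mu> (u \<omega>) (v \<omega>) + \<i> * of_real k * L2_inner S (\<tau> \<omega>) (\<tau>v \<omega>))"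
  using L2_inner_vec_integrable_P[OF L2H1_D(2)[OF assms(1)] L2H1_D(2)[OF assms(2)]]
    L2_inner_integrable_P[OF L2H1_D(1)[OF assms(1)] L2H1_D(1)[OF assms(2)]]
    L2_inner_integrable_P[OF L2H1_D(3)[OF assms(1)] L2H1_D(3)[OF assms(2)]]
  by (intro Bochner_Integration.integrable_add Bochner_Integration.integrable_diff integrable_mult_right) auto

lemma load_integrable:
  assumes "f \<in> L2L2 P \<mu>" "g \<in> L2L2 P S" "v \<in> L2L2 P \<mu>" "\<tau>v \<in> L2L2 P S"
  shows "integrable P (\<lambda>\<omega>. L2_inner \<mu> (f \<omega>) (v \<omega>) + L2_inner S (g \<omega>) (\<tau>v \<omega>))"
  by (intro Bochner_Integration.integrable_add L2_inner_integrable_P assms)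

lemma load_lincomb:
  assumes f: "f \<in> L2L2 P \<mu>" "f' \<in> L2L2 P \<mu>" and g: "g \<in> L2L2 P S" "g' \<in> L2L2 P S"
    and v: "v \<in> L2L2 P \<mu>" "\<tau>v \<in> L2L2 P S"
  shows "load P (\<lambda>\<omega> x. f \<omega> x + r *\<^sub>R f' \<omega> x) (\<lambda>\<omega> x. g \<omega> x + r *\<^sub>R g' \<omega> x) v \<tau>v
    = load P f g v \<tau>v + of_real r * load P f' g' v \<tau>v"
proof -
  have "load P (\<lambda>\<omega> x. f \<omega> x + r *\<^sub>R f' \<omega> x) (\<lambda>\<omega> x. g \<omega> x + r *\<^sub>R g' \<omega> x) v \<tau>v
    = (LINT \<omega>|P. (L2_inner \<mu> (f \<omega>) (v \<omega>) + L2_inner S (g \<omega>) (\<tau>v \<omega>))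
        + of_real r * (L2_inner \<mu> (f' \<omega>) (v \<omega>) + L2_inner S (g' \<omega>) (\<tau>v \<omega>)))"
    unfolding load_def
  proof (rule Bochner_Integration.integral_cong)
    fix \<omega> assume "\<omega> \<in> space P"
    note m = bochner_L2_in[OF f(1) this] bochner_L2_in[OF f(2) this] bochner_L2_in[OF g(1) this]
      bochner_L2_in[OF g(2) this] bochner_L2_in[OF v(1) this] bochner_L2_in[OF v(2) this]
    show "L2_inner \<mu> (\<lambda>x. f \<omega> x + r *\<^sub>R f' \<omega> x) (v \<omega>) + L2_inner S (\<lambda>x. g \<omega> x + r *\<^sub>R g' \<omega> x) (\<tau>v \<omega>)
      = (L2_inner \<mu> (f \<omega>) (v \<omega>) + L2_inner S (g \<omega>) (\<tau>v \<omega>))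
        + of_real r * (L2_inner \<mu> (f' \<omega>) (v \<omega>) + L2_inner S (g' \<omega>) (\<tau>v \<omega>))"
      unfolding L2_inner_lincomb[OF m(1,2,5)] L2_inner_lincomb[OF m(3,4,6)] by (simp add: algebra_simps)
  qed simp
  also have "\<dots> = load P f g v \<tau>v + of_real r * load P f' g' v \<tau>v"
    using load_integrable[OF f(1) g(1) v] load_integrable[OF f(2) g(2) v] unfolding load_def by simp
  finally show ?thesis .
qed

lemma form_lincomb:
  assumes u: "L2H1 P D u Du \<tau>" and u': "L2H1 P D u' Du' \<tau>'" and v: "L2H1 P D v Dv \<tau>v"
  shows "form P k (\<lambda>\<omega> x. u \<omega> x + r *\<^sub>R u' \<omega> x) (\<lambda>\<omega> x. Du \<omega> x + r *\<^sub>R Du' \<omega> x) (\<lambda>\<omega> x. \<tau> \<omega> x + r *\<^sub>R \<tau>' \<omega> x) v Dv \<tau>v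
    = form P k u Du \<tau> v Dv \<tau>v + of_real r * form P k u' Du' \<tau>' v Dv \<tau>v"
proof -
  let ?I = "\<lambda>u Du \<tau> \<omega>. L2_inner_vec \<mu> (Du \<omega>) (Dv \<omega>)
     - of_real (k\<^sup>2) * L2_inner \<mu> (u \<omega>) (v \<omega>) + \<i> * of_real k * L2_inner S (\<tau> \<omega>) (\<tau>v \<omega>)"
  have "form P k (\<lambda>\<omega> x. u \<omega> x + r *\<^sub>R u' \<omega> x) (\<lambda>\<omega> x. Du \<omega> x + r *\<^sub>R Du' \<omega> x) (\<lambda>\<omega> x. \<tau> \<omega> x + r *\<^sub>R \<tau>' \<omega> x) v Dv \<tau>v
    = (LINT \<omega>|P. ?I u Du \<tau> \<omega> + of_real r * ?I u' Du' \<tau>' \<omega>)"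
    unfolding form_def
  proof (rule Bochner_Integration.integral_cong)
    fix \<omega> assume \<omega>: "\<omega> \<in> space P"
    note m = L2H1_D(1-3)[OF u, THEN bochner_L2_in, OF \<omega>] L2H1_D(1-3)[OF u', THEN bochner_L2_in, OF \<omega>]
      L2H1_D(1-3)[OF v, THEN bochner_L2_in, OF \<omega>]
    show "?I (\<lambda>\<omega> x. u \<omega> x + r *\<^sub>R u' \<omega> x) (\<lambda>\<omega> x. Du \<omega> x + r *\<^sub>R Du' \<omega> x) (\<lambda>\<omega> x. \<tau> \<omega> x + r *\<^sub>R \<tau>' \<omega> x) \<omega>
      = ?I u Du \<tau> \<omega> + of_real r * ?I u' Du' \<tau>' \<omega>"
      unfolding L2_inner_lincomb[OF m(1,4,7)] L2_inner_lincomb[OF m(3,6,9)] L2_inner_vec_lincomb[OF m(2,5,8)]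
      by (simp add: algebra_simps)
  qed simp
  also have "\<dots> = form P k u Du \<tau> v Dv \<tau>v + of_real r * form P k u' Du' \<tau>' v Dv \<tau>v"
    using form_integrable[OF u v, of k] form_integrable[OF u' v, of k] unfolding form_def by simp
  finally show ?thesis .
qed

lemma weak_solution_lincomb:
  assumes f: "f \<in> L2L2 P \<mu>" "f' \<in> L2L2 P \<mu>" and g: "g \<in> L2L2 P S" "g' \<in> L2L2 P S"
    and u: "weak_solution P D k (\<lambda>\<omega> x. 1) f g u Du \<tau>" and u': "weak_solution P D k (\<lambda>\<omega> x. 1) f' g' u' Du' \<tau>'"
  shows "weak_solution P D k (\<lambda>\<omega> x. 1) (\<lambda>\<omega> x. f \<omega> x + r *\<^sub>R f' \<omega> x) (\<lambda>\<omega> x. g \<omega> x + r *\<^sub>R g' \<omega> x)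
    (\<lambda>\<omega> x. u \<omega> x + r *\<^sub>R u' \<omega> x) (\<lambda>\<omega> x. Du \<omega> x + r *\<^sub>R Du' \<omega> x) (\<lambda>\<omega> x. \<tau> \<omega> x + r *\<^sub>R \<tau>' \<omega> x)"
  unfolding weak_solution_unit_index
proof (intro conjI allI impI)
  have L2H1: "L2H1 P D u Du \<tau>" "L2H1 P D u' Du' \<tau>'"
    using u u' by (simp_all add: weak_solution_unit_index)
  then show "L2H1 P D (\<lambda>\<omega> x. u \<omega> x + r *\<^sub>R u' \<omega> x) (\<lambda>\<omega> x. Du \<omega> x + r *\<^sub>R Du' \<omega> x) (\<lambda>\<omega> x. \<tau> \<omega> x + r *\<^sub>R \<tau>' \<omega> x)"
    by (rule L2H1_lincomb)
  fix v Dv \<tau>v assume v: "L2H1 P D v Dv \<tau>v"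
  have "form P k u Du \<tau> v Dv \<tau>v = load P f g v \<tau>v" "form P k u' Du' \<tau>' v Dv \<tau>v = load P f' g' v \<tau>v"
    using u u' v unfolding weak_solution_unit_index by blast+
  then show "form P k (\<lambda>\<omega> x. u \<omega> x + r *\<^sub>R u' \<omega> x) (\<lambda>\<omega> x. Du \<omega> x + r *\<^sub>R Du' \<omega> x) (\<lambda>\<omega> x. \<tau> \<omega> x + r *\<^sub>R \<tau>' \<omega> x) v Dv \<tau>v
    = load P (\<lambda>\<omega> x. f \<omega> x + r *\<^sub>R f' \<omega> x) (\<lambda>\<omega> x. g \<omega> x + r *\<^sub>R g' \<omega> x) v \<tau>v"
    using form_lincomb[OF L2H1 v] load_lincomb[OF f g L2H1_D(1,3)[OF v]] by simp
qed

lemma perturbation_in: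
  fixes u :: "'w \<Rightarrow> real^'d \<Rightarrow> complex"
  assumes \<eta>: "\<eta> \<in> L2Linf P \<mu>" "AE \<omega> in P. Linf_norm \<mu> (\<eta> \<omega>) \<le> 1" and u: "u \<in> L2L2 P \<mu>"
  shows "(\<lambda>\<omega> x. of_real (k\<^sup>2 * (2 * \<epsilon> * \<eta> \<omega> x + \<epsilon>\<^sup>2 * (\<eta> \<omega> x)\<^sup>2)) * u \<omega> x) \<in> L2L2 P \<mu>"
proof -
  have eq: "(\<lambda>\<omega> x. of_real (k\<^sup>2 * (2 * \<epsilon> * \<eta> \<omega> x + \<epsilon>\<^sup>2 * (\<eta> \<omega> x)\<^sup>2)) * u \<omega> x)
      = (\<lambda>\<omega> x. of_real (2 * k\<^sup>2 * \<epsilon>) * (of_real (\<eta> \<omega> x) * u \<omega> x)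
        + of_real (k\<^sup>2 * \<epsilon>\<^sup>2) * (of_real (\<eta> \<omega> x) * (of_real (\<eta> \<omega> x) * u \<omega> x)))"
    by (simp add: fun_eq_iff algebra_simps power2_eq_square)
  show ?thesis unfolding eq
    by (intro L2L2_add L2L2_cmult L2L2_mult[OF \<eta>] u)
qed

lemma boundary_perturbation_in:
  assumes \<eta>: "\<eta> \<in> L2Linf P S" "AE \<omega> in P. Linf_norm S (\<eta> \<omega>) \<le> 1" and \<tau>: "\<tau> \<in> L2L2 P S"
  shows "(\<lambda>\<omega> x. - \<i> * of_real (k * \<epsilon> * \<eta> \<omega> x) * \<tau> \<omega> x) \<in> L2L2 P S"
proof -
  have eq: "(\<lambda>\<omega> x. - \<i> * of_real (k * \<epsilon> * \<eta> \<omega> x) * \<tau> \<omega> x)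
      = (\<lambda>\<omega> x. (- \<i> * of_real (k * \<epsilon>)) * (of_real (\<eta> \<omega> x) * \<tau> \<omega> x))"
    by (simp add: fun_eq_iff algebra_simps)
  show ?thesis unfolding eq
    by (intro L2L2_cmult L2L2_mult[OF \<eta>] \<tau>)
qed

text \<open>Expanding (1 + \<epsilon> \<eta>)^2 and moving everything beyond the leading 1 to the
  right gives data that depend on the solution itself. In this form perturbed and unperturbed
  solutions obey the same equation and can be subtracted; read backwards, it restores the perturbed
  problem for the residual.\<close>

lemma weak_solution_shift:
  assumes \<eta>D: "\<eta> \<in> L2Linf P \<mu>" "AE \<omega> in P. Linf_norm \<mu> (\<eta> \<omega>) \<le> 1"
    and \<eta>S: "\<eta> \<in> L2Linf P S" "AE \<omega> in P. Linf_norm S (\<eta> \<omega>) \<le> 1"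
    and f: "f \<in> L2L2 P \<mu>" and g: "g \<in> L2L2 P S"
  shows "weak_solution P D k (\<lambda>\<omega> x. 1 + \<epsilon> * \<eta> \<omega> x) f g u Du \<tau> \<longleftrightarrow>
    weak_solution P D k (\<lambda>\<omega> x. 1)
      (\<lambda>\<omega> x. f \<omega> x + of_real (k\<^sup>2 * (2 * \<epsilon> * \<eta> \<omega> x + \<epsilon>\<^sup>2 * (\<eta> \<omega> x)\<^sup>2)) * u \<omega> x)
      (\<lambda>\<omega> x. g \<omega> x - \<i> * of_real (k * \<epsilon> * \<eta> \<omega> x) * \<tau> \<omega> x) u Du \<tau>"
proof (cases "L2H1 P D u Du \<tau>")
  case True
  note L2 = L2H1_D(1-3)[OF True]
  define F where "F \<omega> x = of_real (k\<^sup>2 * (2 * \<epsilon> * \<eta> \<omega> x + \<epsilon>\<^sup>2 * (\<eta> \<omega> x)\<^sup>2)) * u \<omega> x" for \<omega> x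
  define G where "G \<omega> x = - \<i> * of_real (k * \<epsilon> * \<eta> \<omega> x) * \<tau> \<omega> x" for \<omega> x
  have F: "F \<in> L2L2 P \<mu>" unfolding F_def[abs_def] by (rule perturbation_in[OF \<eta>D L2(1)])
  have G: "G \<in> L2L2 P S" unfolding G_def[abs_def] by (rule boundary_perturbation_in[OF \<eta>S L2(3)])
  have eq: "(LINT \<omega>|P. L2_inner_vec \<mu> (Du \<omega>) (Dv \<omega>)
       - of_real (k\<^sup>2) * L2_inner \<mu> (\<lambda>x. of_real ((1 + \<epsilon> * \<eta> \<omega> x)\<^sup>2) * u \<omega> x) (v \<omega>)
       + \<i> * of_real k * L2_inner S (\<lambda>x. of_real (1 + \<epsilon> * \<eta> \<omega> x) * \<tau> \<omega> x) (\<tau>v \<omega>))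
     = form P k u Du \<tau> v Dv \<tau>v - load P F G v \<tau>v"
    and eq': "load P (\<lambda>\<omega> x. f \<omega> x + F \<omega> x) (\<lambda>\<omega> x. g \<omega> x + G \<omega> x) v \<tau>v = load P f g v \<tau>v + load P F G v \<tau>v"
    if v: "L2H1 P D v Dv \<tau>v" for v Dv \<tau>v
  proof -
    note vL2 = L2H1_D(1,3)[OF v]
    show "load P (\<lambda>\<omega> x. f \<omega> x + F \<omega> x) (\<lambda>\<omega> x. g \<omega> x + G \<omega> x) v \<tau>v = load P f g v \<tau>v + load P F G v \<tau>v"
      using load_lincomb[OF f F g G vL2, of 1] by simp
    have "(LINT \<omega>|P. L2_inner_vec \<mu> (Du \<omega>) (Dv \<omega>)
       - of_real (k\<^sup>2) * L2_inner \<mu> (\<lambda>x. of_real ((1 + \<epsilon> * \<eta> \<omega> x)\<^sup>2) * u \<omega> x) (v \<omega>)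
       + \<i> * of_real k * L2_inner S (\<lambda>x. of_real (1 + \<epsilon> * \<eta> \<omega> x) * \<tau> \<omega> x) (\<tau>v \<omega>))
     = (LINT \<omega>|P. (L2_inner_vec \<mu> (Du \<omega>) (Dv \<omega>)
     - of_real (k\<^sup>2) * L2_inner \<mu> (u \<omega>) (v \<omega>) + \<i> * of_real k * L2_inner S (\<tau> \<omega>) (\<tau>v \<omega>))
      - (L2_inner \<mu> (F \<omega>) (v \<omega>) + L2_inner S (G \<omega>) (\<tau>v \<omega>)))"
    proof (rule Bochner_Integration.integral_cong)
      fix \<omega> assume \<omega>: "\<omega> \<in> space P"
      note m = L2[THEN bochner_L2_in, OF \<omega>] vL2[THEN bochner_L2_in, OF \<omega>]
        bochner_L2_in[OF F \<omega>] bochner_L2_in[OF G \<omega>]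
      have cu: "(\<lambda>x. of_real (k\<^sup>2) * u \<omega> x) \<in> L2_space \<mu>"
        using L2_space_scaleR[OF m(1), of "k\<^sup>2"] by (simp add: scaleR_conv_of_real)
      have c\<tau>: "(\<lambda>x. - (\<i> * of_real k) * \<tau> \<omega> x) \<in> L2_space S"
        using bochner_L2_in[OF L2L2_cmult[OF L2(3)] \<omega>, of "- (\<i> * of_real k)"] .
      have eq1: "(\<lambda>x. of_real (k\<^sup>2) * (of_real ((1 + \<epsilon> * \<eta> \<omega> x)\<^sup>2) * u \<omega> x)) = (\<lambda>x. of_real (k\<^sup>2) * u \<omega> x + F \<omega> x)"
        by (simp add: F_def fun_eq_iff algebra_simps power2_eq_square)
      have 1: "of_real (k\<^sup>2) * L2_inner \<mu> (\<lambda>x. of_real ((1 + \<epsilon> * \<eta> \<omega> x)\<^sup>2) * u \<omega> x) (v \<omega>)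
          = of_real (k\<^sup>2) * L2_inner \<mu> (u \<omega>) (v \<omega>) + L2_inner \<mu> (F \<omega>) (v \<omega>)"
        unfolding L2_inner_mult_left[symmetric] eq1
        unfolding L2_inner_add_left[OF cu m(6) m(4)] ..
      have eq2: "(\<lambda>x. - (\<i> * of_real k) * (of_real (1 + \<epsilon> * \<eta> \<omega> x) * \<tau> \<omega> x)) = (\<lambda>x. - (\<i> * of_real k) * \<tau> \<omega> x + G \<omega> x)"
        by (simp add: G_def fun_eq_iff algebra_simps)
      have 2: "- (\<i> * of_real k) * L2_inner S (\<lambda>x. of_real (1 + \<epsilon> * \<eta> \<omega> x) * \<tau> \<omega> x) (\<tau>v \<omega>)
          = - (\<i> * of_real k) * L2_inner S (\<tau> \<omega>) (\<tau>v \<omega>) + L2_inner S (G \<omega>) (\<tau>v \<omega>)"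
        unfolding L2_inner_mult_left[symmetric] eq2
        unfolding L2_inner_add_left[OF c\<tau> m(7) m(5)] ..
      have alg: "A - B + C = (A - B' + C') - (X + Y)" if "B = B' + X" "- C = - C' + Y" for A B C B' C' X Y :: complex
        using that by algebra
      show "L2_inner_vec \<mu> (Du \<omega>) (Dv \<omega>)
         - of_real (k\<^sup>2) * L2_inner \<mu> (\<lambda>x. of_real ((1 + \<epsilon> * \<eta> \<omega> x)\<^sup>2) * u \<omega> x) (v \<omega>)
         + \<i> * of_real k * L2_inner S (\<lambda>x. of_real (1 + \<epsilon> * \<eta> \<omega> x) * \<tau> \<omega> x) (\<tau>v \<omega>)
       = (L2_inner_vec \<mu> (Du \<omega>) (Dv \<omega>)
       - of_real (k\<^sup>2) * L2_inner \<mu> (u \<omega>) (v \<omega>) + \<i> * of_real k * L2_inner S (\<tau> \<omega>) (\<tau>v \<omega>))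
        - (L2_inner \<mu> (F \<omega>) (v \<omega>) + L2_inner S (G \<omega>) (\<tau>v \<omega>))"
        by (rule alg[OF 1]) (use 2 in simp)
    qed simp
    also have "\<dots> = form P k u Du \<tau> v Dv \<tau>v - load P F G v \<tau>v"
      unfolding form_def load_def
      by (rule Bochner_Integration.integral_diff[OF form_integrable[OF True v] load_integrable[OF F G vL2]])
    finally show "(LINT \<omega>|P. L2_inner_vec \<mu> (Du \<omega>) (Dv \<omega>)
       - of_real (k\<^sup>2) * L2_inner \<mu> (\<lambda>x. of_real ((1 + \<epsilon> * \<eta> \<omega> x)\<^sup>2) * u \<omega> x) (v \<omega>)
       + \<i> * of_real k * L2_inner S (\<lambda>x. of_real (1 + \<epsilon> * \<eta> \<omega> x) * \<tau> \<omega> x) (\<tau>v \<omega>))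
     = form P k u Du \<tau> v Dv \<tau>v - load P F G v \<tau>v" .
  qed
  have data: "(\<lambda>\<omega> x. f \<omega> x + of_real (k\<^sup>2 * (2 * \<epsilon> * \<eta> \<omega> x + \<epsilon>\<^sup>2 * (\<eta> \<omega> x)\<^sup>2)) * u \<omega> x) = (\<lambda>\<omega> x. f \<omega> x + F \<omega> x)"
    "(\<lambda>\<omega> x. g \<omega> x - \<i> * of_real (k * \<epsilon> * \<eta> \<omega> x) * \<tau> \<omega> x) = (\<lambda>\<omega> x. g \<omega> x + G \<omega> x)"
    by (simp_all add: F_def G_def)
  have iff: "(form P k u Du \<tau> v Dv \<tau>v - load P F G v \<tau>v = load P f g v \<tau>v)
      \<longleftrightarrow> form P k u Du \<tau> v Dv \<tau>v = load P f g v \<tau>v + load P F G v \<tau>v" for v Dv \<tau>v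
    by (rule diff_eq_eq)
  show ?thesis
    unfolding weak_solution_unit_index data unfolding weak_solution_def load_def[of P f g, symmetric]
    using True eq eq' iff by (simp add: load_def[symmetric])
qed (simp add: weak_solution_def)

text \<open>The solution used to bound C0 from below: with zero gradient, its data are just the
  coefficients of the equation.\<close>

lemma weak_solution_const:
  assumes "finite_measure P"
  shows "weak_solution P D k (\<lambda>\<omega> x. 1) (\<lambda>\<omega> x. - of_real (k\<^sup>2)) (\<lambda>\<omega> x. \<i> * of_real k) (\<lambda>\<omega> x. 1) (\<lambda>\<omega> x. 0) (\<lambda>\<omega> x. 1)"
  unfolding weak_solution_unit_index
proof (intro conjI allI impI)
  show "L2H1 P D (\<lambda>\<omega> x. 1) (\<lambda>\<omega> x. 0) (\<lambda>\<omega> x. 1)"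
    unfolding L2H1_def using has_trace_const[of 1]
    by (auto intro!: L2L2_const assms continuous_L2_D continuous_L2_S)
  fix v Dv \<tau>v
  show "form P k (\<lambda>\<omega> x. 1) (\<lambda>\<omega> x. 0) (\<lambda>\<omega> x. 1) v Dv \<tau>v
      = load P (\<lambda>\<omega> x. - of_real (k\<^sup>2)) (\<lambda>\<omega> x. \<i> * of_real k) v \<tau>v"
    unfolding form_def load_def
    using L2_inner_mult_left[of \<mu> "- of_real (k\<^sup>2)" "\<lambda>x. 1"] L2_inner_mult_left[of S "\<i> * of_real k" "\<lambda>x. 1"]
    by (simp add: L2_inner_vec_def)
qed

end

section \<open>The numerical inequality for the first mode\<close>

text \<open>The quotient is largest for d = 1, where the numerator is 11 and the denominator 25 k -
  6.\<close>

lemma gamma0_le: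
  assumes "d \<in> {1, 2, 3}" "k \<ge> 1"
  shows "gamma0 d k \<le> 11 / (25 * k - 6)"
proof -
  have "(13 - 2 * real d) / (2 * (4 * real d - 7) + 25 * k) \<le> 11 / (25 * k - 6)"
    using assms by (intro frac_le) auto
  then show ?thesis by (simp add: gamma0_def)
qed

lemma gamma0_pos:
  assumes "d \<in> {1, 2, 3}" "k \<ge> 1"
  shows "gamma0 d k > 0"
  using assms by (auto simp: gamma0_def intro!: divide_pos_pos)

text \<open>A linear program in X and T. Since q1 <= P1, the worst case has as much mass in the
  interior as allowed; with T <= A - X the Friedrichs inequality gives X <= (\<rho>1 + t) / (1 + c +
  t) * A. The hypothesis \<open>num\<close> says that at this X, with T = A - X, the objective is at
  most 9/2 A.\<close>

lemma first_mode_linear: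
  fixes P P1 q q1 \<rho> \<rho>1 X T A c t :: real
  assumes le: "P \<le> P1" "0 \<le> q" "q \<le> q1" "\<rho> \<le> \<rho>1" and nonneg: "0 \<le> X" "0 \<le> T" "0 \<le> t" "0 \<le> c"
    and A: "X + T \<le> A" and fr: "c * X \<le> t * T + (\<rho> * A - X)"
    and num: "q1 \<le> P1" "(P1 - q1) * (\<rho>1 + t) \<le> (9 / 2 - q1) * (1 + c + t)"
  shows "P * X + q * T \<le> 9 / 2 * A"
proof -
  have A0: "0 \<le> A" using nonneg A by linarith
  have "\<rho> * A \<le> \<rho>1 * A" using le A0 by (intro mult_right_mono) auto
  moreover have "t * T \<le> t * (A - X)" using nonneg A by (intro mult_left_mono) auto
  ultimately have X: "(1 + c + t) * X \<le> (\<rho>1 + t) * A"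
    using fr by (simp add: algebra_simps)
  have "(1 + c + t) * ((P1 - q1) * X) = (P1 - q1) * ((1 + c + t) * X)" by simp
  also have "\<dots> \<le> (P1 - q1) * ((\<rho>1 + t) * A)" using X num(1) by (intro mult_left_mono) auto
  also have "\<dots> = ((P1 - q1) * (\<rho>1 + t)) * A" by simp
  also have "\<dots> \<le> ((9 / 2 - q1) * (1 + c + t)) * A" by (rule mult_right_mono[OF num(2) A0])
  also have "\<dots> = (1 + c + t) * ((9 / 2 - q1) * A)" by simp
  finally have "(P1 - q1) * X \<le> (9 / 2 - q1) * A"
    using nonneg by (simp add: mult_le_cancel_left)
  moreover have "P * X \<le> P1 * X" using le nonneg by (intro mult_right_mono) auto
  moreover have "q * T \<le> q1 * (A - X)" using le nonneg A by (intro mult_mono) auto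
  ultimately show ?thesis by (simp add: algebra_simps)
qed

text \<open>By stability \<open>X + T \<le> A\<close>, which settles the claim if \<open>k \<ge> 2\<close>.  For smaller \<open>k\<close> the bound
  \<open>(2 + \<epsilon>)\<^sup>2\<close> may exceed \<open>9/2\<close>; then the mass cannot sit entirely in the interior, because by
  Friedrichs' inequality that would make the gradient too large.\<close>

lemma first_mode_bound:
  fixes k \<epsilon> X T A :: real
  assumes k: "k \<ge> 1" and \<epsilon>: "\<epsilon> > 0" "\<epsilon> * (2 + \<epsilon>) < 11 / (25 * k - 6)"
    and nonneg: "0 \<le> X" "0 \<le> T" and A: "X + T \<le> A"
    and fr: "\<And>b. 0 < b \<Longrightarrow> b < 1 \<Longrightarrow>
      (3 * b - b\<^sup>2) * X \<le> (3 * b - b\<^sup>2) / (1 - b) * T + (((k\<^sup>2 + 1) / (k + 1))\<^sup>2 * A - X)"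
  shows "(2 + \<epsilon>)\<^sup>2 * X + 1 / k\<^sup>2 * T \<le> 9 / 2 * A"
proof -
  \<comment> \<open>The ratio of the two stability constants: (1 + 1/k^2) / (1/k + 1/k^2) = (k^2 +
    1) / (k + 1), squared.\<close>
  define \<rho> where "\<rho> x = ((x\<^sup>2 + 1) / (x + 1))\<^sup>2" for x :: real
  have P: "(2 + \<epsilon>)\<^sup>2 \<le> 4 + 22 / (25 * k - 6)"
  proof -
    have "(2 + \<epsilon>)\<^sup>2 \<le> 4 + 2 * (\<epsilon> * (2 + \<epsilon>))" by (simp add: power2_eq_square algebra_simps)
    also have "\<dots> \<le> 4 + 2 * (11 / (25 * k - 6))" using \<epsilon>(2) by linarith
    finally show ?thesis by simp
  qed
  have \<rho>: "\<rho> k \<le> \<rho> k2" if "k \<le> k2" for k2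
  proof -
    have "0 \<le> k * k2" using that k by (intro mult_nonneg_nonneg) auto
    then have "0 \<le> k * k2 + k + k2 - 1" using that k by linarith
    then have "0 \<le> (k2 - k) * (k * k2 + k + k2 - 1)" using that by (intro mult_nonneg_nonneg) auto
    then have "(k\<^sup>2 + 1) * (k2 + 1) \<le> (k2\<^sup>2 + 1) * (k + 1)" by (simp add: power2_eq_square algebra_simps)
    then have "(k\<^sup>2 + 1) / (k + 1) \<le> (k2\<^sup>2 + 1) / (k2 + 1)" using k that by (simp add: frac_le_eq divide_le_eq pos_divide_le_eq pos_le_divide_eq)
    then show ?thesis unfolding \<rho>_def using k by (intro power_mono) auto
  qed
  have q: "1 / k\<^sup>2 \<le> 1 / k1\<^sup>2" if "1 \<le> k1" "k1 \<le> k" for k1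
    using that by (intro divide_left_mono power_mono mult_pos_pos zero_less_power) auto
  \<comment> \<open>One interval k1 <= k <= k2: the bounds for (2 + \<epsilon>)^2 and 1 / k^2
    decrease in k and are taken at the left end, \<rho> increases and is taken at the right
    end.\<close>
  have step: ?thesis
    if b: "0 < b" "b < 1" and k12: "1 \<le> k1" "k1 \<le> k" "k \<le> k2"
      and P1: "4 + 22 / (25 * k1 - 6) \<le> P1" and q1: "1 / k1\<^sup>2 \<le> q1" and \<rho>1: "\<rho> k2 \<le> \<rho>1"
      and num: "q1 \<le> P1" "(P1 - q1) * (\<rho>1 + (3 * b - b\<^sup>2) / (1 - b)) \<le> (9 / 2 - q1) * (1 + (3 * b - b\<^sup>2) + (3 * b - b\<^sup>2) / (1 - b))"
    for b k1 k2 P1 q1 \<rho>1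
  proof (rule first_mode_linear[OF _ _ _ _ nonneg _ _ A _ num])
    have "22 / (25 * k - 6) \<le> 22 / (25 * k1 - 6)" using k12 by (intro divide_left_mono mult_pos_pos) auto
    then show "(2 + \<epsilon>)\<^sup>2 \<le> P1" using P P1 by linarith
    show "1 / k\<^sup>2 \<le> q1" using q[OF k12(1,2)] q1 by linarith
    show "\<rho> k \<le> \<rho>1" using \<rho>[OF k12(3)] \<rho>1 by linarith
    show "0 \<le> 3 * b - b\<^sup>2" using b by (simp add: power2_eq_square mult_le_cancel_right)
    then show "0 \<le> (3 * b - b\<^sup>2) / (1 - b)" using b by simp
    show "(3 * b - b\<^sup>2) * X \<le> (3 * b - b\<^sup>2) / (1 - b) * T + (\<rho> k * A - X)"
      using fr[OF b] by (simp add: \<rho>_def)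
  qed simp
  \<comment> \<open>As soon as P1 > 9/2, \<open>num\<close> forces \<rho>1 < 1 + c. The value b =
    1/2 gives c = 5/4 with the moderate boundary coefficient 5/2, but near k = 2 the ratio
    approaches 25/9, and b = 9/10 is taken to have 1 + c = 2.89 above it. The intervals shrink
    towards 2, where this margin is smallest.\<close>
  consider "k \<le> 13/10" | "13/10 \<le> k" "k \<le> 3/2" | "3/2 \<le> k" "k \<le> 8/5" | "8/5 \<le> k" "k \<le> 33/20"
    | "33/20 \<le> k" "k \<le> 7/4" | "7/4 \<le> k" "k \<le> 37/20" | "37/20 \<le> k" "k \<le> 193/100"
    | "193/100 \<le> k" "k \<le> 197/100" | "197/100 \<le> k" "k \<le> 2" | "2 \<le> k"
    by linarith
  then show ?thesis
  proof cases
    case 1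
    show ?thesis by (rule step[of "1/2" 1 "13/10" "516/100" 1 "137/100"]) (use 1 k in \<open>simp_all add: \<rho>_def power2_eq_square\<close>)
  next
    case 2
    show ?thesis by (rule step[of "1/2" "13/10" "3/2" "484/100" 1 "169/100"]) (use 2 in \<open>simp_all add: \<rho>_def power2_eq_square\<close>)
  next
    case 3
    show ?thesis by (rule step[of "1/2" "3/2" "8/5" "470/100" 1 "188/100"]) (use 3 in \<open>simp_all add: \<rho>_def power2_eq_square\<close>)
  next
    case 4
    show ?thesis by (rule step[of "1/2" "8/5" "33/20" "465/100" 1 "198/100"]) (use 4 in \<open>simp_all add: \<rho>_def power2_eq_square\<close>)
  next
    case 5
    show ?thesis by (rule step[of "9/10" "33/20" "7/4" "46242/10000" "1/2" "21824/10000"]) (use 5 in \<open>simp_all add: \<rho>_def power2_eq_square\<close>)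
  next
    case 6
    show ?thesis by (rule step[of "9/10" "7/4" "37/20" "45829/10000" "1/2" "24080/10000"]) (use 6 in \<open>simp_all add: \<rho>_def power2_eq_square\<close>)
  next
    case 7
    show ?thesis by (rule step[of "9/10" "37/20" "193/100" "45467/10000" "1/2" "26006/10000"]) (use 7 in \<open>simp_all add: \<rho>_def power2_eq_square\<close>)
  next
    case 8
    show ?thesis by (rule step[of "9/10" "193/100" "197/100" "45208/10000" "1/2" "27008/10000"]) (use 8 in \<open>simp_all add: \<rho>_def power2_eq_square\<close>)
  next
    case 9
    show ?thesis by (rule step[of "9/10" "197/100" 2 "45088/10000" "1/2" "27778/10000"]) (use 9 in \<open>simp_all add: \<rho>_def power2_eq_square\<close>)
  next
    case 10
    \<comment> \<open>At k = 2 the denominator is 44, so the bound for (2 + \<epsilon>)^2 has come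
      down to 9/2 and the L2 estimate alone suffices.\<close>
    have "22 / (25 * k - 6) \<le> 22 / 44" using 10 by (intro divide_left_mono) auto
    then have "(2 + \<epsilon>)\<^sup>2 \<le> 9 / 2" using P by simp
    then have "(2 + \<epsilon>)\<^sup>2 * X \<le> 9 / 2 * X" using nonneg by (intro mult_right_mono) auto
    moreover have "1 / k\<^sup>2 * T \<le> 1 * T" using nonneg k by (intro mult_right_mono) (auto simp: divide_le_eq_1 one_le_power)
    ultimately show ?thesis using A nonneg by linarith
  qed
qed

lemma two_term_growth:
  fixes a :: "nat \<Rightarrow> real"
  assumes c: "1 \<le> c" and a: "a 1 \<le> 4 * c * a 0" "\<And>n. a (n + 2) \<le> c * (8 * a (n + 1) + 2 * a n)"
    and A: "a 0 \<le> A" "0 \<le> A"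
  shows "a (Suc n) \<le> (16 * c) ^ Suc n * A / 4"
proof (induction n rule: less_induct)
  case (less n)
  consider "n = 0" | "n = 1" | m where "n = Suc (Suc m)" by (metis One_nat_def not0_implies_Suc)
  then show ?case
  proof cases
    case 1
    have "4 * c * a 0 \<le> 4 * c * A" using c A by (intro mult_left_mono) auto
    then have "a 1 \<le> 4 * c * A" using a(1) by linarith
    then show ?thesis using 1 by (simp add: mult.commute mult.left_commute)
  next
    case 2
    have 1: "a 1 \<le> 4 * c * A" using less[of 0] 2 by (simp add: mult.commute mult.left_commute)
    have "a (0 + 2) \<le> c * (8 * a (0 + 1) + 2 * a 0)" by (rule a(2))
    then have "a (Suc 1) \<le> c * (8 * a 1 + 2 * a 0)" by (simp add: numeral_2_eq_2)
    also have "\<dots> \<le> c * (8 * (4 * c * A) + 2 * (c * A))"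
      using c A 1 mult_right_mono[OF c A(2)] by (intro mult_left_mono add_mono) auto
    also have "\<dots> \<le> (16 * c) ^ 2 * A / 4" using c A by (simp add: power2_eq_square)
    finally have "a (Suc 1) \<le> (16 * c)\<^sup>2 * A / 4" .
    then show ?thesis using 2 by (simp add: power2_eq_square)
  next
    case 3
    define B where "B = (16 * c) ^ Suc m * A / 4"
    have B0: "0 \<le> B" using c A by (simp add: B_def)
    have IH: "a (m + 1) \<le> B" "a (m + 2) \<le> 16 * c * B"
      using less[of m] less[of "Suc m"] 3 by (simp_all add: B_def mult_ac)
    have "a (m + 1 + 2) \<le> c * (8 * a (m + 1 + 1) + 2 * a (m + 1))" by (rule a(2))
    also have "\<dots> \<le> c * (8 * (16 * c * B) + 2 * (c * B))"
      using c IH mult_right_mono[OF c B0] by (intro mult_left_mono add_mono) auto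
    also have "\<dots> \<le> (16 * c)\<^sup>2 * B" using c B0 by (simp add: power2_eq_square)
    finally show ?thesis using 3 by (simp add: B_def power2_eq_square mult_ac)
  qed
qed

section \<open>Stability and the mode functions\<close>

abbreviation (input) mean_sq :: "'w measure \<Rightarrow> 'x measure \<Rightarrow> ('w \<Rightarrow> 'x \<Rightarrow> 'b::real_normed_vector) \<Rightarrow> real" where
  "mean_sq P M u \<equiv> LINT \<omega>|P. (L2_norm M (u \<omega>))\<^sup>2"

context helmholtz_domain
begin

text \<open>The form in which stability is applied: the boundary gradient, which enters with the
  positive weight c0, is dropped, and the expectations are split.\<close>

lemma stability:
  assumes st: "stability_const P D c0 \<eta> k C0" and c0: "0 < c0"
    and \<epsilon>: "0 \<le> \<epsilon>" "\<epsilon> * (2 + \<epsilon>) < gamma0 CARD('d) k"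
    and f: "f \<in> L2L2 P \<mu>" and g: "g \<in> L2L2 P S"
    and u: "weak_solution P D k (\<lambda>\<omega> x. 1 + \<epsilon> * \<eta> \<omega> x) f g u Du \<tau>"
  defines "data \<equiv> mean_sq P \<mu> f + mean_sq P S g"
  shows "mean_sq P \<mu> u + mean_sq P S \<tau> \<le> C0 * (1 / k + 1 / k\<^sup>2)\<^sup>2 * data"
    and "mean_sq P \<mu> u + mean_sq P \<mu> Du \<le> C0 * (1 + 1 / k\<^sup>2)\<^sup>2 * data"
proof -
  have "L2H1 P D u Du \<tau>" using u by (simp add: weak_solution_def)
  note int = L2H1_D(1-3)[OF this, THEN bochner_L2_integrable]
  have data: "data = (LINT \<omega>|P. (L2_norm \<mu> (f \<omega>))\<^sup>2 + (L2_norm S (g \<omega>))\<^sup>2)"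
    using bochner_L2_integrable[OF f] bochner_L2_integrable[OF g] by (simp add: data_def)
  note est = st[unfolded stability_const_def Let_def, rule_format, OF \<epsilon> f g u, folded data]
  obtain G :: "_ \<Rightarrow> real^'d \<Rightarrow> complex^'d" where G: "G \<in> L2L2 P S"
      "(LINT \<omega>|P. (L2_norm \<mu> (u \<omega>))\<^sup>2 + (L2_norm S (\<tau> \<omega>))\<^sup>2 + c0 * (L2_norm S (G \<omega>))\<^sup>2)
        \<le> C0 * (1 / k + 1 / k\<^sup>2)\<^sup>2 * data"
    using est[THEN conjunct1] by blast
  note H1 = est[THEN conjunct2]
  have "mean_sq P \<mu> u + mean_sq P S \<tau>
      = (LINT \<omega>|P. (L2_norm \<mu> (u \<omega>))\<^sup>2 + (L2_norm S (\<tau> \<omega>))\<^sup>2)"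
    using int by simp
  also have "\<dots> \<le> (LINT \<omega>|P. (L2_norm \<mu> (u \<omega>))\<^sup>2 + (L2_norm S (\<tau> \<omega>))\<^sup>2 + c0 * (L2_norm S (G \<omega>))\<^sup>2)"
    using int bochner_L2_integrable[OF G(1)] c0 by (intro integral_mono) auto
  finally show "mean_sq P \<mu> u + mean_sq P S \<tau> \<le> C0 * (1 / k + 1 / k\<^sup>2)\<^sup>2 * data"
    using G(2) by linarith
  show "mean_sq P \<mu> u + mean_sq P \<mu> Du \<le> C0 * (1 + 1 / k\<^sup>2)\<^sup>2 * data"
    using H1 int unfolding Hj_norm_1_sq by simp
qed

text \<open>Testing the stability estimate with a constant function.\<close>

lemma stability_const_lower_bound:
  assumes st: "stability_const P D c0 \<eta> k C0" and c0: "0 < c0" and C0: "0 < C0" and k: "1 \<le> k"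
    and P: "prob_space P"
  shows "1 \<le> C0 * (1 + k)\<^sup>2"
proof -
  interpret prob_space P by fact
  let ?d = "measure \<mu> (space \<mu>)" and ?s = "measure S (space S)"
  have fin: "finite_measure P" by unfold_locales
  have cL2: "(\<lambda>x. c) \<in> L2_space \<mu>" "(\<lambda>x. c) \<in> L2_space S" for c :: complex
    by (simp_all add: continuous_L2_D continuous_L2_S)
  have "0 < gamma0 CARD('d) k" by (rule gamma0_pos[OF dim k])
  then have "(LINT \<omega>|P. (L2_norm \<mu> (\<lambda>x. 1 :: complex))\<^sup>2) + (LINT \<omega>|P. (L2_norm S (\<lambda>x. 1 :: complex))\<^sup>2)
      \<le> C0 * (1 / k + 1 / k\<^sup>2)\<^sup>2 * ((LINT \<omega>|P. (L2_norm \<mu> (\<lambda>x. - of_real (k\<^sup>2) :: complex))\<^sup>2)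
         + (LINT \<omega>|P. (L2_norm S (\<lambda>x. \<i> * of_real k))\<^sup>2))"
    using weak_solution_const[OF fin]
    by (intro stability(1)[OF st c0, of 0] L2L2_const fin cL2) auto
  then have "?d + ?s \<le> C0 * (1 / k + 1 / k\<^sup>2)\<^sup>2 * (k ^ 4 * ?d + k\<^sup>2 * ?s)"
    by (simp add: L2_norm_sq prob_space norm_mult norm_power mult.commute flip: power_mult)
  \<comment> \<open>The boundary datum carries only k^2; raising it to k^4 lets the total mass of
    interior and boundary be factored out.\<close>
  also have "\<dots> \<le> C0 * (1 / k + 1 / k\<^sup>2)\<^sup>2 * (k ^ 4 * (?d + ?s))"
  proof -
    have "k\<^sup>2 \<le> k ^ 4" using k by (intro power_increasing) auto
    then have "k\<^sup>2 * ?s \<le> k ^ 4 * ?s" by (intro mult_right_mono) auto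
    then show ?thesis using C0 by (intro mult_left_mono) (auto simp: distrib_left)
  qed
  also have "\<dots> = C0 * (1 + k)\<^sup>2 * (?d + ?s)"
  proof -
    have "1 / k + 1 / k\<^sup>2 = (1 + k) / k\<^sup>2" using k by (simp add: field_simps power2_eq_square)
    then show ?thesis using k by (simp add: power_divide flip: power_mult)
  qed
  finally have le: "1 * (?d + ?s) \<le> C0 * (1 + k)\<^sup>2 * (?d + ?s)" by simp
  \<comment> \<open>Cancelling the total mass needs it to be positive, which the volume of a
    nonempty open set ensures.\<close>
  have "?d > 0"
  proof -
    have "D \<in> sets borel" using open_D by simp
    then have "?d = measure lborel D"
      by (simp add: measure_restrict_space)
    moreover have "emeasure lborel D \<noteq> 0"
    proof
      assume "emeasure lborel D = 0"
      then have "negligible D" using \<open>D \<in> sets borel\<close>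
        by (simp add: negligible_iff_null_sets null_sets_completion_iff null_sets_def)
      then show False using open_D D_nonempty open_not_negligible by blast
    qed
    ultimately show ?thesis
      using emeasure_D_finite by (simp add: measure_def enn2real_positive_iff zero_less_iff_neq_zero)
  qed
  moreover have "0 \<le> ?s" by simp
  ultimately have "0 < ?d + ?s" by linarith
  then show ?thesis using le mult_le_cancel_right_pos[of "?d + ?s" 1] by simp
qed

lemma coefficient_AE:
  assumes "\<eta> \<in> L2Linf P M" "AE \<omega> in P. Linf_norm M (\<eta> \<omega>) \<le> 1"
  shows "AE \<omega> in P. AE x in M. \<bar>\<eta> \<omega> x\<bar> \<le> (1::real)"
  using assms(2) AE_space
proof eventually_elim
  case (elim \<omega>)
  show ?case using Linf_norm_AE[OF bochner_L2_in[OF assms(1) elim(2)]]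
    by eventually_elim (use elim(1) in auto)
qed

text \<open>Lifts a pointwise quadratic bound to mean squares; two functions appear on the right
  because a source involves the two preceding modes.\<close>

lemma L2L2_norm_le:
  fixes F u v :: "'w \<Rightarrow> 'x \<Rightarrow> complex"
  assumes F: "F \<in> L2L2 P M" and u: "u \<in> L2L2 P M" and v: "v \<in> L2L2 P M"
    and le: "AE \<omega> in P. AE x in M. (norm (F \<omega> x))\<^sup>2 \<le> a * (norm (u \<omega> x))\<^sup>2 + b * (norm (v \<omega> x))\<^sup>2"
  shows "mean_sq P M F \<le> a * mean_sq P M u + b * mean_sq P M v"
proof -
  note int = bochner_L2_integrable[OF F] bochner_L2_integrable[OF u] bochner_L2_integrable[OF v]
  have "mean_sq P M F \<le> (LINT \<omega>|P. a * (L2_norm M (u \<omega>))\<^sup>2 + b * (L2_norm M (v \<omega>))\<^sup>2)"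
  proof (rule integral_mono_AE)
    show "AE \<omega> in P. (L2_norm M (F \<omega>))\<^sup>2 \<le> a * (L2_norm M (u \<omega>))\<^sup>2 + b * (L2_norm M (v \<omega>))\<^sup>2"
      using le AE_space
    proof eventually_elim
      case (elim \<omega>)
      note m = L2_space_integrable[OF bochner_L2_in[OF F elim(2)]] L2_space_integrable[OF bochner_L2_in[OF u elim(2)]]
        L2_space_integrable[OF bochner_L2_in[OF v elim(2)]]
      have "(LINT x|M. (norm (F \<omega> x))\<^sup>2) \<le> (LINT x|M. a * (norm (u \<omega> x))\<^sup>2 + b * (norm (v \<omega> x))\<^sup>2)"
        using m elim(1) by (intro integral_mono_AE) auto
      then show ?case using m by (simp add: L2_norm_sq)
    qed
  qed (use int in auto)
  then show ?thesis using int by simp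
qed

end

locale mode_expansion = helmholtz_domain D for D :: "(real^'d) set" +
  fixes P :: "'w measure" and \<eta> :: "'w \<Rightarrow> real^'d \<Rightarrow> real" and k \<epsilon> c0 C0 :: real
    and f u\<epsilon> \<tau>u\<epsilon> :: "'w \<Rightarrow> real^'d \<Rightarrow> complex" and Du\<epsilon> :: "'w \<Rightarrow> real^'d \<Rightarrow> complex^'d"
    and u \<tau>u :: "nat \<Rightarrow> 'w \<Rightarrow> real^'d \<Rightarrow> complex" and Du :: "nat \<Rightarrow> 'w \<Rightarrow> real^'d \<Rightarrow> complex^'d"
  assumes parameters: "k \<ge> 1" "\<epsilon> > 0" "c0 > 0"
    and prob: "prob_space P"
    and eta_D: "\<eta> \<in> L2Linf P \<mu>" "AE \<omega> in P. Linf_norm \<mu> (\<eta> \<omega>) \<le> 1"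
    and eta_bd: "\<eta> \<in> L2Linf P S" "AE \<omega> in P. Linf_norm S (\<eta> \<omega>) \<le> 1"
    and C0: "C0 > 0" "stability_const P D c0 \<eta> k C0"
    and f: "f \<in> L2L2 P \<mu>"
    and u_eps: "weak_solution P D k (\<lambda>\<omega> x. 1 + \<epsilon> * \<eta> \<omega> x) f (\<lambda>\<omega> x. 0) u\<epsilon> Du\<epsilon> \<tau>u\<epsilon>"
    and modes: "\<And>n. weak_solution P D k (\<lambda>\<omega> x. 1)
          (\<lambda>\<omega> x. if n = 0 then f \<omega> x
                 else of_real (2 * k\<^sup>2 * \<eta> \<omega> x) * lag u 1 n \<omega> x
                    + of_real (k\<^sup>2 * (\<eta> \<omega> x)\<^sup>2) * lag u 2 n \<omega> x)
          (\<lambda>\<omega> x. - \<i> * of_real (k * \<eta> \<omega> x) * lag \<tau>u 1 n \<omega> x)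
          (u n) (Du n) (\<tau>u n)"
    and small: "\<epsilon> * (2 + \<epsilon>) < gamma0 CARD('d) k"
begin

text \<open>The sources of the modes (with \<open>q = 0\<close>) and, up to a power of \<open>\<epsilon>\<close>, of the residual (with
  \<open>q = \<epsilon>\<close>).\<close>

definition source :: "real \<Rightarrow> nat \<Rightarrow> 'w \<Rightarrow> real^'d \<Rightarrow> complex" where
  "source q n \<omega> x = of_real (2 * k\<^sup>2 * \<eta> \<omega> x + q * k\<^sup>2 * (\<eta> \<omega> x)\<^sup>2) * lag u 1 n \<omega> x
     + of_real (k\<^sup>2 * (\<eta> \<omega> x)\<^sup>2) * lag u 2 n \<omega> x"

definition bsource :: "nat \<Rightarrow> 'w \<Rightarrow> real^'d \<Rightarrow> complex" where
  "bsource n \<omega> x = - \<i> * of_real (k * \<eta> \<omega> x) * lag \<tau>u 1 n \<omega> x"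

definition mode_source :: "nat \<Rightarrow> 'w \<Rightarrow> real^'d \<Rightarrow> complex" where
  "mode_source n = (if n = 0 then f else source 0 n)"

lemma mode: "weak_solution P D k (\<lambda>\<omega> x. 1) (mode_source n) (bsource n) (u n) (Du n) (\<tau>u n)"
proof -
  have "mode_source n = (\<lambda>\<omega> x. if n = 0 then f \<omega> x
                 else of_real (2 * k\<^sup>2 * \<eta> \<omega> x) * lag u 1 n \<omega> x
                    + of_real (k\<^sup>2 * (\<eta> \<omega> x)\<^sup>2) * lag u 2 n \<omega> x)"
    "bsource n = (\<lambda>\<omega> x. - \<i> * of_real (k * \<eta> \<omega> x) * lag \<tau>u 1 n \<omega> x)"
    by (auto simp: mode_source_def source_def bsource_def fun_eq_iff)
  then show ?thesis using modes[of n] by simp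
qed

lemma mode_L2H1: "L2H1 P D (u n) (Du n) (\<tau>u n)"
  using mode by (simp add: weak_solution_def)

lemmas mode_in = L2H1_D(1-3)[OF mode_L2H1]

lemma finite_P: "finite_measure P"
  using prob by (simp add: prob_space_def)

lemma lag_in: "lag u m n \<in> L2L2 P \<mu>" "lag \<tau>u m n \<in> L2L2 P S"
proof -
  have "(\<lambda>x. 0 :: complex) \<in> L2_space \<mu>" "(\<lambda>x. 0 :: complex) \<in> L2_space S"
    by (simp_all add: continuous_L2_D continuous_L2_S)
  note zero = this[THEN L2L2_const[OF finite_P]]
  show "lag u m n \<in> L2L2 P \<mu>" "lag \<tau>u m n \<in> L2L2 P S"
    using mode_in zero by (simp_all add: lag_def)
qed

lemma source_in: "source q n \<in> L2L2 P \<mu>"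
proof -
  have eq: "source q n = (\<lambda>\<omega> x. of_real (2 * k\<^sup>2) * (of_real (\<eta> \<omega> x) * lag u 1 n \<omega> x)
     + (of_real (q * k\<^sup>2) * (of_real (\<eta> \<omega> x) * (of_real (\<eta> \<omega> x) * lag u 1 n \<omega> x))
      + of_real (k\<^sup>2) * (of_real (\<eta> \<omega> x) * (of_real (\<eta> \<omega> x) * lag u 2 n \<omega> x))))"
    by (simp add: source_def fun_eq_iff algebra_simps power2_eq_square)
  show ?thesis unfolding eq
    by (intro L2L2_add L2L2_cmult L2L2_mult[OF eta_D] lag_in)
qed

lemma bsource_in: "bsource n \<in> L2L2 P S"
proof -
  have eq: "bsource n = (\<lambda>\<omega> x. (- \<i> * of_real k) * (of_real (\<eta> \<omega> x) * lag \<tau>u 1 n \<omega> x))"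
    by (simp add: bsource_def fun_eq_iff algebra_simps)
  show ?thesis unfolding eq
    by (intro L2L2_cmult L2L2_mult[OF eta_bd] lag_in)
qed

lemma mode_source_in: "mode_source n \<in> L2L2 P \<mu>"
  using f source_in by (simp add: mode_source_def)

abbreviation X :: "nat \<Rightarrow> real" where "X n \<equiv> mean_sq P \<mu> (u n)"
abbreviation T :: "nat \<Rightarrow> real" where "T n \<equiv> mean_sq P S (\<tau>u n)"

lemma X_nonneg: "0 \<le> X n" and T_nonneg: "0 \<le> T n"
  by (intro Bochner_Integration.integral_nonneg; simp)+

section \<open>Mean square bounds for the sources\<close>

lemma norm_source_le:
  assumes \<eta>: "\<bar>\<eta> \<omega> x\<bar> \<le> 1" and q: "0 \<le> q"
  shows "norm (source q n \<omega> x) \<le> k\<^sup>2 * ((2 + q) * norm (lag u 1 n \<omega> x) + norm (lag u 2 n \<omega> x))"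
proof -
  have sq: "(\<eta> \<omega> x)\<^sup>2 \<le> 1" using \<eta> by (simp add: abs_square_le_1)
  have "\<bar>2 * k\<^sup>2 * \<eta> \<omega> x + q * k\<^sup>2 * (\<eta> \<omega> x)\<^sup>2\<bar> = k\<^sup>2 * \<bar>2 * \<eta> \<omega> x + q * (\<eta> \<omega> x)\<^sup>2\<bar>"
  proof -
    have "2 * k\<^sup>2 * \<eta> \<omega> x + q * k\<^sup>2 * (\<eta> \<omega> x)\<^sup>2 = k\<^sup>2 * (2 * \<eta> \<omega> x + q * (\<eta> \<omega> x)\<^sup>2)"
      by (simp add: algebra_simps)
    then show ?thesis by (simp add: abs_mult)
  qed
  also have "\<dots> \<le> k\<^sup>2 * (2 + q)"
  proof (rule mult_left_mono)
    have "q * (\<eta> \<omega> x)\<^sup>2 \<le> q" "0 \<le> q * (\<eta> \<omega> x)\<^sup>2" using q sq by (auto simp: mult_left_le)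
    then show "\<bar>2 * \<eta> \<omega> x + q * (\<eta> \<omega> x)\<^sup>2\<bar> \<le> 2 + q" using \<eta> by linarith
  qed simp
  finally have 1: "\<bar>2 * k\<^sup>2 * \<eta> \<omega> x + q * k\<^sup>2 * (\<eta> \<omega> x)\<^sup>2\<bar> \<le> k\<^sup>2 * (2 + q)" .
  have 2: "\<bar>k\<^sup>2 * (\<eta> \<omega> x)\<^sup>2\<bar> \<le> k\<^sup>2" using sq by (simp add: abs_mult mult_left_le)
  have "norm (source q n \<omega> x) \<le> \<bar>2 * k\<^sup>2 * \<eta> \<omega> x + q * k\<^sup>2 * (\<eta> \<omega> x)\<^sup>2\<bar> * norm (lag u 1 n \<omega> x)
      + \<bar>k\<^sup>2 * (\<eta> \<omega> x)\<^sup>2\<bar> * norm (lag u 2 n \<omega> x)"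
    unfolding source_def by (rule order_trans[OF norm_triangle_ineq]) (simp only: norm_mult norm_of_real order_refl)
  also have "\<dots> \<le> k\<^sup>2 * (2 + q) * norm (lag u 1 n \<omega> x) + k\<^sup>2 * norm (lag u 2 n \<omega> x)"
    by (intro add_mono mult_right_mono 1 2) auto
  finally show ?thesis by (simp add: algebra_simps)
qed

text \<open>For n = 1 the second lag vanishes, so squaring costs no factor 2. The constant for N = 1
  depends on this.\<close>

lemma source_norm_1:
  assumes q: "0 \<le> q"
  shows "mean_sq P \<mu> (source q 1) \<le> k ^ 4 * (2 + q)\<^sup>2 * X 0"
proof -
  have "mean_sq P \<mu> (source q 1) \<le> k ^ 4 * (2 + q)\<^sup>2 * X 0 + 0 * X 0"
  proof (rule L2L2_norm_le[OF source_in mode_in(1) mode_in(1)])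
    show "AE \<omega> in P. AE x in \<mu>. (norm (source q 1 \<omega> x))\<^sup>2
        \<le> k ^ 4 * (2 + q)\<^sup>2 * (norm (u 0 \<omega> x))\<^sup>2 + 0 * (norm (u 0 \<omega> x))\<^sup>2"
      using coefficient_AE[OF eta_D]
    proof eventually_elim
      case (elim \<omega>)
      then show ?case
      proof eventually_elim
        case (elim x)
        have "norm (source q 1 \<omega> x) \<le> k\<^sup>2 * ((2 + q) * norm (u 0 \<omega> x))"
          using norm_source_le[OF elim q, of 1] by (simp add: lag_def)
        then have "(norm (source q 1 \<omega> x))\<^sup>2 \<le> (k\<^sup>2 * ((2 + q) * norm (u 0 \<omega> x)))\<^sup>2"
          by (intro power_mono) auto
        then show ?case by (simp add: power_mult_distrib flip: power_mult)
      qed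
    qed
  qed
  then show ?thesis by simp
qed

text \<open>Here both preceding modes contribute, and (a + b)^2 <= 2 a^2 + 2 b^2 accounts for the
  factor 2.\<close>

lemma source_norm:
  assumes q: "0 \<le> q"
  shows "mean_sq P \<mu> (source q (n + 2))
    \<le> k ^ 4 * (2 * (2 + q)\<^sup>2) * X (n + 1) + k ^ 4 * 2 * X n"
proof (rule L2L2_norm_le[OF source_in mode_in(1) mode_in(1)])
  show "AE \<omega> in P. AE x in \<mu>. (norm (source q (n + 2) \<omega> x))\<^sup>2
      \<le> k ^ 4 * (2 * (2 + q)\<^sup>2) * (norm (u (n + 1) \<omega> x))\<^sup>2 + k ^ 4 * 2 * (norm (u n \<omega> x))\<^sup>2"
    using coefficient_AE[OF eta_D]
  proof eventually_elim
    case (elim \<omega>)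
    then show ?case
    proof eventually_elim
      case (elim x)
      let ?a = "(2 + q) * norm (u (n + 1) \<omega> x)" and ?b = "norm (u n \<omega> x)"
      have "norm (source q (n + 2) \<omega> x) \<le> k\<^sup>2 * (?a + ?b)"
        using norm_source_le[OF elim q, of "n + 2"] by (simp add: lag_def)
      then have "(norm (source q (n + 2) \<omega> x))\<^sup>2 \<le> (k\<^sup>2 * (?a + ?b))\<^sup>2"
        by (intro power_mono) auto
      also have "\<dots> = k ^ 4 * (?a + ?b)\<^sup>2" by (simp add: power_mult_distrib flip: power_mult)
      also have "\<dots> \<le> k ^ 4 * (2 * ?a\<^sup>2 + 2 * ?b\<^sup>2)"
        using norm_add_sq_le[of 1 ?a ?b] by (intro mult_left_mono) auto
      also have "\<dots> = k ^ 4 * (2 * (2 + q)\<^sup>2) * (norm (u (n + 1) \<omega> x))\<^sup>2 + k ^ 4 * 2 * (norm (u n \<omega> x))\<^sup>2"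
        by (simp only: power_mult_distrib distrib_left mult.assoc)
      finally show ?case .
    qed
  qed
qed

lemma bsource_norm: "mean_sq P S (bsource (Suc n)) \<le> k\<^sup>2 * T n"
proof -
  have "mean_sq P S (bsource (Suc n)) \<le> k\<^sup>2 * T n + 0 * T n"
  proof (rule L2L2_norm_le[OF bsource_in mode_in(3) mode_in(3)])
    show "AE \<omega> in P. AE x in S. (norm (bsource (Suc n) \<omega> x))\<^sup>2 \<le> k\<^sup>2 * (norm (\<tau>u n \<omega> x))\<^sup>2 + 0 * (norm (\<tau>u n \<omega> x))\<^sup>2"
      using coefficient_AE[OF eta_bd]
    proof eventually_elim
      case (elim \<omega>)
      then show ?case
      proof eventually_elim
        case (elim x)
        have "(\<eta> \<omega> x)\<^sup>2 \<le> 1" using elim by (simp add: abs_square_le_1)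
        then have "(k\<^sup>2 * (norm (\<tau>u n \<omega> x))\<^sup>2) * (\<eta> \<omega> x)\<^sup>2 \<le> k\<^sup>2 * (norm (\<tau>u n \<omega> x))\<^sup>2"
          by (intro mult_left_le) auto
        then show ?case
          by (simp add: bsource_def lag_def norm_mult power_mult_distrib algebra_simps)
      qed
    qed
  qed
  then show ?thesis by simp
qed

end

section \<open>The residual\<close>

context mode_expansion
begin

definition res :: "nat \<Rightarrow> 'w \<Rightarrow> real^'d \<Rightarrow> complex" where
  "res N \<omega> x = u\<epsilon> \<omega> x - (\<Sum>n<N. (\<epsilon> ^ n) *\<^sub>R u n \<omega> x)"

definition Dres :: "nat \<Rightarrow> 'w \<Rightarrow> real^'d \<Rightarrow> complex^'d" where
  "Dres N \<omega> x = Du\<epsilon> \<omega> x - (\<Sum>n<N. (\<epsilon> ^ n) *\<^sub>R Du n \<omega> x)"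

definition \<tau>res :: "nat \<Rightarrow> 'w \<Rightarrow> real^'d \<Rightarrow> complex" where
  "\<tau>res N \<omega> x = \<tau>u\<epsilon> \<omega> x - (\<Sum>n<N. (\<epsilon> ^ n) *\<^sub>R \<tau>u n \<omega> x)"

abbreviation perturbation :: "'w \<Rightarrow> real^'d \<Rightarrow> complex" where
  "perturbation \<omega> x \<equiv> of_real (k\<^sup>2 * (2 * \<epsilon> * \<eta> \<omega> x + \<epsilon>\<^sup>2 * (\<eta> \<omega> x)\<^sup>2))"

abbreviation bperturbation :: "'w \<Rightarrow> real^'d \<Rightarrow> complex" where
  "bperturbation \<omega> x \<equiv> \<i> * of_real (k * \<epsilon> * \<eta> \<omega> x)"

text \<open>The data of the residual as a solution for \<alpha> = 1: the shifted data of
  \<open>u\<epsilon>\<close> minus the weighted data of the modes.\<close>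

definition rdata :: "nat \<Rightarrow> 'w \<Rightarrow> real^'d \<Rightarrow> complex" where
  "rdata N \<omega> x = f \<omega> x + perturbation \<omega> x * u\<epsilon> \<omega> x - (\<Sum>n<N. (\<epsilon> ^ n) *\<^sub>R mode_source n \<omega> x)"

definition brdata :: "nat \<Rightarrow> 'w \<Rightarrow> real^'d \<Rightarrow> complex" where
  "brdata N \<omega> x = - bperturbation \<omega> x * \<tau>u\<epsilon> \<omega> x - (\<Sum>n<N. (\<epsilon> ^ n) *\<^sub>R bsource n \<omega> x)"

lemma zero_in: "(\<lambda>\<omega> x. 0 :: complex) \<in> L2L2 P S"
  by (intro L2L2_const finite_P continuous_L2_S) simp

lemma u\<epsilon>_L2H1: "L2H1 P D u\<epsilon> Du\<epsilon> \<tau>u\<epsilon>"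
  using u_eps by (simp add: weak_solution_def)

lemma rdata_in: "rdata N \<in> L2L2 P \<mu>" "brdata N \<in> L2L2 P S"
proof (induction N)
  case 0
  {
    case 1
    show ?case unfolding rdata_def[abs_def]
      using L2L2_add[OF f perturbation_in[OF eta_D L2H1_D(1)[OF u\<epsilon>_L2H1]]] by simp
  next
    case 2
    show ?case unfolding brdata_def[abs_def]
      using boundary_perturbation_in[OF eta_bd L2H1_D(3)[OF u\<epsilon>_L2H1]] by simp
  }
next
  case (Suc N)
  have "rdata (Suc N) = (\<lambda>\<omega> x. rdata N \<omega> x + (- (\<epsilon> ^ N)) *\<^sub>R mode_source N \<omega> x)"
    "brdata (Suc N) = (\<lambda>\<omega> x. brdata N \<omega> x + (- (\<epsilon> ^ N)) *\<^sub>R bsource N \<omega> x)"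
    by (simp_all add: rdata_def brdata_def fun_eq_iff)
  then show "rdata (Suc N) \<in> L2L2 P \<mu>" "brdata (Suc N) \<in> L2L2 P S"
    using L2L2_lincomb[OF Suc(1) mode_source_in[of N], of "- (\<epsilon> ^ N)"]
      L2L2_lincomb[OF Suc(2) bsource_in[of N], of "- (\<epsilon> ^ N)"] by simp_all
qed

text \<open>Each step of the induction subtracts one more mode, by linearity of the unperturbed
  problem.\<close>

lemma res_unit_index: "weak_solution P D k (\<lambda>\<omega> x. 1) (rdata N) (brdata N) (res N) (Dres N) (\<tau>res N)"
proof (induction N)
  case 0
  have "weak_solution P D k (\<lambda>\<omega> x. 1) (\<lambda>\<omega> x. f \<omega> x + perturbation \<omega> x * u\<epsilon> \<omega> x)
      (\<lambda>\<omega> x. 0 - bperturbation \<omega> x * \<tau>u\<epsilon> \<omega> x) u\<epsilon> Du\<epsilon> \<tau>u\<epsilon>"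
    using u_eps weak_solution_shift[OF eta_D eta_bd f zero_in, where k = k and \<epsilon> = \<epsilon> and u = u\<epsilon> and Du = Du\<epsilon> and \<tau> = \<tau>u\<epsilon>]
    by blast
  moreover have "rdata 0 = (\<lambda>\<omega> x. f \<omega> x + perturbation \<omega> x * u\<epsilon> \<omega> x)"
    "brdata 0 = (\<lambda>\<omega> x. 0 - bperturbation \<omega> x * \<tau>u\<epsilon> \<omega> x)" "res 0 = u\<epsilon>" "Dres 0 = Du\<epsilon>" "\<tau>res 0 = \<tau>u\<epsilon>"
    by (simp_all add: rdata_def brdata_def res_def Dres_def \<tau>res_def fun_eq_iff)
  ultimately show ?case by simp
next
  case (Suc N)
  have "rdata (Suc N) = (\<lambda>\<omega> x. rdata N \<omega> x + (- (\<epsilon> ^ N)) *\<^sub>R mode_source N \<omega> x)"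
    "brdata (Suc N) = (\<lambda>\<omega> x. brdata N \<omega> x + (- (\<epsilon> ^ N)) *\<^sub>R bsource N \<omega> x)"
    "res (Suc N) = (\<lambda>\<omega> x. res N \<omega> x + (- (\<epsilon> ^ N)) *\<^sub>R u N \<omega> x)"
    "Dres (Suc N) = (\<lambda>\<omega> x. Dres N \<omega> x + (- (\<epsilon> ^ N)) *\<^sub>R Du N \<omega> x)"
    "\<tau>res (Suc N) = (\<lambda>\<omega> x. \<tau>res N \<omega> x + (- (\<epsilon> ^ N)) *\<^sub>R \<tau>u N \<omega> x)"
    by (simp_all add: rdata_def brdata_def res_def Dres_def \<tau>res_def fun_eq_iff)
  then show ?case
    using weak_solution_lincomb[OF rdata_in(1) mode_source_in rdata_in(2) bsource_in Suc mode, of "- (\<epsilon> ^ N)"] by simp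
qed

text \<open>All powers of \<epsilon> below N cancel between the expansion of the perturbation and
  the mode equations. Splitting off the perturbation of the residual leaves order N and one term
  with \<eta>^2 of order N + 1, which accounts for the parameter q = \<epsilon> of
  \<open>source\<close>. The formula starts at N = 1, where the datum f has been cancelled by the
  first mode.\<close>

lemma rdata_eq: "rdata (Suc m) \<omega> x = (\<epsilon> ^ Suc m) *\<^sub>R source \<epsilon> (Suc m) \<omega> x + perturbation \<omega> x * res (Suc m) \<omega> x"
proof (induction m)
  case 0
  show ?case
    by (simp add: rdata_def res_def mode_source_def source_def lag_def scaleR_conv_of_real)
      (simp add: algebra_simps power2_eq_square)
next
  case (Suc m)
  have "rdata (Suc (Suc m)) \<omega> x = rdata (Suc m) \<omega> x - (\<epsilon> ^ Suc m) *\<^sub>R source 0 (Suc m) \<omega> x"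
    by (simp add: rdata_def mode_source_def)
  moreover have "res (Suc (Suc m)) \<omega> x = res (Suc m) \<omega> x - (\<epsilon> ^ Suc m) *\<^sub>R u (Suc m) \<omega> x"
    by (simp add: res_def)
  moreover have "source \<epsilon> (Suc m) \<omega> x = source 0 (Suc m) \<omega> x + of_real (\<epsilon> * k\<^sup>2 * (\<eta> \<omega> x)\<^sup>2) * u m \<omega> x"
    by (simp add: source_def lag_def algebra_simps)
  moreover have "source \<epsilon> (Suc (Suc m)) \<omega> x = of_real (2 * k\<^sup>2 * \<eta> \<omega> x + \<epsilon> * k\<^sup>2 * (\<eta> \<omega> x)\<^sup>2) * u (Suc m) \<omega> x
     + of_real (k\<^sup>2 * (\<eta> \<omega> x)\<^sup>2) * u m \<omega> x"
    by (simp add: source_def lag_def)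
  ultimately show ?case unfolding Suc.IH
    by (simp add: scaleR_conv_of_real) (simp add: algebra_simps power2_eq_square)
qed

text \<open>The boundary coefficient is linear in \<epsilon>, so no term of order N + 1 is left and
  \<open>bsource\<close> carries no parameter.\<close>

lemma brdata_eq: "brdata (Suc m) \<omega> x = (\<epsilon> ^ Suc m) *\<^sub>R bsource (Suc m) \<omega> x - bperturbation \<omega> x * \<tau>res (Suc m) \<omega> x"
proof (induction m)
  case 0
  show ?case
    by (simp add: brdata_def \<tau>res_def bsource_def lag_def scaleR_conv_of_real) (simp add: algebra_simps)
next
  case (Suc m)
  have "brdata (Suc (Suc m)) \<omega> x = brdata (Suc m) \<omega> x - (\<epsilon> ^ Suc m) *\<^sub>R bsource (Suc m) \<omega> x"
    by (simp add: brdata_def)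
  moreover have "\<tau>res (Suc (Suc m)) \<omega> x = \<tau>res (Suc m) \<omega> x - (\<epsilon> ^ Suc m) *\<^sub>R \<tau>u (Suc m) \<omega> x"
    by (simp add: \<tau>res_def)
  moreover have "bsource (Suc (Suc m)) \<omega> x = - \<i> * of_real (k * \<eta> \<omega> x) * \<tau>u (Suc m) \<omega> x"
    by (simp add: bsource_def lag_def)
  ultimately show ?case unfolding Suc.IH
    by (simp add: scaleR_conv_of_real) (simp add: algebra_simps)
qed

text \<open>The terms that contain the residual itself are moved back to the left side, which
  restores the perturbed coefficient and leaves data of order \<epsilon>^N.\<close>

lemma res_solution:
  "weak_solution P D k (\<lambda>\<omega> x. 1 + \<epsilon> * \<eta> \<omega> x) (\<lambda>\<omega> x. (\<epsilon> ^ Suc m) *\<^sub>R source \<epsilon> (Suc m) \<omega> x)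
    (\<lambda>\<omega> x. (\<epsilon> ^ Suc m) *\<^sub>R bsource (Suc m) \<omega> x) (res (Suc m)) (Dres (Suc m)) (\<tau>res (Suc m))"
proof (rule weak_solution_shift[THEN iffD2, OF eta_D eta_bd])
  have "rdata (Suc m) = (\<lambda>\<omega> x. (\<epsilon> ^ Suc m) *\<^sub>R source \<epsilon> (Suc m) \<omega> x + perturbation \<omega> x * res (Suc m) \<omega> x)"
    "brdata (Suc m) = (\<lambda>\<omega> x. (\<epsilon> ^ Suc m) *\<^sub>R bsource (Suc m) \<omega> x - bperturbation \<omega> x * \<tau>res (Suc m) \<omega> x)"
    using rdata_eq brdata_eq by (auto simp only: fun_eq_iff)
  then show "weak_solution P D k (\<lambda>\<omega> x. 1)
      (\<lambda>\<omega> x. (\<epsilon> ^ Suc m) *\<^sub>R source \<epsilon> (Suc m) \<omega> x + perturbation \<omega> x * res (Suc m) \<omega> x)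
      (\<lambda>\<omega> x. (\<epsilon> ^ Suc m) *\<^sub>R bsource (Suc m) \<omega> x - bperturbation \<omega> x * \<tau>res (Suc m) \<omega> x)
      (res (Suc m)) (Dres (Suc m)) (\<tau>res (Suc m))"
    using res_unit_index[of "Suc m"] by simp
qed (intro L2L2_scaleR source_in bsource_in)+

section \<open>Estimates\<close>

abbreviation M :: real where "M \<equiv> mean_sq P \<mu> f"
abbreviation c :: real where "c \<equiv> C0 * (1 + k)\<^sup>2"
abbreviation A :: real where "A \<equiv> c / k ^ 4 * M"
abbreviation src :: "real \<Rightarrow> nat \<Rightarrow> real" where
  "src q n \<equiv> mean_sq P \<mu> (source q n) + mean_sq P S (bsource n)"

lemma M_nonneg: "0 \<le> M"
  by (intro Bochner_Integration.integral_nonneg) simp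

lemma c_ge: "1 \<le> c"
  by (rule stability_const_lower_bound[OF C0(2) parameters(3) C0(1) parameters(1) prob])

lemma k_factor: "C0 * (1 / k + 1 / k\<^sup>2)\<^sup>2 = c / k ^ 4"
proof -
  have "1 / k + 1 / k\<^sup>2 = (1 + k) / k\<^sup>2" using parameters(1) by (simp add: field_simps power2_eq_square)
  then show ?thesis by (simp add: power_divide flip: power_mult)
qed

lemma gamma0_positive: "0 * (2 + 0) < gamma0 CARD('d) k"
  using gamma0_pos[OF dim parameters(1)] by simp

lemma mode_bound: "X n + T n \<le> c / k ^ 4 * (mean_sq P \<mu> (mode_source n)
    + mean_sq P S (bsource n))"
  using stability(1)[OF C0(2) parameters(3) order_refl gamma0_positive mode_source_in[of n] bsource_in[of n],
      where u = "u n" and Du = "Du n" and \<tau> = "\<tau>u n"]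
    mode[of n] by (simp add: k_factor)

lemma bsource_0: "bsource 0 \<omega> = (\<lambda>x. 0)"
  by (simp add: bsource_def lag_def fun_eq_iff)

lemma first_mode: "X 0 + T 0 \<le> A"
  using mode_bound[of 0] by (simp add: mode_source_def bsource_0 L2_norm_def)

lemma first_mode_H1: "X 0 + mean_sq P \<mu> (Du 0) \<le> ((k\<^sup>2 + 1) / (k + 1))\<^sup>2 * A"
proof -
  have "X 0 + mean_sq P \<mu> (Du 0) \<le> C0 * (1 + 1 / k\<^sup>2)\<^sup>2 * M"
    using stability(2)[OF C0(2) parameters(3) order_refl gamma0_positive mode_source_in[of 0] bsource_in[of 0],
        where u = "u 0" and Du = "Du 0" and \<tau> = "\<tau>u 0"]
      mode[of 0] by (simp add: mode_source_def bsource_0 L2_norm_def)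
  also have "C0 * (1 + 1 / k\<^sup>2)\<^sup>2 * M = ((k\<^sup>2 + 1) / (k + 1))\<^sup>2 * A"
  proof -
    have e: "1 + 1 / k\<^sup>2 = (k\<^sup>2 + 1) / k\<^sup>2" using parameters(1) by (simp add: field_simps)
    have "C0 * (1 + 1 / k\<^sup>2)\<^sup>2 = C0 * (k\<^sup>2 + 1)\<^sup>2 / k ^ 4"
      unfolding e by (simp add: power_divide flip: power_mult)
    moreover have "((k\<^sup>2 + 1) / (k + 1))\<^sup>2 * c = C0 * (k\<^sup>2 + 1)\<^sup>2"
      using parameters(1) by (simp add: power_divide add.commute)
    ultimately have "C0 * (1 + 1 / k\<^sup>2)\<^sup>2 = ((k\<^sup>2 + 1) / (k + 1))\<^sup>2 * c / k ^ 4"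
      by metis
    then show ?thesis by simp
  qed
  finally show ?thesis .
qed

lemma friedrichs_mean:
  assumes b: "0 < b" "b < 1"
  shows "(3 * b - b\<^sup>2) * X n \<le> (3 * b - b\<^sup>2) / (1 - b) * T n + mean_sq P \<mu> (Du n)"
proof -
  note int = mode_in(1-3)[THEN bochner_L2_integrable, of n]
  have "(LINT \<omega>|P. (3 * b - b\<^sup>2) * (L2_norm \<mu> (u n \<omega>))\<^sup>2)
    \<le> (LINT \<omega>|P. (3 * b - b\<^sup>2) / (1 - b) * (L2_norm S (\<tau>u n \<omega>))\<^sup>2 + (L2_norm \<mu> (Du n \<omega>))\<^sup>2)"
  proof (rule integral_mono_AE)
    show "AE \<omega> in P. (3 * b - b\<^sup>2) * (L2_norm \<mu> (u n \<omega>))\<^sup>2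
        \<le> (3 * b - b\<^sup>2) / (1 - b) * (L2_norm S (\<tau>u n \<omega>))\<^sup>2 + (L2_norm \<mu> (Du n \<omega>))\<^sup>2"
      using L2H1_D(4)[OF mode_L2H1[of n]] by eventually_elim (rule friedrichs[OF _ b])
  qed (use int in auto)
  then show ?thesis using int by simp
qed

text \<open>The case N = 1. As k^4 A = c M, the right side is 9/2 c M = 9/32 * (16 c) M, exactly
  what the theorem demands.\<close>

lemma source_bound: "src \<epsilon> 1 \<le> k ^ 4 * (9 / 2 * A)"
proof -
  have k: "k > 0" using parameters(1) by simp
  have small': "\<epsilon> * (2 + \<epsilon>) < 11 / (25 * k - 6)"
    using small gamma0_le[OF dim parameters(1)] by linarith
  have "src \<epsilon> 1 \<le> k ^ 4 * (2 + \<epsilon>)\<^sup>2 * X 0 + k\<^sup>2 * T 0"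
    using source_norm_1[of \<epsilon>] bsource_norm[of 0] parameters(2) by simp
  also have "\<dots> = k ^ 4 * ((2 + \<epsilon>)\<^sup>2 * X 0 + 1 / k\<^sup>2 * T 0)"
    using k by (simp add: field_simps power2_eq_square power4_eq_xxxx)
  also have "\<dots> \<le> k ^ 4 * (9 / 2 * A)"
  proof (rule mult_left_mono[OF first_mode_bound[OF parameters(1,2) small' X_nonneg T_nonneg first_mode]])
    fix b :: real assume "0 < b" "b < 1"
    then show "(3 * b - b\<^sup>2) * X 0 \<le> (3 * b - b\<^sup>2) / (1 - b) * T 0 + (((k\<^sup>2 + 1) / (k + 1))\<^sup>2 * A - X 0)"
      using friedrichs_mean[of b 0] first_mode_H1 by linarith
  qed simp
  finally show ?thesis .
qed

text \<open>The smaller factor k^2 of the boundary term is raised to the interior coefficient, so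
  that only the sums X + T enter and a scalar recursion results.\<close>

lemma source_le:
  assumes q: "0 \<le> q"
  shows "src q (n + 2) \<le> k ^ 4 * (2 * (2 + q)\<^sup>2 * (X (n + 1) + T (n + 1)) + 2 * (X n + T n))"
proof -
  have "k\<^sup>2 * T (n + 1) \<le> k ^ 4 * T (n + 1)"
    using parameters(1) T_nonneg by (intro mult_right_mono power_increasing) auto
  also have "\<dots> \<le> k ^ 4 * (2 * (2 + q)\<^sup>2 * T (n + 1))"
  proof (rule mult_left_mono)
    have "1 \<le> 2 * (2 + q)\<^sup>2" using q by (simp add: power2_eq_square algebra_simps)
    then show "T (n + 1) \<le> 2 * (2 + q)\<^sup>2 * T (n + 1)"
      using mult_right_mono[of 1 "2 * (2 + q)\<^sup>2" "T (n + 1)"] T_nonneg by simp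
  qed simp
  finally have "k\<^sup>2 * T (n + 1) \<le> k ^ 4 * (2 * (2 + q)\<^sup>2 * T (n + 1))" .
  moreover have "0 \<le> k ^ 4 * (2 * T n)" using T_nonneg by simp
  moreover have "mean_sq P S (bsource (n + 2)) \<le> k\<^sup>2 * T (n + 1)"
    using bsource_norm[of "n + 1"] by simp
  moreover have "k ^ 4 * (2 * (2 + q)\<^sup>2 * (X (n + 1) + T (n + 1)) + 2 * (X n + T n))
      = k ^ 4 * (2 * (2 + q)\<^sup>2) * X (n + 1) + k ^ 4 * (2 * (2 + q)\<^sup>2 * T (n + 1)) + k ^ 4 * 2 * X n + k ^ 4 * (2 * T n)"
    by (simp only: distrib_left mult.assoc add_ac)
  ultimately show ?thesis
    using source_norm[OF q, of n] by linarith
qed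

lemma mode_growth: "X (Suc n) + T (Suc n) \<le> (16 * c) ^ Suc n * A / 4"
proof (rule two_term_growth[where a = "\<lambda>n. X n + T n" and c = c and A = A, OF c_ge _ _ first_mode])
  have k: "k > 0" using parameters(1) by simp
  have pos: "0 \<le> c / k ^ 4" using C0(1) k by simp
  have cancel: "c / k ^ 4 * (k ^ 4 * y) = c * y" for y using k by simp
  have "src 0 1 \<le> k ^ 4 * 4 * X 0 + k\<^sup>2 * T 0"
    using source_norm_1[of 0] bsource_norm[of 0] by simp
  also have "k\<^sup>2 * T 0 \<le> k ^ 4 * T 0"
    using parameters(1) T_nonneg by (intro mult_right_mono power_increasing) auto
  also have "k ^ 4 * 4 * X 0 + k ^ 4 * T 0 \<le> k ^ 4 * (4 * (X 0 + T 0))"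
    using T_nonneg[of 0] k by (simp add: distrib_left)
  finally have "src 0 1 \<le> k ^ 4 * (4 * (X 0 + T 0))" by simp
  from mult_left_mono[OF this pos] have "c / k ^ 4 * src 0 1 \<le> c * (4 * (X 0 + T 0))"
    unfolding cancel .
  moreover have "X 1 + T 1 \<le> c / k ^ 4 * src 0 1"
    using mode_bound[of 1] by (simp add: mode_source_def)
  ultimately have "X 1 + T 1 \<le> c * (4 * (X 0 + T 0))" by (rule order_trans[rotated])
  also have "\<dots> = 4 * c * (X 0 + T 0)" by (simp only: mult_ac)
  finally show "X 1 + T 1 \<le> 4 * c * (X 0 + T 0)" .
  fix n
  \<comment> \<open>At q = 0 the coefficient 2 (2 + q)^2 is 8.\<close>
  have "src 0 (n + 2) \<le> k ^ 4 * (8 * (X (n + 1) + T (n + 1)) + 2 * (X n + T n))"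
    using source_le[of 0 n] by simp
  from mult_left_mono[OF this pos]
  have "c / k ^ 4 * src 0 (n + 2) \<le> c * (8 * (X (n + 1) + T (n + 1)) + 2 * (X n + T n))"
    unfolding cancel .
  then show "X (n + 2) + T (n + 2) \<le> c * (8 * (X (n + 1) + T (n + 1)) + 2 * (X n + T n))"
    using mode_bound[of "n + 2"] by (simp add: mode_source_def)
  show "0 \<le> A" using pos M_nonneg by (rule mult_nonneg_nonneg)
qed

text \<open>N = 1 is \<open>source_bound\<close>. For larger N the growth of the modes suffices, and
  the lossy constants of \<open>source_le\<close> are affordable.\<close>

lemma residual_source: "src \<epsilon> (Suc m) \<le> 9 / 32 * (16 * c) ^ Suc m * M"
proof -
  have k: "k > 0" using parameters(1) by simp
  have kA: "k ^ 4 * A = c * M" using k by simp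
  have A0: "0 \<le> A" using C0(1) k M_nonneg by simp
  show ?thesis
  proof (cases m)
    case 0
    have "k ^ 4 * (9 / 2 * A) = 9 / 2 * (k ^ 4 * A)" by simp
    then show ?thesis using source_bound 0 unfolding kA by simp
  next
    case (Suc n)
    define B where "B = (16 * c) ^ n * A"
    have B0: "0 \<le> B" using A0 C0(1) by (simp add: B_def)
    \<comment> \<open>\<open>mode_growth\<close> has the factor 1/4 for positive indices only, so n
      = 0 falls back on the stability bound A.\<close>
    have an: "X n + T n \<le> B"
    proof (cases n)
      case 0
      then show ?thesis using first_mode by (simp add: B_def)
    next
      case (Suc l)
      have "X n + T n \<le> B / 4" using mode_growth[of l] by (simp add: B_def Suc)
      then show ?thesis using B0 by linarith
    qed
    have an1: "X (n + 1) + T (n + 1) \<le> 4 * (c * B)"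
      using mode_growth[of n] by (simp add: B_def mult_ac)
    \<comment> \<open>Already \<epsilon> (2 + \<epsilon>) < 11/19 < 1 gives this crude
      bound.\<close>
    have eps: "2 * (2 + \<epsilon>)\<^sup>2 \<le> 12"
    proof -
      have "11 / (25 * k - 6) \<le> 11 / 19" using parameters(1) by (intro divide_left_mono) auto
      then have "\<epsilon> * (2 + \<epsilon>) < 1" using small gamma0_le[OF dim parameters(1)] by linarith
      moreover have "2 * (2 + \<epsilon>)\<^sup>2 = 8 + 4 * (\<epsilon> * (2 + \<epsilon>)) - 2 * \<epsilon>\<^sup>2"
        by (simp add: power2_eq_square algebra_simps)
      ultimately show ?thesis using zero_le_power2[of \<epsilon>] by linarith
    qed
    have "src \<epsilon> (n + 2) \<le> k ^ 4 * (2 * (2 + \<epsilon>)\<^sup>2 * (X (n + 1) + T (n + 1)) + 2 * (X n + T n))"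
      using parameters(2) by (intro source_le) simp
    also have "\<dots> \<le> k ^ 4 * (12 * (4 * (c * B)) + 2 * (c * B))"
    proof (intro mult_left_mono add_mono mult_mono eps an1)
      have "1 * B \<le> c * B" by (rule mult_right_mono[OF c_ge B0])
      then show "X n + T n \<le> c * B" using an by simp
    qed (use X_nonneg T_nonneg in \<open>auto intro: add_nonneg_nonneg\<close>)
    \<comment> \<open>The left side is 12 * 4 + 2 = 50 times the product, and 72 = 9/32 *
      16^2.\<close>
    also have "\<dots> \<le> 72 * (c * (k ^ 4 * B))"
      using C0(1) B0 by simp
    also have "k ^ 4 * B = (16 * c) ^ n * (c * M)"
      unfolding B_def kA[symmetric] by simp
    also have "72 * (c * ((16 * c) ^ n * (c * M))) = 9 / 32 * (16 * c) ^ Suc m * M"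
      unfolding Suc by simp
    finally show ?thesis by (simp add: Suc)
  qed
qed

lemma residual_data:
  "(LINT \<omega>|P. (L2_norm \<mu> (\<lambda>x. (\<epsilon> ^ N) *\<^sub>R source \<epsilon> N \<omega> x))\<^sup>2)
    + (LINT \<omega>|P. (L2_norm S (\<lambda>x. (\<epsilon> ^ N) *\<^sub>R bsource N \<omega> x))\<^sup>2) = (\<epsilon> ^ N)\<^sup>2 * src \<epsilon> N"
  by (simp add: L2_norm_scaleR power_mult_distrib distrib_left)

lemma residual_bound:
  assumes \<sigma>: "\<sigma> = 4 * \<epsilon> * sqrt C0 * (1 + k)" and N: "N \<ge> 1" and j: "j \<in> {0, 1}"
  shows "(LINT \<omega>|P. (Hj_norm j D (res N \<omega>) (Dres N \<omega>))\<^sup>2)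
    \<le> 9 * C0 * \<sigma> ^ (2 * N) / (32 * (1 + k)\<^sup>2) * (k ^ j + 1 / k) ^ 4 * M"
proof -
  obtain m where m: "N = Suc m" using N by (cases N) auto
  have k: "k > 0" using parameters(1) by simp
  have \<sigma>2: "\<sigma> ^ (2 * N) = (\<epsilon> ^ N)\<^sup>2 * (16 * c) ^ N"
  proof -
    have "\<sigma>\<^sup>2 = \<epsilon>\<^sup>2 * (16 * c)"
      unfolding \<sigma> power_mult_distrib real_sqrt_pow2[OF less_imp_le[OF C0(1)]] by simp
    then show ?thesis by (simp add: power_mult power_mult_distrib) (simp add: power_mult[symmetric] mult.commute)
  qed
  have data: "(\<epsilon> ^ N)\<^sup>2 * src \<epsilon> N \<le> 9 / 32 * \<sigma> ^ (2 * N) * M"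
  proof -
    have "9 / 32 * \<sigma> ^ (2 * N) * M = (\<epsilon> ^ N)\<^sup>2 * (9 / 32 * (16 * c) ^ N * M)"
      unfolding \<sigma>2 by simp
    then show ?thesis unfolding m using residual_source[of m] by (simp only: mult_left_mono zero_le_power2)
  qed
  have sol: "weak_solution P D k (\<lambda>\<omega> x. 1 + \<epsilon> * \<eta> \<omega> x) (\<lambda>\<omega> x. (\<epsilon> ^ N) *\<^sub>R source \<epsilon> N \<omega> x)
    (\<lambda>\<omega> x. (\<epsilon> ^ N) *\<^sub>R bsource N \<omega> x) (res N) (Dres N) (\<tau>res N)"
    unfolding m by (rule res_solution)
  have L2H1: "L2H1 P D (res N) (Dres N) (\<tau>res N)" using sol by (simp add: weak_solution_def)
  note st = stability[OF C0(2) parameters(3) less_imp_le[OF parameters(2)] small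
      L2L2_scaleR[OF source_in] L2L2_scaleR[OF bsource_in] sol, unfolded residual_data]
  have pos: "0 \<le> 9 / 32 * \<sigma> ^ (2 * N) * M"
    using M_nonneg by (simp add: power_mult)
  consider "j = 0" | "j = 1" using j by auto
  then show ?thesis
  proof cases
    case 1
    have "mean_sq P \<mu> (res N) \<le> C0 * (1 / k + 1 / k\<^sup>2)\<^sup>2 * ((\<epsilon> ^ N)\<^sup>2 * src \<epsilon> N)"
    proof -
      have "0 \<le> mean_sq P S (\<tau>res N)" by (intro Bochner_Integration.integral_nonneg) simp
      then show ?thesis using st(1) by linarith
    qed
    also have "\<dots> \<le> C0 * (1 / k + 1 / k\<^sup>2)\<^sup>2 * (9 / 32 * \<sigma> ^ (2 * N) * M)"
      using C0(1) by (intro mult_left_mono data) auto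
    \<comment> \<open>For j = 0 the claimed prefactor equals the one of stability, since (1 + 1/k)^4
      = (1 + k)^4 / k^4.\<close>
    also have "C0 * (1 / k + 1 / k\<^sup>2)\<^sup>2 = C0 / (1 + k)\<^sup>2 * (1 + 1 / k) ^ 4"
    proof -
      have e: "1 + 1 / k = (1 + k) / k" using k by (simp add: field_simps)
      have p4: "(1 + k) ^ 4 = (1 + k)\<^sup>2 * (1 + k)\<^sup>2" by (simp flip: power_add)
      have "C0 / (1 + k)\<^sup>2 * (1 + 1 / k) ^ 4 = C0 / (1 + k)\<^sup>2 * (((1 + k)\<^sup>2 * (1 + k)\<^sup>2) / k ^ 4)"
        unfolding e power_divide p4 ..
      also have "\<dots> = c / k ^ 4"
      proof -
        have "C0 / s * ((s * s) / K) = C0 * s / K" if "s \<noteq> 0" for s K :: real using that by simp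
        then show ?thesis using k by (metis less_irrefl add_pos_pos zero_less_one zero_less_power)
      qed
      finally show ?thesis by (simp add: k_factor)
    qed
    finally show ?thesis using 1 by (simp add: Hj_norm_0 mult_ac)
  next
    case 2
    note int = L2H1_D(1,2)[OF L2H1, THEN bochner_L2_integrable]
    have "(LINT \<omega>|P. (Hj_norm 1 D (res N \<omega>) (Dres N \<omega>))\<^sup>2) \<le> C0 * (1 + 1 / k\<^sup>2)\<^sup>2 * ((\<epsilon> ^ N)\<^sup>2 * src \<epsilon> N)"
      using st(2) int unfolding Hj_norm_1_sq by simp
    also have "\<dots> \<le> C0 * (1 + 1 / k\<^sup>2)\<^sup>2 * (9 / 32 * \<sigma> ^ (2 * N) * M)"
      using C0(1) by (intro mult_left_mono data) auto
    also have "\<dots> \<le> C0 / (1 + k)\<^sup>2 * (k + 1 / k) ^ 4 * (9 / 32 * \<sigma> ^ (2 * N) * M)"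
    proof (rule mult_right_mono[OF _ pos])
      have e1: "1 + 1 / k\<^sup>2 = (k\<^sup>2 + 1) / k\<^sup>2" and e2: "k + 1 / k = (k\<^sup>2 + 1) / k"
        using k by (simp_all add: field_simps power2_eq_square)
      \<comment> \<open>For j = 1, comparing the prefactors comes down to 1 + k <= k^2 + 1, that is,
        to k >= 1.\<close>
      have "(1 + k)\<^sup>2 \<le> (k\<^sup>2 + 1)\<^sup>2"
        using parameters(1) by (intro power_mono) (auto simp: power2_eq_square)
      then have "(k\<^sup>2 + 1)\<^sup>2 * (1 + k)\<^sup>2 \<le> (k\<^sup>2 + 1)\<^sup>2 * (k\<^sup>2 + 1)\<^sup>2"
        by (intro mult_left_mono) auto
      then have "(k\<^sup>2 + 1)\<^sup>2 \<le> (k\<^sup>2 + 1) ^ 4 / (1 + k)\<^sup>2"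
        using k by (simp add: pos_le_divide_eq flip: power_add)
      then have "C0 / k ^ 4 * (k\<^sup>2 + 1)\<^sup>2 \<le> C0 / k ^ 4 * ((k\<^sup>2 + 1) ^ 4 / (1 + k)\<^sup>2)"
        using C0(1) k by (intro mult_left_mono) auto
      then show "C0 * (1 + 1 / k\<^sup>2)\<^sup>2 \<le> C0 / (1 + k)\<^sup>2 * (k + 1 / k) ^ 4"
        unfolding e1 e2 by (simp add: power_divide mult_ac flip: power_mult)
    qed
    finally show ?thesis using 2 by (simp add: mult_ac)
  qed
qed

end

theorem theorem3p3:
  fixes P :: "'w measure"
    and D :: "(real^'d) set"
    and \<eta> :: "'w \<Rightarrow> real^'d \<Rightarrow> real"
    and k \<epsilon> c0 C0 \<sigma> :: real
    and f u\<epsilon> \<tau>u\<epsilon> :: "'w \<Rightarrow> real^'d \<Rightarrow> complex"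
    and Du\<epsilon> :: "'w \<Rightarrow> real^'d \<Rightarrow> complex^'d"
    and u \<tau>u :: "nat \<Rightarrow> 'w \<Rightarrow> real^'d \<Rightarrow> complex"
    and Du :: "nat \<Rightarrow> 'w \<Rightarrow> real^'d \<Rightarrow> complex^'d"
    and N j :: nat
  assumes dim: "CARD('d) \<in> {1, 2, 3}"
    and domain: "convex_polygonal_domain D" "D \<subseteq> ball 0 1" "star_shaped_const D c0"
    and parameters: "k \<ge> 1" "\<epsilon> > 0"
    and prob: "prob_space P"
    and eta_D: "\<eta> \<in> L2Linf P (lebesgue_on D)"
      "AE \<omega> in P. Linf_norm (lebesgue_on D) (\<eta> \<omega>) \<le> 1"
    and eta_bd: "\<eta> \<in> L2Linf P (surface_measure D)"
      "AE \<omega> in P. Linf_norm (surface_measure D) (\<eta> \<omega>) \<le> 1"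
    and C0: "C0 > 0" "stability_const P D c0 \<eta> k C0"
    and f: "f \<in> L2L2 P (lebesgue_on D)"
    and u_eps: "weak_solution P D k (\<lambda>\<omega> x. 1 + \<epsilon> * \<eta> \<omega> x) f (\<lambda>\<omega> x. 0) u\<epsilon> Du\<epsilon> \<tau>u\<epsilon>"
    and modes: "\<And>n. weak_solution P D k (\<lambda>\<omega> x. 1)
          (\<lambda>\<omega> x. if n = 0 then f \<omega> x
                 else of_real (2 * k\<^sup>2 * \<eta> \<omega> x) * lag u 1 n \<omega> x
                    + of_real (k\<^sup>2 * (\<eta> \<omega> x)\<^sup>2) * lag u 2 n \<omega> x)
          (\<lambda>\<omega> x. - \<i> * of_real (k * \<eta> \<omega> x) * lag \<tau>u 1 n \<omega> x)
          (u n) (Du n) (\<tau>u n)"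
    and sigma: "\<sigma> = 4 * \<epsilon> * sqrt C0 * (1 + k)"
    and small: "\<epsilon> * (2 + \<epsilon>) < gamma0 CARD('d) k" "\<sigma> < 1"
    and N: "N \<ge> 1"
    and j: "j \<in> {0, 1}"
  shows "(LINT \<omega>|P. (Hj_norm j D
              (\<lambda>x. u\<epsilon> \<omega> x - (\<Sum>n<N. of_real (\<epsilon> ^ n) * u n \<omega> x))
              (\<lambda>x. Du\<epsilon> \<omega> x - (\<Sum>n<N. (\<epsilon> ^ n) *\<^sub>R Du n \<omega> x)))\<^sup>2)
         \<le> 9 * C0 * \<sigma> ^ (2 * N) / (32 * (1 + k)\<^sup>2) * (k ^ j + 1 / k) ^ 4
             * (LINT \<omega>|P. (L2_norm (lebesgue_on D) (f \<omega>))\<^sup>2)"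
proof -
  have c0: "c0 > 0" using domain(3) by (simp add: star_shaped_const_def)
  have "helmholtz_domain D"
    by (intro helmholtz_domain.intro polygonal_domain.intro helmholtz_domain_axioms.intro domain dim)
  then interpret mode_expansion D P \<eta> k \<epsilon> c0 C0 f u\<epsilon> \<tau>u\<epsilon> Du\<epsilon> u \<tau>u Du
    by (intro mode_expansion.intro mode_expansion_axioms.intro parameters c0 prob eta_D eta_bd C0 f
        u_eps modes small)
  have "(\<lambda>x. u\<epsilon> \<omega> x - (\<Sum>n<N. of_real (\<epsilon> ^ n) * u n \<omega> x)) = res N \<omega>"
    "(\<lambda>x. Du\<epsilon> \<omega> x - (\<Sum>n<N. (\<epsilon> ^ n) *\<^sub>R Du n \<omega> x)) = Dres N \<omega>" for \<omega>
    by (simp_all add: res_def Dres_def fun_eq_iff scaleR_conv_of_real[where 'a = complex])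
  then show ?thesis using residual_bound[OF sigma N j] by simp
qed

end
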